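(* Let $\lambda,\mu$ be nonzero complex numbers with $\lambda/\mu\notin\mathbb{R}$, and let $(\mathbb{D}^2,\mathcal{F},\{0\})$ be the holomorphic foliation on the unit bidisc $\mathbb{D}^2\subset\mathbb{C}^2$, with singular set $\{0\}$, associated to the linear vector field $\Phi(z,w)=\mu z\frac{\partial}{\partial z}+\lambda w\frac{\partial}{\partial w}$. Then for every harmonic current $T$ directed by $\mathcal{F}$ which does not give mass to any of the two separatrices $(z=0)$ and $(w=0)$, the Lelong number $\mathcal{L}(T,0)$ of $T$ at $0$ vanishes.
   Context: $\mathbb{D}$ is the open unit disc in $\mathbb{C}$. Let $(M,\mathcal{F},E)$ be a holomorphic foliation by Riemann surfaces with closed singular set $E$ on a complex surface $M$ (here $M=\mathbb{D}^2$, $E=\{0\}$, and the leaves in $M\setminus E$ are the integral curves of $\Phi$). Let $\mathcal{C}_{\mathcal{F}}$ (resp. $\mathcal{C}^{1,1}_{\mathcal{F}}$) be the space of functions (resp. forms of bidegree $(1,1)$) defined on the leaves, compactly supported on $M\setminus E$, leafwise smooth and transversally continuous. A form in $\mathcal{C}^{1,1}_{\mathcal{F}}$ is positive if its restriction to every plaque is a positive $(1,1)$-form. A harmonic current $T$ directed by $\mathcal{F}$ is a continuous linear form on $\mathcal{C}^{1,1}_{\mathcal{F}}$ such that (i) $T(i\partial\overline\partial f)=0$ for all $f\in\mathcal{C}_{\mathcal{F}}$, where $\partial\overline\partial$ is taken along the leaves; (ii) $T(\alpha)\ge 0$ for all positive $\alpha\in\mathcal{C}^{1,1}_{\mathcal{F}}$.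 For a local coordinate $y$ with values in $\mathbb{C}^2$, $T\wedge i\partial\overline\partial\|y\|^2$ denotes the positive measure on $M\setminus E$ (extended by zero through $E$) given by $\varphi\mapsto T(\varphi\, i\partial\overline\partial\|y\|^2)$, the form being restricted to leaves. "$T$ does not give mass to a separatrix" means that this measure gives zero mass to the separatrix (with $0$ removed). The Lelong number of $T$ at $x\in M$ is $\mathcal{L}(T,x):=\lim_{r\to0+}\frac{1}{\pi r^2}\int_{B(x,r)}T\wedge i\partial\overline\partial\|y\|^2$, where a neighborhood of $x$ is identified with an open neighborhood of $0$ in $\mathbb{C}^2$ by a biholomorphic change of coordinates sending $x$ to $0$, and $B(x,r)$ is the Euclidean ball of radius $r$ centered at $0$. (By Skoda the limit exists and is independent of the coordinates.) *)

theory Defs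
  imports "HOL-Analysis.Analysis"
begin

type_synonym pt = "complex \<times> complex"

abbreviation bidisc :: "pt set" where
  "bidisc \<equiv> ball 0 1 \<times> ball 0 1"

abbreviation punctured_bidisc :: "pt set" where
  "punctured_bidisc \<equiv> bidisc - {0}"


section \<open>The foliation of a linear vector field\<close>

definition vfield :: "complex \<Rightarrow> complex \<Rightarrow> pt \<Rightarrow> pt" where
  "vfield mu lam p = (mu * fst p, lam * snd p)"

definition flow :: "complex \<Rightarrow> complex \<Rightarrow> complex \<Rightarrow> pt \<Rightarrow> pt" where
  "flow mu lam t p = (exp (mu * t) * fst p, exp (lam * t) * snd p)"

lemma flow_0: "flow mu lam 0 p = p"
  by (simp add: flow_def)

lemma flow_integral_curve:
  "((\<lambda>t. fst (flow mu lam t p)) has_field_derivative fst (vfield mu lam (flow mu lam t p))) (at t)"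
  "((\<lambda>t. snd (flow mu lam t p)) has_field_derivative snd (vfield mu lam (flow mu lam t p))) (at t)"
  by (auto simp: flow_def vfield_def intro!: derivative_eq_intros)

text \<open>
  For \<open>p \<noteq> 0\<close> (and \<open>mu\<close>, \<open>lam\<close> nonzero) the map \<open>t \<mapsto> flow mu lam t p\<close> is, near \<open>t = 0\<close>, a holomorphic
  coordinate on the leaf through \<open>p\<close>; together with a small transversal it gives a flow box.
  All leafwise notions below are expressed in this coordinate. With \<open>t = x + i y\<close>,
  \<open>leaf_deriv mu lam v\<close> is \<open>\<partial>/\<partial>x\<close> for \<open>v = 1\<close> and \<open>\<partial>/\<partial>y\<close> for \<open>v = \<i>\<close>; since the flow is a
  one-parameter group, iterating it gives the higher derivatives in \<open>t\<close>.
\<close>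

definition leaf_deriv ::
    "complex \<Rightarrow> complex \<Rightarrow> complex \<Rightarrow> (pt \<Rightarrow> complex) \<Rightarrow> pt \<Rightarrow> complex" where
  "leaf_deriv mu lam v f p =
     vector_derivative (\<lambda>s::real. f (flow mu lam (of_real s * v) p)) (at 0)"

definition leaf_derivs ::
    "complex \<Rightarrow> complex \<Rightarrow> complex list \<Rightarrow> (pt \<Rightarrow> complex) \<Rightarrow> pt \<Rightarrow> complex" where
  "leaf_derivs mu lam vs f = foldr (leaf_deriv mu lam) vs f"

text \<open>
  Leafwise smooth and transversally continuous: leafwise derivatives of all orders exist and
  are continuous on the punctured bidisc (equivalently, jointly continuous in every flow box).
\<close>

definition leaf_smooth :: "complex \<Rightarrow> complex \<Rightarrow> (pt \<Rightarrow> complex) \<Rightarrow> bool" where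
  "leaf_smooth mu lam f \<longleftrightarrow>
     (\<forall>vs \<in> lists {1, \<i>}.
        continuous_on punctured_bidisc (leaf_derivs mu lam vs f) \<and>
        (\<forall>v \<in> {1, \<i>}. \<forall>p \<in> punctured_bidisc.
           (\<lambda>s::real. leaf_derivs mu lam vs f (flow mu lam (of_real s * v) p))
             differentiable (at 0)))"

definition test_functions :: "complex \<Rightarrow> complex \<Rightarrow> (pt \<Rightarrow> complex) set" where
  "test_functions mu lam =
     {f. leaf_smooth mu lam f \<and>
         compact (closure {p. f p \<noteq> 0}) \<and> closure {p. f p \<noteq> 0} \<subseteq> punctured_bidisc}"


section \<open>Leafwise forms of bidegree (1,1)\<close>

text \<open>
  The tangent line of the leaf at \<open>p\<close> is identified with \<open>\<complex>\<close> by \<open>a \<mapsto> a \<cdot> vfield mu lam p\<close>, i.e. by the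
  coordinate \<open>t\<close>. For a form \<open>\<alpha>\<close>, \<open>\<alpha> p a b\<close> is its value at \<open>p\<close> on the tangent vectors
  corresponding to \<open>a\<close> and \<open>b\<close>. As leaves have complex dimension one, every complex-valued
  alternating real-bilinear form on a tangent line has bidegree (1,1).
\<close>

type_synonym form = "pt \<Rightarrow> complex \<Rightarrow> complex \<Rightarrow> complex"

definition form_support :: "form \<Rightarrow> pt set" where
  "form_support \<alpha> = closure {p. \<exists>a b. \<alpha> p a b \<noteq> 0}"

definition test_forms :: "complex \<Rightarrow> complex \<Rightarrow> form set" where
  "test_forms mu lam =
     {\<alpha>. (\<forall>p. bilinear (\<alpha> p) \<and> (\<forall>a. \<alpha> p a a = 0)) \<and>
         (\<forall>a b. leaf_smooth mu lam (\<lambda>p. \<alpha> p a b)) \<and>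
         compact (form_support \<alpha>) \<and> form_support \<alpha> \<subseteq> punctured_bidisc}"

definition positive_form :: "form \<Rightarrow> bool" where
  "positive_form \<alpha> \<longleftrightarrow> (\<forall>p a. \<alpha> p a (\<i> * a) \<in> \<real>\<^sub>\<ge>\<^sub>0)"

definition leaf_dt :: "complex \<Rightarrow> complex \<Rightarrow> (pt \<Rightarrow> complex) \<Rightarrow> pt \<Rightarrow> complex" where
  "leaf_dt mu lam f p = (leaf_deriv mu lam 1 f p - \<i> * leaf_deriv mu lam \<i> f p) / 2"

definition leaf_dtbar :: "complex \<Rightarrow> complex \<Rightarrow> (pt \<Rightarrow> complex) \<Rightarrow> pt \<Rightarrow> complex" where
  "leaf_dtbar mu lam f p = (leaf_deriv mu lam 1 f p + \<i> * leaf_deriv mu lam \<i> f p) / 2"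

text \<open>
  The leafwise form \<open>i ddbar f\<close>, which in the coordinate \<open>t\<close> is the mixed Wirtinger derivative of \<open>f\<close>
  times \<open>i dt \<and> d(cnj t)\<close>. Leaves being complex curves, for a function \<open>f\<close> on an open subset of \<open>\<complex>\<^sup>2\<close>
  it is also the restriction to the leaves of the ambient form \<open>i ddbar f\<close>.
\<close>

definition i_ddbar :: "complex \<Rightarrow> complex \<Rightarrow> (pt \<Rightarrow> complex) \<Rightarrow> form" where
  "i_ddbar mu lam f p a b =
     leaf_dt mu lam (leaf_dtbar mu lam f) p * (\<i> * (a * cnj b - b * cnj a))"


section \<open>Directed harmonic currents\<close>

text \<open>
  Convergence in the space of test forms: supports in a common compact subset of the punctured
  bidisc and uniform convergence of all leafwise derivatives. This is the notion of convergence
  of the usual inductive limit topology, for which a linear form is continuous iff it is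
  sequentially continuous.
\<close>

definition test_forms_tendsto ::
    "complex \<Rightarrow> complex \<Rightarrow> (nat \<Rightarrow> form) \<Rightarrow> form \<Rightarrow> bool" where
  "test_forms_tendsto mu lam A \<alpha> \<longleftrightarrow>
     (\<exists>K. compact K \<and> K \<subseteq> punctured_bidisc \<and>
          (\<forall>n. form_support (A n) \<subseteq> K) \<and> form_support \<alpha> \<subseteq> K) \<and>
     (\<forall>vs \<in> lists {1, \<i>}. \<forall>a b.
        uniform_limit punctured_bidisc
          (\<lambda>n. leaf_derivs mu lam vs (\<lambda>p. A n p a b))
          (leaf_derivs mu lam vs (\<lambda>p. \<alpha> p a b)) sequentially)"

definition harmonic_current :: "complex \<Rightarrow> complex \<Rightarrow> (form \<Rightarrow> complex) \<Rightarrow> bool" where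
  "harmonic_current mu lam T \<longleftrightarrow>
     (\<forall>\<alpha> \<in> test_forms mu lam. \<forall>\<beta> \<in> test_forms mu lam.
        T (\<lambda>p a b. \<alpha> p a b + \<beta> p a b) = T \<alpha> + T \<beta>) \<and>
     (\<forall>c. \<forall>\<alpha> \<in> test_forms mu lam. T (\<lambda>p a b. c * \<alpha> p a b) = c * T \<alpha>) \<and>
     (\<forall>A \<alpha>. (\<forall>n. A n \<in> test_forms mu lam) \<and> \<alpha> \<in> test_forms mu lam \<and>
        test_forms_tendsto mu lam A \<alpha> \<longrightarrow> (\<lambda>n. T (A n)) \<longlonglongrightarrow> T \<alpha>) \<and>
     (\<forall>f \<in> test_functions mu lam. T (i_ddbar mu lam f) = 0) \<and>
     (\<forall>\<alpha> \<in> test_forms mu lam. positive_form \<alpha> \<longrightarrow> T \<alpha> \<in> \<real>\<^sub>\<ge>\<^sub>0)"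


section \<open>Mass and Lelong numbers\<close>

definition cscale :: "complex \<Rightarrow> pt \<Rightarrow> pt" where
  "cscale c p = (c * fst p, c * snd p)"

definition holomorphic2_on :: "(pt \<Rightarrow> pt) \<Rightarrow> pt set \<Rightarrow> bool" where
  "holomorphic2_on y U \<longleftrightarrow>
     (\<forall>p \<in> U. \<exists>D. (y has_derivative D) (at p) \<and> (\<forall>c v. D (cscale c v) = cscale c (D v)))"

definition biholomorphic_coordinate :: "pt set \<Rightarrow> (pt \<Rightarrow> pt) \<Rightarrow> bool" where
  "biholomorphic_coordinate U y \<longleftrightarrow>
     open U \<and> U \<subseteq> bidisc \<and> holomorphic2_on y U \<and> inj_on y U \<and>
     open (y ` U) \<and> holomorphic2_on (inv_into U y) (y ` U)"

text \<open>
  \<open>m\<close> is the positive Radon measure \<open>T \<and> i ddbar \<parallel>y\<parallel>\<^sup>2\<close> on \<open>U - {0}\<close>, extended by zero.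
  By the Riesz representation theorem there is exactly one such \<open>m\<close> when \<open>T\<close> is a harmonic current.
  The norm on \<^typ>\<open>pt\<close> is the Euclidean one.
\<close>

definition mass_measure ::
    "complex \<Rightarrow> complex \<Rightarrow> (form \<Rightarrow> complex) \<Rightarrow> pt set \<Rightarrow> (pt \<Rightarrow> pt) \<Rightarrow> pt measure \<Rightarrow> bool" where
  "mass_measure mu lam T U y m \<longleftrightarrow>
     sets m = sets borel \<and>
     emeasure m (- (U - {0})) = 0 \<and>
     (\<forall>K. compact K \<and> K \<subseteq> U - {0} \<longrightarrow> emeasure m K < \<infinity>) \<and>
     (\<forall>\<phi> \<in> test_functions mu lam. closure {p. \<phi> p \<noteq> 0} \<subseteq> U \<longrightarrow>
        (\<integral>p. \<phi> p \<partial>m) =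
        T (\<lambda>p a b. \<phi> p * i_ddbar mu lam (\<lambda>q. of_real ((norm (y q))\<^sup>2)) p a b))"

definition gives_no_mass ::
    "complex \<Rightarrow> complex \<Rightarrow> (form \<Rightarrow> complex) \<Rightarrow> pt set \<Rightarrow> bool" where
  "gives_no_mass mu lam T S \<longleftrightarrow>
     (\<exists>m. mass_measure mu lam T bidisc (\<lambda>p. p) m \<and> emeasure m S = 0)"

text \<open>
  The limit is taken in the extended nonnegative reals, so a finite value entails that the
  measure is finite near \<open>x\<close>; it is required for every choice of coordinates centred at \<open>x\<close>.
\<close>

definition has_lelong_number ::
    "complex \<Rightarrow> complex \<Rightarrow> (form \<Rightarrow> complex) \<Rightarrow> pt \<Rightarrow> real \<Rightarrow> bool" where
  "has_lelong_number mu lam T x L \<longleftrightarrow>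
     (\<forall>U y. biholomorphic_coordinate U y \<and> x \<in> U \<and> y x = 0 \<longrightarrow>
        (\<exists>m. mass_measure mu lam T U y m \<and>
          ((\<lambda>r. emeasure m {p \<in> U. norm (y p) < r} / ennreal (pi * r\<^sup>2))
             \<longlongrightarrow> ennreal L) (at_right 0)))"

end

theory Submission
  imports Defs "HOL-Complex_Analysis.Complex_Analysis"
begin

text \<open>
  Test the current only against functions of \<open>u = - ln \<bar>z\<bar> / \<bar>mu\<bar>\<close> and \<open>v = - ln \<bar>w\<bar> / \<bar>lam\<bar>\<close>. Since \<open>lam / mu\<close> is
  not real, \<open>(u, v)\<close> are real linear coordinates on each leaf off the separatrices and identify it
  with the quadrant \<open>u, v > 0\<close>. The mass of the current, divided by the area density of the leaves,
  is pushed forward to a single measure on the quadrant, which is annihilated by a constant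
  coefficient elliptic operator and is finite on the strips along the two edges, because these come
  from compact subsets of the punctured bidisc. Superharmonic functions that are cut off along the
  edges bound the mass in the interior by the mass of the strips: a barrier supported in a triangle
  shows that \<open>u + v \<approx> n\<close> has mass \<open>o(n\<^sup>2)\<close>, the concave function \<open>u v / (u + v)\<close> improves this to \<open>o(n)\<close>,
  and then \<open>- ln (\<bar>z\<bar>\<^sup>2 + \<bar>w\<bar>\<^sup>2 + \<rho>) / 2\<close>, cut off also where \<open>u + v\<close> is small, shows that the ball of
  squared radius \<open>\<rho>\<close> has mass \<open>o(\<rho>)\<close>. For other coordinates the density of the mass changes by a factor
  that is bounded by the Cauchy estimates.
\<close>

section \<open>Smooth functions\<close>

text \<open>The obstacle is the lack of a global mass bound: the measure on the quadrant is known to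
  be finite only on strips, whereas a test function has to be cut off where u + v has size n, at the
  price of an error carried by the shell there. For a function q this error is about |q| / n^2 plus
  the gradient of q over n, times the mass of the shell. The logarithmic potential grows linearly,
  so it needs shells of mass o(n). The concave function, once truncated, is bounded and its gradient
  is supported in a strip, so it needs only o(n^2). The barrier vanishes for large u + v by itself,
  so it needs no prior bound; its little-o comes from the tails of strips of finite mass. This
  dictates the order of the three estimates. In the last one every bound on the potential is
  independent of \<rho>, so the tail beyond a level K of u + v can be made small before \<rho> is
  chosen; this is why the mass divided by \<rho> tends to 0 and does not merely stay
  bounded.\<close>

primrec Ck :: "'a::real_normed_vector set \<Rightarrow> nat \<Rightarrow> ('a \<Rightarrow> real) \<Rightarrow> bool" where
  "Ck S 0 F = continuous_on S F"
| "Ck S (Suc k) F = ((\<forall>x\<in>S. F differentiable (at x)) \<and>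
      (\<forall>h. Ck S k (\<lambda>x. frechet_derivative F (at x) h)))"

text \<open>Iterated directional derivatives, rather than derivatives as linear maps, keep every
  level of the recursion real valued, so that sums, products and compositions are each handled by
  one induction over \<open>k\<close>.\<close>

definition smooth_on :: "'a::real_normed_vector set \<Rightarrow> ('a \<Rightarrow> real) \<Rightarrow> bool" where
  "smooth_on S F \<longleftrightarrow> (\<forall>k. Ck S k F)"

lemma has_derivative_transform_open:
  assumes "open S" "x \<in> S" "\<And>y. y \<in> S \<Longrightarrow> F y = G y" "(F has_derivative D) (at x)"
  shows "(G has_derivative D) (at x)"
  using has_derivative_transform_within_open[OF assms(4) assms(1,2)] assms(3) by blast

lemma Ck_cong:
  assumes "open S" "\<And>x. x \<in> S \<Longrightarrow> F x = G x"
  shows "Ck S k F = Ck S k G"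
  using assms(2)
proof (induction k arbitrary: F G)
  case 0
  then show ?case by (simp cong: continuous_on_cong)
next
  case (Suc k)
  have der: "(F has_derivative D) (at x) \<longleftrightarrow> (G has_derivative D) (at x)" if "x \<in> S" for x D
    using has_derivative_transform_open[OF assms(1) that] Suc.prems by metis
  have "frechet_derivative F (at x) = frechet_derivative G (at x)" if "x \<in> S" for x
    unfolding frechet_derivative_def using der[OF that] by simp
  moreover have "F differentiable (at x) \<longleftrightarrow> G differentiable (at x)" if "x \<in> S" for x
    unfolding differentiable_def using der[OF that] by simp
  ultimately show ?case
    using Suc.IH[of "\<lambda>x. frechet_derivative F (at x) h" "\<lambda>x. frechet_derivative G (at x) h" for h]
    by simp
qed

text \<open>Lets an induction supply an explicit derivative in place of
  \<open>frechet_derivative\<close>; openness of \<open>S\<close> is what allows the replacement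
  under further derivatives.\<close>

lemma Ck_SucI:
  assumes "open S" "\<And>x. x \<in> S \<Longrightarrow> (F has_derivative F' x) (at x)"
    and "\<And>h. Ck S k (\<lambda>x. F' x h)"
  shows "Ck S (Suc k) F"
proof -
  have eq: "frechet_derivative F (at x) = F' x" if "x \<in> S" for x
    using frechet_derivative_at[OF assms(2)[OF that]] by simp
  have "Ck S k (\<lambda>x. frechet_derivative F (at x) h)" for h
    using Ck_cong[OF assms(1), of "\<lambda>x. frechet_derivative F (at x) h" "\<lambda>x. F' x h"] eq assms(3)
    by auto
  then show ?thesis using assms(2) by (auto simp: differentiable_def)
qed

lemma Ck_SucD: "Ck S (Suc k) F \<Longrightarrow> Ck S k F"
proof (induction k arbitrary: F)
  case 0
  then show ?case
    by (auto intro!: continuous_at_imp_continuous_on differentiable_imp_continuous_within)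
next
  case (Suc k)
  show ?case using Suc.IH Suc.prems by (metis Ck.simps(2))
qed

lemma Ck_const [intro!]: "open S \<Longrightarrow> Ck S k (\<lambda>x. c)"
proof (induction k arbitrary: c)
  case (Suc k)
  show ?case by (rule Ck_SucI[where F' = "\<lambda>x h. 0"]) (use Suc in auto)
qed auto

lemma Ck_linear: "open S \<Longrightarrow> bounded_linear l \<Longrightarrow> Ck S k l"
proof (cases k)
  case (Suc n)
  assume a: "open S" "bounded_linear l"
  show ?thesis unfolding Suc
    by (rule Ck_SucI[where F' = "\<lambda>x. l"]) (use a in \<open>auto intro: bounded_linear_imp_has_derivative\<close>)
qed (auto intro: linear_continuous_on)

lemma Ck_add: "open S \<Longrightarrow> Ck S k F \<Longrightarrow> Ck S k G \<Longrightarrow> Ck S k (\<lambda>x. F x + G x)"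
proof (induction k arbitrary: F G)
  case (Suc k)
  then show ?case
    by (intro Ck_SucI[where F' = "\<lambda>x h. frechet_derivative F (at x) h + frechet_derivative G (at x) h"])
      (auto intro!: has_derivative_add iffD1[OF frechet_derivative_works])
qed (auto intro: continuous_intros)

lemma Ck_mult: "open S \<Longrightarrow> Ck S k F \<Longrightarrow> Ck S k G \<Longrightarrow> Ck S k (\<lambda>x. F x * G x)"
proof (induction k arbitrary: F G)
  case (Suc k)
  have "Ck S k (\<lambda>x. F x * frechet_derivative G (at x) h + frechet_derivative F (at x) h * G x)" for h
    using Suc by (intro Ck_add Suc.IH) (auto intro: Ck_SucD)
  then show ?case using Suc.prems
    by (intro Ck_SucI[where F' = "\<lambda>x h. F x * frechet_derivative G (at x) h + frechet_derivative F (at x) h * G x"])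
      (auto intro!: has_derivative_mult iffD1[OF frechet_derivative_works])
qed (auto intro: continuous_intros)

text \<open>The chain rule yields a product in which the derivative of \<open>g\<close> is composed
  with the same \<open>F\<close>; hence \<open>g\<close> is generalized in the induction while
  \<open>F\<close> stays fixed.\<close>

lemma Ck_compose:
  assumes "open S" "open T" "\<And>x. x \<in> S \<Longrightarrow> F x \<in> T" "Ck T k g" "Ck S k F"
  shows "Ck S k (\<lambda>x. g (F x))"
  using assms(4,5)
proof (induction k arbitrary: g)
  case 0
  then show ?case using assms(3) by (auto intro: continuous_on_compose2)
next
  case (Suc k)
  \<comment> \<open>\<open>g\<close> depends on one real variable, so its derivative is
    multiplication by its value at 1.\<close>
  have 1: "frechet_derivative g (at y) r = r * frechet_derivative g (at y) 1" if "y \<in> T" for y r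
  proof -
    have "linear (frechet_derivative g (at y))"
      using Suc.prems(1) that by (auto intro: linear_frechet_derivative)
    from linear_cmul[OF this, of r 1] show ?thesis by simp
  qed
  have "Ck T k (\<lambda>y. frechet_derivative g (at y) 1)" "Ck S k F"
    using Suc.prems Ck_SucD by auto
  then have "Ck S k (\<lambda>x. frechet_derivative g (at (F x)) 1)"
    by (rule Suc.IH)
  then have "Ck S k (\<lambda>x. frechet_derivative F (at x) h * frechet_derivative g (at (F x)) 1)" for h
    using Suc.prems by (intro Ck_mult[OF assms(1)]) auto
  moreover have "((\<lambda>x. g (F x)) has_derivative
      (\<lambda>h. frechet_derivative F (at x) h * frechet_derivative g (at (F x)) 1)) (at x)" if "x \<in> S" for x
  proof -
    have "((\<lambda>x. g (F x)) has_derivative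
      (\<lambda>h. frechet_derivative g (at (F x)) (frechet_derivative F (at x) h))) (at x)"
      by (rule has_derivative_compose)
        (use Suc.prems that assms(3) in \<open>simp_all add: frechet_derivative_works[symmetric]\<close>)
    moreover have "(\<lambda>h. frechet_derivative g (at (F x)) (frechet_derivative F (at x) h)) =
        (\<lambda>h. frechet_derivative F (at x) h * frechet_derivative g (at (F x)) 1)"
      by (rule ext) (rule 1[OF assms(3)[OF that]])
    ultimately show ?thesis by simp
  qed
  ultimately show ?case
    by (intro Ck_SucI[OF assms(1), where F' = "\<lambda>x h. frechet_derivative F (at x) h * frechet_derivative g (at (F x)) 1"])
qed

lemma Ck_inverse: "Ck (- {0::real}) k inverse"
proof (induction k)
  case 0
  then show ?case by (auto intro!: continuous_intros)
next
  case (Suc k)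
  have "Ck (- {0::real}) k (\<lambda>x. (-h) * (inverse x * inverse x))" for h
    using Suc by (intro Ck_mult Ck_const) auto
  then show ?case
    by (intro Ck_SucI[where F' = "\<lambda>x h. (-h) * (inverse x * inverse x)"])
      (auto intro!: derivative_eq_intros)
qed

lemma Ck_exp: "Ck UNIV k (exp :: real \<Rightarrow> real)"
proof (induction k)
  case (Suc k)
  show ?case
    by (rule Ck_SucI[where F' = "\<lambda>x h. h * exp x"])
      (use Suc in \<open>auto intro!: Ck_mult Ck_const derivative_eq_intros\<close>)
qed (auto intro!: continuous_intros)

lemma Ck_ln: "Ck {0::real<..} k ln"
proof (cases k)
  case (Suc n)
  have inv: "Ck {0::real<..} n inverse"
    using Ck_compose[of "{0::real<..}" "-{0}" "\<lambda>x. x" n inverse] Ck_inverse Ck_linear[OF _ bounded_linear_ident]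
    by auto
  show ?thesis unfolding Suc
    by (rule Ck_SucI[where F' = "\<lambda>x h. h * inverse x"])
      (use inv in \<open>auto intro!: Ck_mult Ck_const derivative_eq_intros\<close>)
qed (auto intro!: continuous_intros)

lemma smooth_on_const [simp, intro!]: "open S \<Longrightarrow> smooth_on S (\<lambda>x. c)"
  by (simp add: smooth_on_def Ck_const del: Ck.simps)

lemma smooth_on_linear: "open S \<Longrightarrow> bounded_linear l \<Longrightarrow> smooth_on S l"
  by (simp add: smooth_on_def Ck_linear del: Ck.simps)

lemma smooth_on_add: "open S \<Longrightarrow> smooth_on S F \<Longrightarrow> smooth_on S G \<Longrightarrow> smooth_on S (\<lambda>x. F x + G x)"
  by (simp add: smooth_on_def Ck_add del: Ck.simps)

lemma smooth_on_mult: "open S \<Longrightarrow> smooth_on S F \<Longrightarrow> smooth_on S G \<Longrightarrow> smooth_on S (\<lambda>x. F x * G x)"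
  by (simp add: smooth_on_def Ck_mult del: Ck.simps)

lemma smooth_on_compose:
  "open S \<Longrightarrow> open T \<Longrightarrow> (\<And>x. x \<in> S \<Longrightarrow> F x \<in> T) \<Longrightarrow> smooth_on T g \<Longrightarrow> smooth_on S F \<Longrightarrow>
    smooth_on S (\<lambda>x. g (F x))"
  unfolding smooth_on_def using Ck_compose[of S T F _ g] by blast

lemma smooth_on_cong:
  "open S \<Longrightarrow> (\<And>x. x \<in> S \<Longrightarrow> F x = G x) \<Longrightarrow> smooth_on S F \<longleftrightarrow> smooth_on S G"
  unfolding smooth_on_def using Ck_cong[of S F G] by blast

lemma smooth_on_fst [intro!]: "open S \<Longrightarrow> smooth_on S fst"
  and smooth_on_snd [intro!]: "open S \<Longrightarrow> smooth_on S snd"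
  and smooth_on_id [intro!]: "open R \<Longrightarrow> smooth_on R (\<lambda>x. x)"
  by (auto intro!: smooth_on_linear bounded_linear_fst bounded_linear_snd bounded_linear_ident)

lemma smooth_on_cmult: "open S \<Longrightarrow> smooth_on S F \<Longrightarrow> smooth_on S (\<lambda>x. c * F x)"
  by (auto intro: smooth_on_mult)

lemma smooth_on_uminus: "open S \<Longrightarrow> smooth_on S F \<Longrightarrow> smooth_on S (\<lambda>x. - F x)"
  using smooth_on_cmult[of S F "-1"] by simp

lemma smooth_on_diff: "open S \<Longrightarrow> smooth_on S F \<Longrightarrow> smooth_on S G \<Longrightarrow> smooth_on S (\<lambda>x. F x - G x)"
  using smooth_on_add[of S F "\<lambda>x. - G x"] smooth_on_uminus[of S G] by simp

lemma smooth_on_divide: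
  assumes "open S" "\<And>x. x \<in> S \<Longrightarrow> G x \<noteq> 0" "smooth_on S F" "smooth_on S G"
  shows "smooth_on S (\<lambda>x. F x / G x)"
proof -
  have "smooth_on (- {0::real}) inverse"
    unfolding smooth_on_def using Ck_inverse by blast
  then have "smooth_on S (\<lambda>x. inverse (G x))"
    using smooth_on_compose[of S "- {0}" G inverse] assms by auto
  then show ?thesis
    unfolding divide_inverse using assms smooth_on_mult by blast
qed

lemma smooth_on_exp: "open S \<Longrightarrow> smooth_on S F \<Longrightarrow> smooth_on S (\<lambda>x. exp (F x))"
  by (rule smooth_on_compose[where T = UNIV and g = exp])
    (simp_all add: smooth_on_def Ck_exp del: Ck.simps)

lemma smooth_on_ln:
  "open S \<Longrightarrow> (\<And>x. x \<in> S \<Longrightarrow> F x > 0) \<Longrightarrow> smooth_on S F \<Longrightarrow> smooth_on S (\<lambda>x. ln (F x))"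
  by (rule smooth_on_compose[where T = "{0<..}" and g = ln])
    (simp_all add: smooth_on_def Ck_ln del: Ck.simps)

lemma smooth_on_derivative:
  assumes "open S" "smooth_on S F" "\<And>x. x \<in> S \<Longrightarrow> (F has_derivative F' x) (at x)"
  shows "smooth_on S (\<lambda>x. F' x h)"
proof -
  have "frechet_derivative F (at x) h = F' x h" if "x \<in> S" for x
    using frechet_derivative_at[OF assms(3)[OF that]] by simp
  then have "smooth_on S (\<lambda>x. frechet_derivative F (at x) h) \<longleftrightarrow> smooth_on S (\<lambda>x. F' x h)"
    using assms(1) by (intro smooth_on_cong) auto
  moreover have "smooth_on S (\<lambda>x. frechet_derivative F (at x) h)"
    unfolding smooth_on_def
  proof
    fix k
    have "Ck S (Suc k) F" using assms(2) by (simp add: smooth_on_def del: Ck.simps)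
    then show "Ck S k (\<lambda>x. frechet_derivative F (at x) h)" by simp
  qed
  ultimately show ?thesis by simp
qed

lemma smooth_on_imp_has_derivative:
  assumes "smooth_on S F" "x \<in> S"
  shows "(F has_derivative frechet_derivative F (at x)) (at x)"
proof -
  have "Ck S (Suc 0) F" using assms(1) by (simp add: smooth_on_def del: Ck.simps)
  then show ?thesis using assms(2) by (auto intro!: iffD1[OF frechet_derivative_works])
qed

lemma smooth_on_imp_continuous_on: "smooth_on S F \<Longrightarrow> continuous_on S F"
  unfolding smooth_on_def by (metis Ck.simps(1))

lemma smooth_on_antiderivative:
  fixes F g :: "real \<Rightarrow> real"
  assumes "\<And>x. (F has_real_derivative g x) (at x)" "smooth_on UNIV g"
  shows "smooth_on UNIV F"
  unfolding smooth_on_def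
proof
  fix k
  have "Ck UNIV (Suc k) F"
    by (rule Ck_SucI[where F' = "\<lambda>x h. g x * h"])
      (use assms in \<open>auto simp: has_field_derivative_def smooth_on_def intro!: Ck_mult Ck_const simp del: Ck.simps\<close>)
  then show "Ck UNIV k F" by (rule Ck_SucD)
qed

section \<open>Smooth steps and ramps built from exp(-1/x)\<close>

lemma poly_over_exp_tendsto_0:
  fixes p :: "real poly"
  shows "((\<lambda>y. y ^ k * poly p y * exp (- y)) \<longlongrightarrow> 0) at_top"
proof (induction p arbitrary: k)
  case (pCons a p)
  \<comment> \<open>Splitting off the constant coefficient raises the power of y by one, which is
    why \<open>k\<close> is arbitrary in the induction.\<close>
  have "((\<lambda>y::real. a * (y ^ k / exp y) + y ^ Suc k * poly p y * exp (- y)) \<longlongrightarrow> a * 0 + 0) at_top"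
    by (intro tendsto_intros tendsto_power_div_exp_0 pCons.IH)
  then show ?case
    by (simp add: algebra_simps exp_minus divide_inverse)
qed auto

text \<open>Functions of this form are closed under differentiation, with p replaced by X^2 (p -
  p'). Smoothness of exp(-1/x), extended by 0, then follows by induction over the order with
  \<open>p\<close> arbitrary.\<close>

definition flat_poly :: "real poly \<Rightarrow> real \<Rightarrow> real" where
  "flat_poly p x = (if x > 0 then poly p (1 / x) * exp (- (1 / x)) else 0)"

lemma flat_poly_deriv:
  "(flat_poly p has_real_derivative flat_poly ([:0, 0, 1:] * (p - pderiv p)) x) (at x)"
proof -
  consider "x > 0" | "x < 0" | "x = 0" by linarith
  then show ?thesis
  proof cases
    case 1
    have "((\<lambda>x. poly p (1 / x) * exp (- (1 / x))) has_real_derivative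
        flat_poly ([:0, 0, 1:] * (p - pderiv p)) x) (at x)"
      using 1 unfolding flat_poly_def
      by (auto intro!: derivative_eq_intros DERIV_chain2[OF poly_DERIV] simp: field_simps power2_eq_square)
    then show ?thesis
      using 1 by (elim has_field_derivative_transform_within_open[where S = "{0<..}"])
        (auto simp: flat_poly_def)
  next
    case 2
    have "((\<lambda>x. 0) has_real_derivative flat_poly ([:0, 0, 1:] * (p - pderiv p)) x) (at x)"
      using 2 by (simp add: flat_poly_def)
    then show ?thesis
      using 2 by (elim has_field_derivative_transform_within_open[where S = "{..<0}"])
        (auto simp: flat_poly_def)
  next
    case 3
    \<comment> \<open>At 0 the substitution y = 1/x turns the difference quotient from the right
      into a polynomial times exp(-y) at infinity.\<close>
    have "((\<lambda>y. y ^ 1 * poly p y * exp (- y)) \<longlongrightarrow> 0) at_top"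
      by (rule poly_over_exp_tendsto_0)
    then have "((\<lambda>y. inverse y ^ 1 * poly p (inverse y) * exp (- inverse y)) \<longlongrightarrow> 0) (at_right (0::real))"
      by (rule filterlim_compose[OF _ filterlim_inverse_at_top_right])
    moreover have "eventually (\<lambda>y. inverse y ^ 1 * poly p (inverse y) * exp (- inverse y) =
        flat_poly p y / y) (at_right (0::real))"
      using eventually_at_right_less[of 0]
      by eventually_elim (simp add: flat_poly_def field_simps)
    ultimately have r: "((\<lambda>y. flat_poly p y / y) \<longlongrightarrow> 0) (at_right 0)"
      by (rule Lim_transform_eventually)
    have "eventually (\<lambda>y. flat_poly p y / y = 0) (at_left (0::real))"
      unfolding eventually_at_filter by (auto simp: flat_poly_def intro!: always_eventually)
    then have l: "((\<lambda>y. flat_poly p y / y) \<longlongrightarrow> 0) (at_left 0)"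
      by (simp add: tendsto_eventually)
    have "((\<lambda>y. flat_poly p y / y) \<longlongrightarrow> 0) (at 0)"
      using l r by (simp add: filterlim_split_at)
    then show ?thesis
      by (simp add: 3 DERIV_def flat_poly_def)
  qed
qed

lemma flat_poly_smooth: "smooth_on UNIV (flat_poly p)"
  unfolding smooth_on_def
proof
  fix k show "Ck UNIV k (flat_poly p)"
  proof (induction k arbitrary: p)
    case 0
    have "continuous_on UNIV (flat_poly p)"
      by (rule DERIV_continuous_on) (use flat_poly_deriv in simp)
    then show ?case by simp
  next
    case (Suc k)
    show ?case
    proof (rule Ck_SucI)
      show "(flat_poly p has_derivative (\<lambda>h. flat_poly ([:0, 0, 1:] * (p - pderiv p)) x * h)) (at x)" for x
        using flat_poly_deriv by (simp add: has_field_derivative_def)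
    qed (use Suc in \<open>auto intro!: Ck_mult Ck_const simp del: Ck.simps\<close>)
  qed
qed

lemma bounded_of_const_outside:
  fixes f :: "real \<Rightarrow> real"
  assumes "continuous_on UNIV f" "\<And>x. x < 0 \<or> x > 1 \<Longrightarrow> f x = 0"
  shows "\<exists>c. \<forall>x. \<bar>f x\<bar> \<le> c"
proof -
  have "bounded (f ` {0..1})"
    using assms(1) by (intro compact_imp_bounded compact_continuous_image) (auto intro: continuous_on_subset)
  then obtain c where "\<forall>x\<in>{0..1}. \<bar>f x\<bar> \<le> c" by (auto simp: bounded_iff)
  then have "\<bar>f x\<bar> \<le> \<bar>c\<bar>" for x
    using assms(2)[of x] by (cases "x \<in> {0..1}") force+
  then show ?thesis by blast
qed

definition flat :: "real \<Rightarrow> real" where "flat = flat_poly 1"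

text \<open>The usual quotient of flat x by flat x + flat (1 - x), with one constant
  \<open>c\<close> bounding both derivatives; since c \<ge> 1, later estimates can absorb both 1 and
  c into c^2.\<close>

lemma exists_smooth_step:
  obtains A A' A'' :: "real \<Rightarrow> real" and c :: real
  where "smooth_on UNIV A" "\<And>x. (A has_real_derivative A' x) (at x)"
    "\<And>x. (A' has_real_derivative A'' x) (at x)"
    "\<And>x. x \<le> 0 \<Longrightarrow> A x = 0" "\<And>x. x \<ge> 1 \<Longrightarrow> A x = 1" "\<And>x. 0 \<le> A x" "\<And>x. A x \<le> 1"
    "\<And>x. A' x \<ge> 0" "\<And>x. x \<le> 0 \<or> x \<ge> 1 \<Longrightarrow> A' x = 0" "\<And>x. x \<le> 0 \<or> x \<ge> 1 \<Longrightarrow> A'' x = 0"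
    "c \<ge> 1" "\<And>x. A' x \<le> c" "\<And>x. \<bar>A'' x\<bar> \<le> c"
proof -
  define flat' where "flat' = flat_poly [:0, 0, 1:]"
  have d: "(flat has_real_derivative flat' x) (at x)" for x
    using flat_poly_deriv[of 1 x] by (simp add: flat_def flat'_def)
  have pos: "flat x > 0" if "x > 0" for x using that by (simp add: flat_def flat_poly_def)
  have z: "flat x = 0" "flat' x = 0" if "x \<le> 0" for x using that by (auto simp: flat_def flat'_def flat_poly_def)
  have nn: "flat x \<ge> 0" "flat' x \<ge> 0" for x by (auto simp: flat_def flat'_def flat_poly_def)
  have dpos: "flat x + flat (1 - x) > 0" for x
  proof (cases "x > 0")
    case True then show ?thesis using pos[OF True] nn(1)[of "1-x"] by linarith
  next
    case False then show ?thesis using pos[of "1-x"] nn(1)[of x] by linarith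
  qed
  define A where "A x = flat x / (flat x + flat (1 - x))" for x
  define A' where "A' x = (flat' x * flat (1 - x) + flat x * flat' (1 - x)) / (flat x + flat (1 - x))\<^sup>2" for x
  have sf: "smooth_on UNIV flat" by (simp add: flat_def flat_poly_smooth)
  have sf1: "smooth_on UNIV (\<lambda>x. flat (1 - x))"
    by (rule smooth_on_compose[where T = UNIV and g = flat])
      (auto intro!: smooth_on_diff smooth_on_const smooth_on_id sf)
  have dd: "flat x + flat (1 - x) \<noteq> 0" for x using dpos[of x] by linarith
  have sA: "smooth_on UNIV A"
    unfolding A_def by (rule smooth_on_divide) (auto intro!: smooth_on_add sf sf1 simp: dd)
  have dA: "(A has_real_derivative A' x) (at x)" for x
  proof -
    have "((\<lambda>x. flat (1 - x)) has_real_derivative flat' (1 - x) * (0 - 1)) (at x)"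
      by (rule DERIV_chain2[OF d]) (auto intro!: derivative_eq_intros)
    then have d1: "((\<lambda>x. flat (1 - x)) has_real_derivative - flat' (1 - x)) (at x)"
      by simp
    have "((\<lambda>x. flat x / (flat x + flat (1 - x))) has_real_derivative
       (flat' x * (flat x + flat (1 - x)) - flat x * (flat' x + - flat' (1 - x)))
       / ((flat x + flat (1 - x)) * (flat x + flat (1 - x)))) (at x)"
      by (intro DERIV_divide DERIV_add d d1 dd)
    moreover have "(flat' x * (flat x + flat (1 - x)) - flat x * (flat' x + - flat' (1 - x)))
       / ((flat x + flat (1 - x)) * (flat x + flat (1 - x))) = A' x"
      by (simp add: A'_def algebra_simps power2_eq_square)
    ultimately show ?thesis unfolding A_def by simp
  qed
  have sA': "smooth_on UNIV A'"
    using smooth_on_derivative[OF open_UNIV sA, of "\<lambda>x h. A' x * h" 1] dA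
    by (simp add: has_field_derivative_def)
  define A'' where "A'' x = frechet_derivative A' (at x) 1" for x
  have dA': "(A' has_real_derivative A'' x) (at x)" for x
  proof -
    have h: "(A' has_derivative frechet_derivative A' (at x)) (at x)"
      by (rule smooth_on_imp_has_derivative[OF sA']) simp
    moreover have "frechet_derivative A' (at x) = (\<lambda>h. A'' x * h)"
    proof
      fix r
      have "linear (frechet_derivative A' (at x))"
        using h has_derivative_linear by blast
      from linear_cmul[OF this, of r 1] show "frechet_derivative A' (at x) r = A'' x * r"
        by (simp add: A''_def mult.commute)
    qed
    ultimately show ?thesis by (simp add: has_field_derivative_def)
  qed
  have sA'': "smooth_on UNIV A''"
    unfolding A''_def
    by (rule smooth_on_derivative[OF open_UNIV sA' smooth_on_imp_has_derivative[OF sA']]) auto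
  have A'0: "A' x = 0" if "x \<le> 0 \<or> x \<ge> 1" for x
    using that z[of x] z[of "1-x"] by (auto simp: A'_def)
  have A''0: "A'' x = 0" if "x < 0 \<or> x > 1" for x
  proof -
    have "open ({..<0} \<union> {1::real<..})" by auto
    then have "((\<lambda>x. 0) has_real_derivative A'' x) (at x)"
      using that A'0 by (intro has_field_derivative_transform_within_open[OF dA', where S = "{..<0} \<union> {1<..}"]) auto
    then show ?thesis using DERIV_unique DERIV_const by blast
  qed
  have cont: "continuous_on UNIV A''" by (rule smooth_on_imp_continuous_on[OF sA''])
  \<comment> \<open>Differentiating on the open half-lines does not reach 0 and 1; there
    \<open>A''\<close> vanishes by continuity.\<close>
  have A''1: "A'' x = 0" if "x \<le> 0 \<or> x \<ge> 1" for x
  proof -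
    have eq: "closure {..<0::real} = {..0}" "closure {1::real<..} = {1..}" by auto
    have "A'' y = 0" if "y \<in> closure {..<0::real}" for y
      by (rule continuous_constant_on_closure[OF continuous_on_subset[OF cont subset_UNIV] _ that])
        (simp add: A''0)
    moreover have "A'' y = 0" if "y \<in> closure {1::real<..}" for y
      by (rule continuous_constant_on_closure[OF continuous_on_subset[OF cont subset_UNIV] _ that])
        (simp add: A''0)
    ultimately show ?thesis using that unfolding eq by auto
  qed
  obtain c1 where c1: "\<And>x. \<bar>A' x\<bar> \<le> c1"
    using bounded_of_const_outside[of A'] smooth_on_imp_continuous_on[OF sA'] A'0 by force
  obtain c2 where c2: "\<And>x. \<bar>A'' x\<bar> \<le> c2"
    using bounded_of_const_outside[of A''] cont A''0 by blast
  show ?thesis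
  proof (rule that[of A A' A'' "max 1 (max c1 c2)"])
    show "A x = 0" if "x \<le> 0" for x using z[OF that] by (simp add: A_def)
    show "A x = 1" if "x \<ge> 1" for x using z[of "1 - x"] that pos[of x] by (simp add: A_def)
    show "0 \<le> A x" "A x \<le> 1" for x
      using nn(1)[of x] nn(1)[of "1-x"] dpos[of x] by (auto simp: A_def)
    show "A' x \<ge> 0" for x using nn by (simp add: A'_def)
    show "A' x \<le> max 1 (max c1 c2)" for x using c1[of x] by linarith
    show "\<bar>A'' x\<bar> \<le> max 1 (max c1 c2)" for x using c2[of x] by linarith
  qed (use sA dA dA' A'0 A''1 in auto)
qed

text \<open>\<open>B\<close> is a smoothing of the positive part, within distance 1 of it. Its
  derivative \<open>A\<close> is increasing in the applications, so \<open>B\<close> is convex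
  there; this gives the Laplacians of barriers and truncations built from it a definite
  sign.\<close>

lemma exists_smooth_ramp:
  fixes A :: "real \<Rightarrow> real"
  assumes "smooth_on UNIV A" "\<And>x. x \<le> 0 \<Longrightarrow> A x = 0" "\<And>x. x \<ge> 1 \<Longrightarrow> A x = 1"
    "\<And>x. 0 \<le> A x" "\<And>x. A x \<le> 1"
  obtains B where "smooth_on UNIV B" "\<And>x. (B has_real_derivative A x) (at x)"
    "\<And>x. x \<le> 0 \<Longrightarrow> B x = 0" "\<And>x. x \<ge> 0 \<Longrightarrow> 0 \<le> B x \<and> B x \<le> x"
    "\<And>x. x - 1 \<le> B x"
proof -
  have contA: "continuous_on UNIV A" by (rule smooth_on_imp_continuous_on[OF assms(1)])
  have "\<exists>B. \<forall>x. (B has_real_derivative A x) (at x)"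
  proof -
    \<comment> \<open>One of the two intervals is always empty or a point, so the difference is the
      signed integral from 0 to x.\<close>
    define P where "P = (\<lambda>x. integral {0..x} A - integral {x..0} A)"
    have "(P has_real_derivative A x) (at x)" for x
    proof -
      define a where "a = min x 0 - 1"
      define b where "b = max x 0 + 1"
      have int: "A integrable_on {u..v}" for u v
        using contA by (intro integrable_continuous_interval) (auto intro: continuous_on_subset)
      have eq: "integral {a..y} A - integral {a..0} A = P y" if "y \<in> {a<..<b}" for y
      proof (cases "y \<ge> 0")
        case True
        then have "integral {a..0} A + integral {0..y} A = integral {a..y} A"
          by (intro Henstock_Kurzweil_Integration.integral_combine int) (auto simp: a_def)
        moreover have "integral {y..0} A = 0" using True by (cases "y = 0") auto
        ultimately show ?thesis by (simp add: P_def)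
      next
        case False
        then have "integral {a..y} A + integral {y..0} A = integral {a..0} A"
          using that by (intro Henstock_Kurzweil_Integration.integral_combine int) auto
        then show ?thesis using False by (simp add: P_def)
      qed
      have "((\<lambda>y. integral {a..y} A) has_real_derivative A x) (at x within {a..b})"
        using contA by (intro integral_has_real_derivative) (auto simp: a_def b_def intro: continuous_on_subset)
      moreover have "at x within {a..b} = at x"
        by (rule at_within_interior) (auto simp: a_def b_def)
      ultimately have "((\<lambda>y. integral {a..y} A) has_real_derivative A x) (at x)"
        by metis
      then have "((\<lambda>y. integral {a..y} A - integral {a..0} A) has_real_derivative A x) (at x)"
        by (auto intro!: derivative_eq_intros)
      then show ?thesis
        by (rule has_field_derivative_transform_within_open[where S = "{a<..<b}"])
          (auto simp: eq, auto simp: a_def b_def)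
    qed
    then show ?thesis by blast
  qed
  then obtain B0 where B0: "\<And>x. (B0 has_real_derivative A x) (at x)" by blast
  define B where "B x = B0 x - B0 0" for x
  have B: "(B has_real_derivative A x) (at x)" for x
    unfolding B_def using B0 by (auto intro!: derivative_eq_intros)
  have 0: "B x = 0" if "x \<le> 0" for x
  proof -
    have "B x = B 0"
    proof (cases "x = 0")
      case False
      with that obtain z where "z < 0" "B 0 - B x = (0 - x) * A z"
        using MVT2[of x 0 B A] B by auto
      then show ?thesis using assms(2)[of z] by simp
    qed simp
    then show ?thesis by (simp add: B_def)
  qed
  have 1: "0 \<le> B x \<and> B x \<le> x" if "x \<ge> 0" for x
  proof (cases "x = 0")
    case False
    with that obtain z where "B x - B 0 = (x - 0) * A z"
      using MVT2[of 0 x B A] B by auto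
    then show ?thesis using 0[of 0] assms(4,5)[of z] that by (simp add: mult_left_le)
  qed (simp add: 0)
  have 2: "x - 1 \<le> B x" for x
  proof (cases "x > 1")
    case True
    then obtain z where "z > 1" "B x - B 1 = (x - 1) * A z"
      using MVT2[of 1 x B A] B by auto
    then show ?thesis using assms(3)[of z] 1[of 1] by simp
  next
    case False
    then show ?thesis using 0[of x] 1[of x] by (cases "x \<ge> 0") auto
  qed
  show ?thesis
    by (rule that[of B]) (use B 0 1 2 smooth_on_antiderivative[OF B assms(1)] in auto)
qed

section \<open>Measures annihilated by an elliptic operator on the quadrant\<close>

definition quadrant :: "(real \<times> real) set" where
  "quadrant = {p. fst p > 0 \<and> snd p > 0}"

lemma open_quadrant [simp, intro!]: "open quadrant"
  unfolding quadrant_def by (intro open_Collect_conj open_Collect_less continuous_intros)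

text \<open>Carrying all partial derivatives as named functions reduces Laplacians of products and
  compositions to algebra. The occurrence of \<open>Fuv\<close> in two clauses builds in the
  symmetry of the mixed derivative.\<close>

definition jet ::
    "(real \<times> real \<Rightarrow> real) \<Rightarrow> (real \<times> real \<Rightarrow> real) \<Rightarrow> (real \<times> real \<Rightarrow> real) \<Rightarrow>
     (real \<times> real \<Rightarrow> real) \<Rightarrow> (real \<times> real \<Rightarrow> real) \<Rightarrow> (real \<times> real \<Rightarrow> real) \<Rightarrow> bool" where
  "jet F Fu Fv Fuu Fuv Fvv \<longleftrightarrow> (\<forall>p\<in>quadrant.
     (F has_derivative (\<lambda>h. fst h * Fu p + snd h * Fv p)) (at p) \<and>
     (Fu has_derivative (\<lambda>h. fst h * Fuu p + snd h * Fuv p)) (at p) \<and>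
     (Fv has_derivative (\<lambda>h. fst h * Fuv p + snd h * Fvv p)) (at p))"

lemma jet_mult:
  assumes "jet F Fu Fv Fuu Fuv Fvv" "jet G Gu Gv Guu Guv Gvv"
  shows "jet (\<lambda>p. F p * G p) (\<lambda>p. F p * Gu p + Fu p * G p) (\<lambda>p. F p * Gv p + Fv p * G p)
    (\<lambda>p. F p * Guu p + 2 * (Fu p * Gu p) + Fuu p * G p)
    (\<lambda>p. F p * Guv p + Fu p * Gv p + Fv p * Gu p + Fuv p * G p)
    (\<lambda>p. F p * Gvv p + 2 * (Fv p * Gv p) + Fvv p * G p)"
  unfolding jet_def
proof (intro ballI conjI)
  fix p assume p: "p \<in> quadrant"
  note f = assms(1)[unfolded jet_def, rule_format, OF p]
  note g = assms(2)[unfolded jet_def, rule_format, OF p]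
  note f1 = f[THEN conjunct1] and f2 = f[THEN conjunct2, THEN conjunct1] and f3 = f[THEN conjunct2, THEN conjunct2]
  note g1 = g[THEN conjunct1] and g2 = g[THEN conjunct2, THEN conjunct1] and g3 = g[THEN conjunct2, THEN conjunct2]
  show "((\<lambda>p. F p * G p) has_derivative
      (\<lambda>h. fst h * (F p * Gu p + Fu p * G p) + snd h * (F p * Gv p + Fv p * G p))) (at p)"
    by (rule has_derivative_eq_rhs[OF has_derivative_mult[OF f1 g1]]) (auto simp: fun_eq_iff algebra_simps)
  show "((\<lambda>p. F p * Gu p + Fu p * G p) has_derivative
      (\<lambda>h. fst h * (F p * Guu p + 2 * (Fu p * Gu p) + Fuu p * G p) +
           snd h * (F p * Guv p + Fu p * Gv p + Fv p * Gu p + Fuv p * G p))) (at p)"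
    by (rule has_derivative_eq_rhs[OF has_derivative_add[OF has_derivative_mult[OF f1 g2] has_derivative_mult[OF f2 g1]]])
      (auto simp: fun_eq_iff algebra_simps)
  show "((\<lambda>p. F p * Gv p + Fv p * G p) has_derivative
      (\<lambda>h. fst h * (F p * Guv p + Fu p * Gv p + Fv p * Gu p + Fuv p * G p) +
           snd h * (F p * Gvv p + 2 * (Fv p * Gv p) + Fvv p * G p))) (at p)"
    by (rule has_derivative_eq_rhs[OF has_derivative_add[OF has_derivative_mult[OF f1 g3] has_derivative_mult[OF f3 g1]]])
      (auto simp: fun_eq_iff algebra_simps)
qed

lemma jet_compose:
  assumes "jet F Fu Fv Fuu Fuv Fvv"
    and "\<And>p. p \<in> quadrant \<Longrightarrow> (g has_real_derivative g' (F p)) (at (F p))"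
    and "\<And>p. p \<in> quadrant \<Longrightarrow> (g' has_real_derivative g'' (F p)) (at (F p))"
  shows "jet (\<lambda>p. g (F p)) (\<lambda>p. g' (F p) * Fu p) (\<lambda>p. g' (F p) * Fv p)
    (\<lambda>p. g'' (F p) * (Fu p)\<^sup>2 + g' (F p) * Fuu p)
    (\<lambda>p. g'' (F p) * (Fu p * Fv p) + g' (F p) * Fuv p)
    (\<lambda>p. g'' (F p) * (Fv p)\<^sup>2 + g' (F p) * Fvv p)"
  unfolding jet_def
proof (intro ballI conjI)
  fix p assume p: "p \<in> quadrant"
  note f = assms(1)[unfolded jet_def, rule_format, OF p]
  note f1 = f[THEN conjunct1] and f2 = f[THEN conjunct2, THEN conjunct1] and f3 = f[THEN conjunct2, THEN conjunct2]
  note g1 = has_derivative_compose[OF f1 assms(2)[OF p, unfolded has_field_derivative_def]]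
  note g2 = has_derivative_compose[OF f1 assms(3)[OF p, unfolded has_field_derivative_def]]
  show "((\<lambda>p. g (F p)) has_derivative
      (\<lambda>h. fst h * (g' (F p) * Fu p) + snd h * (g' (F p) * Fv p))) (at p)"
    by (rule has_derivative_eq_rhs[OF g1]) (auto simp: fun_eq_iff algebra_simps)
  show "((\<lambda>p. g' (F p) * Fu p) has_derivative
      (\<lambda>h. fst h * (g'' (F p) * (Fu p)\<^sup>2 + g' (F p) * Fuu p) +
           snd h * (g'' (F p) * (Fu p * Fv p) + g' (F p) * Fuv p))) (at p)"
    by (rule has_derivative_eq_rhs[OF has_derivative_mult[OF g2 f2]]) (auto simp: fun_eq_iff algebra_simps power2_eq_square)
  show "((\<lambda>p. g' (F p) * Fv p) has_derivative
      (\<lambda>h. fst h * (g'' (F p) * (Fu p * Fv p) + g' (F p) * Fuv p) +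
           snd h * (g'' (F p) * (Fv p)\<^sup>2 + g' (F p) * Fvv p))) (at p)"
    by (rule has_derivative_eq_rhs[OF has_derivative_mult[OF g2 f3]]) (auto simp: fun_eq_iff algebra_simps power2_eq_square)
qed

lemma jet_affine:
  "jet (\<lambda>p. \<alpha> * fst p + \<beta> * snd p + \<gamma>) (\<lambda>p. \<alpha>) (\<lambda>p. \<beta>) (\<lambda>p. 0) (\<lambda>p. 0) (\<lambda>p. 0)"
  unfolding jet_def by (auto intro!: derivative_eq_intros simp: algebra_simps)

lemma smooth_on_affine:
  fixes S :: "(real \<times> real) set"
  shows "open S \<Longrightarrow> smooth_on S (\<lambda>p. \<alpha> * fst p + \<beta> * snd p + \<gamma>)"
  by (intro smooth_on_add smooth_on_cmult smooth_on_fst smooth_on_snd smooth_on_const)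

lemma smooth_on_compose_UNIV:
  "open S \<Longrightarrow> smooth_on UNIV g \<Longrightarrow> smooth_on S F \<Longrightarrow> smooth_on S (\<lambda>x. g (F x))"
  by (rule smooth_on_compose[where T = UNIV and g = g]) auto

lemma smooth_on_compose_affine:
  fixes S :: "(real \<times> real) set"
  assumes "open S" "smooth_on UNIV g"
  shows "smooth_on S (\<lambda>p. g (\<alpha> * fst p + \<beta> * snd p + \<gamma>))"
  using smooth_on_compose_UNIV[OF assms smooth_on_affine[OF assms(1)]] .

lemma jet_smooth:
  assumes "smooth_on quadrant F" "jet F Fu Fv Fuu Fuv Fvv"
  shows "smooth_on quadrant Fu" "smooth_on quadrant Fv" "smooth_on quadrant Fuu"
    "smooth_on quadrant Fuv" "smooth_on quadrant Fvv"
proof -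
  note d = assms(2)[unfolded jet_def, rule_format]
  show u: "smooth_on quadrant Fu"
    using smooth_on_derivative[OF _ assms(1), of "\<lambda>p h. fst h * Fu p + snd h * Fv p" "(1, 0)"] d by simp
  show v: "smooth_on quadrant Fv"
    using smooth_on_derivative[OF _ assms(1), of "\<lambda>p h. fst h * Fu p + snd h * Fv p" "(0, 1)"] d by simp
  show "smooth_on quadrant Fuu"
    using smooth_on_derivative[OF _ u, of "\<lambda>p h. fst h * Fuu p + snd h * Fuv p" "(1, 0)"] d by simp
  show "smooth_on quadrant Fuv"
    using smooth_on_derivative[OF _ u, of "\<lambda>p h. fst h * Fuu p + snd h * Fuv p" "(0, 1)"] d by simp
  show "smooth_on quadrant Fvv"
    using smooth_on_derivative[OF _ v, of "\<lambda>p h. fst h * Fuv p + snd h * Fvv p" "(0, 1)"] d by simp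
qed

section \<open>Regions of the quadrant and the measures studied on it\<close>

definition corner :: "real \<Rightarrow> (real \<times> real) set" where
  "corner N = {p. 1 \<le> fst p \<and> 1 \<le> snd p \<and> fst p + snd p \<le> N}"

text \<open>The edges of the quadrant correspond to the boundary of the bidisc, so all regions keep
  distance 1 from them. On a strip one of u, v stays bounded while the other is free: in the bidisc
  it stays away from 0 and runs along the separatrices.\<close>

definition strip :: "real \<Rightarrow> real \<Rightarrow> (real \<times> real) set" where
  "strip w x = {p. 1 \<le> fst p \<and> 1 \<le> snd p \<and> (fst p \<le> w \<or> snd p \<le> w) \<and> x \<le> fst p + snd p}"

text \<open>A dyadic shell; the lower bound 2 keeps it where the cutoffs along both edges are equal
  to 1.\<close>

definition block :: "real \<Rightarrow> (real \<times> real) set" where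
  "block n = {p. 2 \<le> fst p \<and> 2 \<le> snd p \<and> n \<le> fst p + snd p \<and> fst p + snd p \<le> 2 * n}"

lemma closed_corner: "closed (corner N)" and closed_strip: "closed (strip w x)" and closed_block: "closed (block n)"
  unfolding corner_def strip_def block_def
  by (intro closed_Collect_conj closed_Collect_disj closed_Collect_le continuous_intros)+

lemma sets_basic [measurable, simp]:
  "corner N \<in> sets borel" "strip w x \<in> sets borel" "block n \<in> sets borel"
  by (auto intro!: borel_closed closed_corner closed_strip closed_block)

lemma sets_exp_sublevel:
  "{p :: real \<times> real. exp (\<alpha> * fst p) + exp (\<beta> * snd p) < \<rho> \<and> fst p + snd p \<le> N} \<in> sets borel"
proof -
  have "open {p :: real \<times> real. exp (\<alpha> * fst p) + exp (\<beta> * snd p) < \<rho>}"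
    by (intro open_Collect_less continuous_intros)
  moreover have "closed {p :: real \<times> real. fst p + snd p \<le> N}"
    by (intro closed_Collect_le continuous_intros)
  ultimately show ?thesis
    unfolding Collect_conj_eq by (intro sets.Int borel_open borel_closed)
qed

lemma corner_subset: "corner N \<subseteq> quadrant" by (auto simp: corner_def quadrant_def)

lemma compact_corner: "compact (corner N)"
proof -
  have "corner N \<subseteq> cbox (1, 1) (N, N)" by (auto simp: corner_def cbox_Pair_eq)
  then show ?thesis
    using closed_corner bounded_subset[OF bounded_cbox] by (auto simp: compact_eq_bounded_closed)
qed

text \<open>The properties of the pushed-forward measure on which all mass estimates rest.
  Restricting the integral to \<open>corner N\<close> makes integrability automatic: continuous
  functions are bounded there, and a corner lies in a strip, hence has finite mass. The total mass
  may be infinite.\<close>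

locale weakly_harmonic =
  fixes \<Lambda> :: "(real \<times> real) measure" and b :: real
  assumes sets_\<Lambda> [simp, measurable_cong]: "sets \<Lambda> = sets borel"
    and b: "\<bar>b\<bar> < 1"
    and strip_finite: "\<And>w. emeasure \<Lambda> (strip w 0) < \<infinity>"
    and harmonic: "\<And>F Fu Fv Fuu Fuv Fvv N. smooth_on quadrant F \<Longrightarrow> jet F Fu Fv Fuu Fuv Fvv \<Longrightarrow>
        (\<And>p. p \<in> quadrant - corner N \<Longrightarrow> F p = 0) \<Longrightarrow>
        (LINT p:corner N|\<Lambda>. Fuu p + 2 * b * Fuv p + Fvv p) = 0"
begin

lemma fmeasurable_strip [simp, intro]: "strip w x \<in> fmeasurable \<Lambda>"
proof (rule fmeasurableI)
  have "emeasure \<Lambda> (strip w x) \<le> emeasure \<Lambda> (strip w 0)"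
    by (rule emeasure_mono) (force simp: strip_def, simp)
  then show "emeasure \<Lambda> (strip w x) < \<infinity>" using strip_finite[of w] by (rule le_less_trans)
qed auto

lemma fmeasurable_corner [simp, intro]: "corner N \<in> fmeasurable \<Lambda>"
  by (rule fmeasurableI2[OF fmeasurable_strip[of N 0]]) (force simp: strip_def corner_def, simp)

lemma fmeasurable_block [simp, intro]: "block n \<in> fmeasurable \<Lambda>"
  by (rule fmeasurableI2[OF fmeasurable_corner[of "2 * n"]]) (force simp: block_def corner_def, simp)

lemma integrable_corner:
  fixes f :: "real \<times> real \<Rightarrow> real"
  assumes "continuous_on quadrant f"
  shows "set_integrable \<Lambda> (corner N) f"
proof -
  have c: "continuous_on (corner N) f"
    using assms corner_subset by (rule continuous_on_subset)
  then have "bounded (f ` corner N)"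
    by (intro compact_imp_bounded compact_continuous_image compact_corner)
  then obtain B where B: "\<And>p. p \<in> corner N \<Longrightarrow> norm (f p) \<le> B" by (auto simp: bounded_iff)
  have m: "(\<lambda>p. indicator (corner N) p *\<^sub>R f p) \<in> borel_measurable \<Lambda>"
    using borel_measurable_continuous_on_indicator[of "corner N" f] c closed_corner
    by (simp cong: measurable_cong_sets)
  have fin: "emeasure \<Lambda> (corner N) < \<infinity>"
    using fmeasurable_corner[of N] by (simp add: fmeasurable_def)
  show ?thesis
    unfolding set_integrable_def
  proof (rule integrableI_bounded_set[where A = "corner N" and B = B])
    show "(\<lambda>p. indicat_real (corner N) p *\<^sub>R f p) \<in> borel_measurable \<Lambda>" by (rule m)
  qed (use B fin in auto)
qed

text \<open>Continuity from above, available because a strip of fixed width has finite mass. The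
  first and the last of the mass estimates draw their smallness from it.\<close>

lemma strip_tail: "((\<lambda>n. measure \<Lambda> (strip w (real n / M))) \<longlonglongrightarrow> 0)" if "M > 0"
proof -
  have "(\<lambda>n. measure \<Lambda> (strip w (real n / M))) \<longlonglongrightarrow> measure \<Lambda> (\<Inter>n. strip w (real n / M))"
  proof (rule Lim_measure_decseq)
    show "decseq (\<lambda>n. strip w (real n / M))"
      using that by (intro decseq_SucI) (auto simp: strip_def field_simps)
    show "emeasure \<Lambda> (strip w (real i / M)) \<noteq> \<infinity>" for i
      using fmeasurable_strip[of w "real i / M"] by (auto simp: fmeasurable_def)
  qed auto
  moreover have "(\<Inter>n. strip w (real n / M)) = {}"
  proof (rule ccontr)
    assume "(\<Inter>n. strip w (real n / M)) \<noteq> {}"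
    then obtain p where p: "\<And>n. real n / M \<le> fst p + snd p" by (auto simp: strip_def)
    obtain n where "real n > (fst p + snd p) * M" using reals_Archimedean2 by blast
    then show False using p[of n] that by (auto simp: field_simps)
  qed
  ultimately show ?thesis by simp
qed

end

section \<open>Cutoffs along the edges and at infinity, and their errors\<close>

locale step_and_ramp =
  fixes A A' A'' B :: "real \<Rightarrow> real" and c :: real
  assumes smooth_A: "smooth_on UNIV A" and smooth_B: "smooth_on UNIV B"
    and dA: "\<And>x. (A has_real_derivative A' x) (at x)"
    and dA': "\<And>x. (A' has_real_derivative A'' x) (at x)"
    and dB: "\<And>x. (B has_real_derivative A x) (at x)"
    and A_0: "\<And>x. x \<le> 0 \<Longrightarrow> A x = 0" and A_1: "\<And>x. x \<ge> 1 \<Longrightarrow> A x = 1"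
    and A_ge: "\<And>x. 0 \<le> A x" and A_le: "\<And>x. A x \<le> 1"
    and A'_ge: "\<And>x. A' x \<ge> 0" and A'_0: "\<And>x. x \<le> 0 \<or> x \<ge> 1 \<Longrightarrow> A' x = 0"
    and A''_0: "\<And>x. x \<le> 0 \<or> x \<ge> 1 \<Longrightarrow> A'' x = 0"
    and c: "c \<ge> 1" and A'_le: "\<And>x. A' x \<le> c" and A''_le: "\<And>x. \<bar>A'' x\<bar> \<le> c"
    and B_0: "\<And>x. x \<le> 0 \<Longrightarrow> B x = 0" and B_pos: "\<And>x. x \<ge> 0 \<Longrightarrow> 0 \<le> B x \<and> B x \<le> x"
    and B_ge: "\<And>x. x - 1 \<le> B x"

lemma exists_step_and_ramp: "\<exists>A A' A'' B c. step_and_ramp A A' A'' B c"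
proof (rule exists_smooth_step)
  fix A A' A'' :: "real \<Rightarrow> real" and c :: real
  assume A: "smooth_on UNIV A" "\<And>x. (A has_real_derivative A' x) (at x)"
    "\<And>x. (A' has_real_derivative A'' x) (at x)"
    "\<And>x. x \<le> 0 \<Longrightarrow> A x = 0" "\<And>x. x \<ge> 1 \<Longrightarrow> A x = 1" "\<And>x. 0 \<le> A x" "\<And>x. A x \<le> 1"
    "\<And>x. A' x \<ge> 0" "\<And>x. x \<le> 0 \<or> x \<ge> 1 \<Longrightarrow> A' x = 0" "\<And>x. x \<le> 0 \<or> x \<ge> 1 \<Longrightarrow> A'' x = 0"
    "c \<ge> 1" "\<And>x. A' x \<le> c" "\<And>x. \<bar>A'' x\<bar> \<le> c"
  obtain B where "smooth_on UNIV B" "\<And>x. (B has_real_derivative A x) (at x)"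
    "\<And>x. x \<le> 0 \<Longrightarrow> B x = 0" "\<And>x. x \<ge> 0 \<Longrightarrow> 0 \<le> B x \<and> B x \<le> x" "\<And>x. x - 1 \<le> B x"
    using exists_smooth_ramp[OF A(1,4,5,6,7)] by blast
  then have "step_and_ramp A A' A'' B c" unfolding step_and_ramp_def using A by simp
  then show ?thesis by blast
qed

locale weakly_harmonic_cutoff = weakly_harmonic + step_and_ramp
begin

definition lap where "lap Fuu Fuv Fvv p = (Fuu p + 2 * b * Fuv p + Fvv p :: real)" for p :: "real \<times> real"

definition cutoff :: "(real \<Rightarrow> real) \<Rightarrow> real \<times> real \<Rightarrow> real" where
  "cutoff Y p = A (fst p - 1) * A (snd p - 1) * Y (fst p + snd p)"

text \<open>Up to the factor 8 c^2 this bounds L(C q) - C L q, where C is \<open>cutoff Y\<close>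
  and L is the operator in \<open>lap\<close>. Where u, v > 2 both edge factors are 1, so only
  derivatives of \<open>Y\<close> contribute.\<close>

definition err where
  "err Y Y' Y'' q qu qv p =
    (if fst p \<le> 2 \<or> snd p \<le> 2
     then (\<bar>Y (fst p + snd p)\<bar> + \<bar>Y' (fst p + snd p)\<bar> + \<bar>Y'' (fst p + snd p)\<bar>) * (\<bar>q p\<bar> + \<bar>qu p\<bar> + \<bar>qv p\<bar>)
     else \<bar>q p\<bar> * \<bar>Y'' (fst p + snd p)\<bar> + \<bar>Y' (fst p + snd p)\<bar> * (\<bar>qu p\<bar> + \<bar>qv p\<bar>) :: real)"
  for p :: "real \<times> real"

text \<open>The product rule with the values of the cutoff factors as plain reals. Each second
  derivative of the product is at most 2 c^2 S, the square coming from x1' x2'; the operator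
  combines them with total weight 1 + 2 |b| + 1 < 4, whence the 8.\<close>

lemma quadratic_bounds:
  fixes x1 x2 x1' x2' x1'' x2'' y y' y'' q qu qv :: real
  assumes x: "0 \<le> x1" "x1 \<le> 1" "0 \<le> x2" "x2 \<le> 1" "0 \<le> x1'" "x1' \<le> c" "0 \<le> x2'" "x2' \<le> c"
    "\<bar>x1''\<bar> \<le> c" "\<bar>x2''\<bar> \<le> c"
  defines "cu \<equiv> x1' * x2 * y + x1 * x2 * y'" and "cv \<equiv> x1 * x2' * y + x1 * x2 * y'"
    and "cuu \<equiv> x1'' * x2 * y + 2 * (x1' * x2 * y') + x1 * x2 * y''"
    and "cuv \<equiv> x1' * x2' * y + x1' * x2 * y' + x1 * x2' * y' + x1 * x2 * y''"
    and "cvv \<equiv> x1 * x2'' * y + 2 * (x1 * x2' * y') + x1 * x2 * y''"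
  shows "\<bar>q * (cuu + 2 * b * cuv + cvv) + 2 * (cu * qu + b * (cu * qv + cv * qu) + cv * qv)\<bar>
    \<le> 8 * c\<^sup>2 * ((\<bar>y\<bar> + \<bar>y'\<bar> + \<bar>y''\<bar>) * (\<bar>q\<bar> + \<bar>qu\<bar> + \<bar>qv\<bar>))"
proof -
  define S where "S = \<bar>y\<bar> + \<bar>y'\<bar> + \<bar>y''\<bar>"
  have S: "S \<ge> 0" "\<bar>y\<bar> \<le> S" "\<bar>y'\<bar> \<le> S" "\<bar>y''\<bar> \<le> S" by (auto simp: S_def)
  have cc: "c \<le> c\<^sup>2" "1 \<le> c\<^sup>2" using c by (auto simp: power2_eq_square intro: order_trans[OF c])
  have m1: "\<bar>s * t * z\<bar> \<le> k * \<bar>z\<bar>" if "\<bar>s\<bar> \<le> k" "\<bar>t\<bar> \<le> 1" for s t z k :: real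
  proof -
    have "\<bar>s\<bar> * \<bar>t\<bar> \<le> k * 1" using that by (intro mult_mono) auto
    then show ?thesis by (simp add: abs_mult mult_right_mono)
  qed
  have m2: "\<bar>t * s * z\<bar> \<le> k * \<bar>z\<bar>" if "\<bar>s\<bar> \<le> k" "\<bar>t\<bar> \<le> 1" for s t z k :: real
    using m1[OF that, of z] by (simp add: mult.commute)
  have m3: "\<bar>x1' * x2' * z\<bar> \<le> c\<^sup>2 * \<bar>z\<bar>" for z
  proof -
    have "\<bar>x1'\<bar> * \<bar>x2'\<bar> \<le> c * c" using x by (intro mult_mono) auto
    then show ?thesis by (simp add: abs_mult mult_right_mono power2_eq_square)
  qed
  have cS: "c * \<bar>z\<bar> \<le> c\<^sup>2 * \<bar>z\<bar>" "1 * \<bar>z\<bar> \<le> c\<^sup>2 * \<bar>z\<bar>" for z :: real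
    by (rule mult_right_mono[OF cc(1)], simp, rule mult_right_mono[OF cc(2)], simp)
  have e: "c\<^sup>2 * S = c\<^sup>2 * \<bar>y\<bar> + c\<^sup>2 * \<bar>y'\<bar> + c\<^sup>2 * \<bar>y''\<bar>" by (simp add: S_def algebra_simps)
  have nn: "0 \<le> c\<^sup>2 * \<bar>y\<bar>" "0 \<le> c\<^sup>2 * \<bar>y'\<bar>" "0 \<le> c\<^sup>2 * \<bar>y''\<bar>" by auto
  have bx: "\<bar>x1\<bar> \<le> 1" "\<bar>x2\<bar> \<le> 1" "\<bar>x1'\<bar> \<le> c" "\<bar>x2'\<bar> \<le> c" using x by auto
  have cu: "\<bar>cu\<bar> \<le> c\<^sup>2 * S" unfolding cu_def e
    using m1[OF bx(3) bx(2), of y] m1[OF bx(1,2), of y'] cS[of y] cS[of y'] cS[of y''] nn by linarith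
  have cv: "\<bar>cv\<bar> \<le> c\<^sup>2 * S" unfolding cv_def e
    using m2[OF bx(4) bx(1), of y] m1[OF bx(1,2), of y'] cS[of y] cS[of y'] cS[of y''] nn by linarith
  have tri: "\<bar>P + 2 * Q + R\<bar> \<le> \<bar>P\<bar> + 2 * \<bar>Q\<bar> + \<bar>R\<bar>" "\<bar>P + Q + R + T\<bar> \<le> \<bar>P\<bar> + \<bar>Q\<bar> + \<bar>R\<bar> + \<bar>T\<bar>" for P Q R T :: real
    by linarith+
  \<comment> \<open>Replacing the products by variables leaves purely linear arithmetic.\<close>
  have lin3: "P + 2 * Q + R \<le> 2 * (Y1 + Y2 + Y3)"
    if "P \<le> z1" "z1 \<le> Y1" "Q \<le> z2" "z2 \<le> Y2" "R \<le> z3" "z3 \<le> Y3" "0 \<le> Y1" "0 \<le> Y3"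
    for P Q R z1 z2 z3 Y1 Y2 Y3 :: real using that by argo
  have lin4: "P + Q + Q' + R \<le> 2 * (Y1 + Y2 + Y3)"
    if "P \<le> Y1" "Q \<le> z2" "Q' \<le> z2" "z2 \<le> Y2" "R \<le> z3" "z3 \<le> Y3" "0 \<le> Y1" "0 \<le> Y3"
    for P Q Q' R z2 z3 Y1 Y2 Y3 :: real using that by argo
  have cuu: "\<bar>cuu\<bar> \<le> 2 * (c\<^sup>2 * S)" unfolding cuu_def e
    by (rule order_trans[OF tri(1)], rule lin3[OF m1[OF x(9) bx(2), of y] cS(1) m1[OF bx(3) bx(2), of y'] cS(1)
      m1[OF bx(1,2), of y''] cS(2) nn(1) nn(3)])
  have cvv: "\<bar>cvv\<bar> \<le> 2 * (c\<^sup>2 * S)" unfolding cvv_def e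
    by (rule order_trans[OF tri(1)], rule lin3[OF m2[OF x(10) bx(1), of y] cS(1) m2[OF bx(4) bx(1), of y'] cS(1)
      m1[OF bx(1,2), of y''] cS(2) nn(1) nn(3)])
  have cuv: "\<bar>cuv\<bar> \<le> 2 * (c\<^sup>2 * S)" unfolding cuv_def e
    by (rule order_trans[OF tri(2)], rule lin4[OF m3[of y] m1[OF bx(3) bx(2), of y'] m2[OF bx(4) bx(1), of y'] cS(1)
      m1[OF bx(1,2), of y''] cS(2) nn(1) nn(3)])
  have bb: "\<bar>b * z\<bar> \<le> \<bar>z\<bar>" for z using b by (simp add: abs_mult mult_left_le_one_le)
  have lin5: "\<bar>2 * (s1 + bz + s4)\<bar> \<le> 4 * t1 + 4 * t2"
    if "\<bar>s1\<bar> \<le> t1" "\<bar>s2\<bar> \<le> t2" "\<bar>s3\<bar> \<le> t1" "\<bar>s4\<bar> \<le> t2" "\<bar>bz\<bar> \<le> \<bar>s2 + s3\<bar>"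
    for s1 s2 s3 s4 t1 t2 bz :: real using that by argo
  have "\<bar>cuu + 2 * b * cuv + cvv\<bar> \<le> 8 * (c\<^sup>2 * S)"
    using cuu cvv cuv bb[of cuv] by linarith
  then have 1: "\<bar>q * (cuu + 2 * b * cuv + cvv)\<bar> \<le> 8 * (c\<^sup>2 * S) * \<bar>q\<bar>"
    unfolding abs_mult[of q] by (subst mult.commute) (rule mult_right_mono, auto)
  have 2: "\<bar>cu * z\<bar> \<le> (c\<^sup>2 * S) * \<bar>z\<bar>" "\<bar>cv * z\<bar> \<le> (c\<^sup>2 * S) * \<bar>z\<bar>" for z
    using cu cv by (simp_all add: abs_mult mult_right_mono)
  have "\<bar>2 * (cu * qu + b * (cu * qv + cv * qu) + cv * qv)\<bar> \<le> 4 * ((c\<^sup>2 * S) * \<bar>qu\<bar>) + 4 * ((c\<^sup>2 * S) * \<bar>qv\<bar>)"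
    by (rule lin5[OF 2(1) 2(1) 2(2) 2(2) bb])
  moreover have "0 \<le> (c\<^sup>2 * S) * \<bar>qu\<bar>" "0 \<le> (c\<^sup>2 * S) * \<bar>qv\<bar>" using S by auto
  moreover have "8 * c\<^sup>2 * (S * (\<bar>q\<bar> + \<bar>qu\<bar> + \<bar>qv\<bar>)) = 8 * (c\<^sup>2 * S) * \<bar>q\<bar> + 8 * ((c\<^sup>2 * S) * \<bar>qu\<bar>) + 8 * ((c\<^sup>2 * S) * \<bar>qv\<bar>)"
    by (simp add: algebra_simps)
  ultimately show ?thesis using 1 unfolding S_def[symmetric] by linarith
qed

text \<open>The same estimate where both edge factors are 1: all second derivatives of the cutoff
  are then equal to y'', and both first derivatives to y'.\<close>

lemma interior_bounds:
  fixes y' y'' q qu qv :: real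
  shows "\<bar>q * (y'' + 2 * b * y'' + y'') + 2 * (y' * qu + b * (y' * qv + y' * qu) + y' * qv)\<bar>
    \<le> 8 * c\<^sup>2 * (\<bar>q\<bar> * \<bar>y''\<bar> + \<bar>y'\<bar> * (\<bar>qu\<bar> + \<bar>qv\<bar>))"
proof -
  have bb: "\<bar>b * z\<bar> \<le> \<bar>z\<bar>" for z using b by (simp add: abs_mult mult_left_le_one_le)
  have "\<bar>q * y''\<bar> = \<bar>q\<bar> * \<bar>y''\<bar>" "\<bar>y' * qu\<bar> = \<bar>y'\<bar> * \<bar>qu\<bar>" "\<bar>y' * qv\<bar> = \<bar>y'\<bar> * \<bar>qv\<bar>"
    by (simp_all add: abs_mult)
  note abs_eqs = this
  have lin: "\<bar>(2 * s0 + 2 * bs0) + 2 * (s1 + bz + s2)\<bar> \<le> 4 * (t0 + t1 + t2)"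
    if "\<bar>s0\<bar> = t0" "\<bar>s1\<bar> = t1" "\<bar>s2\<bar> = t2" "\<bar>bs0\<bar> \<le> \<bar>s0\<bar>" "\<bar>bz\<bar> \<le> \<bar>s2 + s1\<bar>"
    for s0 bs0 s1 bz s2 t0 t1 t2 :: real using that by argo
  have "q * (y'' + 2 * b * y'' + y'') = 2 * (q * y'') + 2 * (b * (q * y''))" by (simp add: algebra_simps)
  then have "\<bar>q * (y'' + 2 * b * y'' + y'') + 2 * (y' * qu + b * (y' * qv + y' * qu) + y' * qv)\<bar>
      \<le> 4 * (\<bar>q\<bar> * \<bar>y''\<bar> + \<bar>y'\<bar> * \<bar>qu\<bar> + \<bar>y'\<bar> * \<bar>qv\<bar>)"
    using lin[OF abs_eqs bb bb] by simp
  also have "\<dots> \<le> 8 * c\<^sup>2 * (\<bar>q\<bar> * \<bar>y''\<bar> + \<bar>y'\<bar> * \<bar>qu\<bar> + \<bar>y'\<bar> * \<bar>qv\<bar>)"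
  proof (rule mult_right_mono)
    have "1 \<le> c\<^sup>2" using c by simp
    then show "4 \<le> 8 * c\<^sup>2" by linarith
  qed auto
  finally show ?thesis by (simp add: algebra_simps)
qed

lemma jet_step1: "jet (\<lambda>p. A (fst p - 1)) (\<lambda>p. A' (fst p - 1)) (\<lambda>p. 0) (\<lambda>p. A'' (fst p - 1)) (\<lambda>p. 0) (\<lambda>p. 0)"
  using jet_compose[OF jet_affine[of 1 0 "-1"], where g = A and g' = A' and g'' = A''] dA dA' by simp

lemma jet_step2: "jet (\<lambda>p. A (snd p - 1)) (\<lambda>p. 0) (\<lambda>p. A' (snd p - 1)) (\<lambda>p. 0) (\<lambda>p. 0) (\<lambda>p. A'' (snd p - 1))"
  using jet_compose[OF jet_affine[of 0 1 "-1"], where g = A and g' = A' and g'' = A''] dA dA' by simp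

lemma smooth_cutoff:
  assumes "smooth_on UNIV Y"
  shows "smooth_on quadrant (cutoff Y)"
proof -
  have "smooth_on quadrant (\<lambda>p. A (1 * fst p + 0 * snd p + (-1)))"
    "smooth_on quadrant (\<lambda>p. A (0 * fst p + 1 * snd p + (-1)))"
    "smooth_on quadrant (\<lambda>p. Y (1 * fst p + 1 * snd p + 0))"
    by (rule smooth_on_compose_affine; simp add: smooth_A assms)+
  from smooth_on_mult[OF _ smooth_on_mult[OF _ this(1,2)] this(3)]
  show ?thesis unfolding cutoff_def[abs_def] by simp
qed

text \<open>Testing against C q, with C = \<open>cutoff Y\<close>, shows that the integral of C L q
  + E vanishes, where E collects the terms in which C is differentiated. If L q has a sign, this
  bounds mass in the interior by the mass of the sets carrying E. Three sets cover all applications,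
  with empty sets as padding.\<close>

lemma cutoff_estimate:
  assumes q: "smooth_on quadrant q" "jet q qu qv quu quv qvv"
    and Y: "smooth_on UNIV Y" "\<And>x. (Y has_real_derivative Y' x) (at x)"
      "\<And>x. (Y' has_real_derivative Y'' x) (at x)" "\<And>x. x > N \<Longrightarrow> Y x = 0"
    and e: "\<And>p. p \<in> corner N \<Longrightarrow> err Y Y' Y'' q qu qv p
        \<le> g1 * indicator S1 p + g2 * indicator S2 p + g3 * indicator S3 p"
    and S: "S1 \<in> fmeasurable \<Lambda>" "S2 \<in> fmeasurable \<Lambda>" "S3 \<in> fmeasurable \<Lambda>" and g: "g1 \<ge> 0" "g2 \<ge> 0" "g3 \<ge> 0"
  shows "\<bar>LINT p:corner N|\<Lambda>. cutoff Y p * lap quu quv qvv p\<bar>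
    \<le> 8 * c\<^sup>2 * (g1 * measure \<Lambda> S1 + g2 * measure \<Lambda> S2 + g3 * measure \<Lambda> S3)"
proof -
  define X1 where "X1 p = A (fst p - 1)" for p :: "real \<times> real"
  define X1' where "X1' p = A' (fst p - 1)" for p :: "real \<times> real"
  define X1'' where "X1'' p = A'' (fst p - 1)" for p :: "real \<times> real"
  define X2 where "X2 p = A (snd p - 1)" for p :: "real \<times> real"
  define X2' where "X2' p = A' (snd p - 1)" for p :: "real \<times> real"
  define X2'' where "X2'' p = A'' (snd p - 1)" for p :: "real \<times> real"
  define Z where "Z p = Y (fst p + snd p)" for p :: "real \<times> real"
  define Z' where "Z' p = Y' (fst p + snd p)" for p :: "real \<times> real"
  define Z'' where "Z'' p = Y'' (fst p + snd p)" for p :: "real \<times> real"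
  have C_eq: "cutoff Y = (\<lambda>p. X1 p * X2 p * Z p)"
    by (simp add: cutoff_def X1_def X2_def Z_def fun_eq_iff)
  have jZ: "jet Z Z' Z' Z'' Z'' Z''"
    using jet_compose[OF jet_affine[of 1 1 0], where g = Y and g' = Y' and g'' = Y''] Y
    by (simp add: Z_def[abs_def] Z'_def[abs_def] Z''_def[abs_def])
  have j1: "jet X1 X1' (\<lambda>p. 0) X1'' (\<lambda>p. 0) (\<lambda>p. 0)"
    using jet_step1 by (simp add: X1_def[abs_def] X1'_def[abs_def] X1''_def[abs_def])
  have j2: "jet X2 (\<lambda>p. 0) X2' (\<lambda>p. 0) (\<lambda>p. 0) X2''"
    using jet_step2 by (simp add: X2_def[abs_def] X2'_def[abs_def] X2''_def[abs_def])
  define Cu where "Cu p = X1' p * X2 p * Z p + X1 p * X2 p * Z' p" for p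
  define Cv where "Cv p = X1 p * X2' p * Z p + X1 p * X2 p * Z' p" for p
  define Cuu where "Cuu p = X1'' p * X2 p * Z p + 2 * (X1' p * X2 p * Z' p) + X1 p * X2 p * Z'' p" for p
  define Cuv where "Cuv p = X1' p * X2' p * Z p + X1' p * X2 p * Z' p + X1 p * X2' p * Z' p + X1 p * X2 p * Z'' p" for p
  define Cvv where "Cvv p = X1 p * X2'' p * Z p + 2 * (X1 p * X2' p * Z' p) + X1 p * X2 p * Z'' p" for p
  have jC: "jet (cutoff Y) Cu Cv Cuu Cuv Cvv"
    using jet_mult[OF jet_mult[OF j1 j2] jZ]
    unfolding C_eq Cu_def[abs_def] Cv_def[abs_def] Cuu_def[abs_def] Cuv_def[abs_def] Cvv_def[abs_def]
    by (simp add: algebra_simps)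
  \<comment> \<open>This is q L C plus twice the bilinear form of the operator, applied to the
    gradients of C and q.\<close>
  define E where "E p = q p * (Cuu p + 2 * b * Cuv p + Cvv p)
      + 2 * (Cu p * qu p + b * (Cu p * qv p + Cv p * qu p) + Cv p * qv p)" for p
  have sC: "smooth_on quadrant (cutoff Y)" by (rule smooth_cutoff[OF Y(1)])
  have s: "smooth_on quadrant (\<lambda>p. cutoff Y p * q p)" by (intro smooth_on_mult sC q open_quadrant)
  have "(LINT p:corner N|\<Lambda>. (cutoff Y p * quu p + 2 * (Cu p * qu p) + Cuu p * q p) +
      2 * b * (cutoff Y p * quv p + Cu p * qv p + Cv p * qu p + Cuv p * q p) +
      (cutoff Y p * qvv p + 2 * (Cv p * qv p) + Cvv p * q p)) = 0"
  proof (rule harmonic[OF s jet_mult[OF jC q(2)]])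
    show "cutoff Y p * q p = 0" if "p \<in> quadrant - corner N" for p
      using that A_0[of "fst p - 1"] A_0[of "snd p - 1"] Y(4)[of "fst p + snd p"]
      by (cases "1 \<le> fst p"; cases "1 \<le> snd p") (auto simp: cutoff_def corner_def)
  qed
  also have "(\<lambda>p. (cutoff Y p * quu p + 2 * (Cu p * qu p) + Cuu p * q p) +
      2 * b * (cutoff Y p * quv p + Cu p * qv p + Cv p * qu p + Cuv p * q p) +
      (cutoff Y p * qvv p + 2 * (Cv p * qv p) + Cvv p * q p)) =
      (\<lambda>p. cutoff Y p * lap quu quv qvv p + E p)"
    by (simp add: E_def lap_def fun_eq_iff algebra_simps)
  finally have 0: "(LINT p:corner N|\<Lambda>. cutoff Y p * lap quu quv qvv p + E p) = 0" .
  note cont = jet_smooth[OF q, THEN smooth_on_imp_continuous_on] smooth_on_imp_continuous_on[OF q(1)]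
    jet_smooth[OF sC jC, THEN smooth_on_imp_continuous_on] smooth_on_imp_continuous_on[OF sC]
  have i1: "set_integrable \<Lambda> (corner N) (\<lambda>p. cutoff Y p * lap quu quv qvv p)"
    unfolding lap_def by (intro integrable_corner continuous_intros cont)
  have i2: "set_integrable \<Lambda> (corner N) E"
    unfolding E_def by (intro integrable_corner continuous_intros cont)
  have "(LINT p:corner N|\<Lambda>. cutoff Y p * lap quu quv qvv p) = - (LINT p:corner N|\<Lambda>. E p)"
    using 0 set_integral_add(2)[OF i1 i2] by linarith
  then have "\<bar>LINT p:corner N|\<Lambda>. cutoff Y p * lap quu quv qvv p\<bar> = \<bar>LINT p:corner N|\<Lambda>. E p\<bar>" by simp
  also have "\<dots> \<le> (\<integral>p. \<bar>indicator (corner N) p *\<^sub>R E p\<bar> \<partial>\<Lambda>)"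
    unfolding set_lebesgue_integral_def using integral_norm_bound[of \<Lambda> "\<lambda>p. indicator (corner N) p *\<^sub>R E p"] by simp
  also have "\<dots> \<le> (\<integral>p. 8 * c\<^sup>2 * (g1 * indicator S1 p + g2 * indicator S2 p + g3 * indicator S3 p) \<partial>\<Lambda>)"
  proof (rule integral_mono)
    show "integrable \<Lambda> (\<lambda>p. \<bar>indicat_real (corner N) p *\<^sub>R E p\<bar>)"
      using i2 unfolding set_integrable_def by (rule integrable_abs)
    show "integrable \<Lambda> (\<lambda>p. 8 * c\<^sup>2 * (g1 * indicator S1 p + g2 * indicator S2 p + g3 * indicator S3 p))"
      using S by (intro integrable_mult_right Bochner_Integration.integrable_add)
        (auto simp: fmeasurable_def)
    fix p
    show "\<bar>indicat_real (corner N) p *\<^sub>R E p\<bar> \<le>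
        8 * c\<^sup>2 * (g1 * indicator S1 p + g2 * indicator S2 p + g3 * indicator S3 p)"
    proof (cases "p \<in> corner N")
      case False then show ?thesis using g by auto
    next
      case True
      have "\<bar>E p\<bar> \<le> 8 * c\<^sup>2 * err Y Y' Y'' q qu qv p"
      proof (cases "fst p \<le> 2 \<or> snd p \<le> 2")
        case strip: True
        have "\<bar>E p\<bar> \<le> 8 * c\<^sup>2 * ((\<bar>Z p\<bar> + \<bar>Z' p\<bar> + \<bar>Z'' p\<bar>) * (\<bar>q p\<bar> + \<bar>qu p\<bar> + \<bar>qv p\<bar>))"
          unfolding E_def Cu_def Cv_def Cuu_def Cuv_def Cvv_def
          by (rule quadratic_bounds)
            (auto simp: X1_def X2_def X1'_def X2'_def X1''_def X2''_def A_ge A_le A'_ge A'_le A''_le)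
        then show ?thesis using strip by (simp add: err_def Z_def Z'_def Z''_def)
      next
        case False
        then have x: "X1 p = 1" "X2 p = 1" "X1' p = 0" "X2' p = 0" "X1'' p = 0" "X2'' p = 0"
          by (auto simp: X1_def X2_def X1'_def X2'_def X1''_def X2''_def A_1 A'_0 A''_0)
        show ?thesis
          using interior_bounds[of "q p" "Z'' p" "Z' p" "qu p" "qv p"] False
          by (simp add: err_def E_def Cu_def Cv_def Cuu_def Cuv_def Cvv_def x Z'_def Z''_def)
      qed
      also have "\<dots> \<le> 8 * c\<^sup>2 * (g1 * indicator S1 p + g2 * indicator S2 p + g3 * indicator S3 p)"
        using e[OF True] by (intro mult_left_mono) auto
      finally show ?thesis using True by simp
    qed
  qed
  also have "\<dots> = 8 * c\<^sup>2 * (g1 * measure \<Lambda> S1 + g2 * measure \<Lambda> S2 + g3 * measure \<Lambda> S3)"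
    using S by (simp add: fmeasurable_def Bochner_Integration.integral_add)
  finally show ?thesis .
qed

lemma integrable_cutoff_lap:
  assumes "smooth_on quadrant q" "jet q qu qv quu quv qvv" "smooth_on UNIV Y"
  shows "set_integrable \<Lambda> (corner N) (\<lambda>p. cutoff Y p * lap quu quv qvv p)"
  unfolding lap_def
  by (intro integrable_corner continuous_intros jet_smooth[OF assms(1,2), THEN smooth_on_imp_continuous_on]
      smooth_on_imp_continuous_on[OF smooth_cutoff] assms)

section \<open>Signs of Laplacians, barriers, and shells of mass o(n^2)\<close>

lemma set_integral_lower_bound:
  fixes F f :: "real \<times> real \<Rightarrow> real"
  assumes "set_integrable \<Lambda> (corner N) F" "set_integrable \<Lambda> E f" "E \<subseteq> corner N"
    "\<And>p. p \<in> corner N \<Longrightarrow> 0 \<le> F p" "\<And>p. p \<in> E \<Longrightarrow> f p \<le> F p"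
  shows "(LINT p:E|\<Lambda>. f p) \<le> (LINT p:corner N|\<Lambda>. F p)"
  unfolding set_lebesgue_integral_def
proof (rule integral_mono)
  fix p
  show "indicat_real E p *\<^sub>R f p \<le> indicat_real (corner N) p *\<^sub>R F p"
    using assms(3-5) by (cases "p \<in> E"; cases "p \<in> corner N") auto
qed (use assms(1,2) in \<open>auto simp: set_integrable_def\<close>)

lemma quadratic_form_nonneg: "0 \<le> x\<^sup>2 + 2 * b * (x * y) + y\<^sup>2" for x y :: real
proof -
  have "b\<^sup>2 \<le> 1" using b by (simp add: abs_square_le_1)
  then have "0 \<le> (x + b * y)\<^sup>2 + (1 - b\<^sup>2) * y\<^sup>2" by simp
  also have "\<dots> = x\<^sup>2 + 2 * b * (x * y) + y\<^sup>2" by (simp add: algebra_simps power2_eq_square)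
  finally show ?thesis .
qed

lemma B_nonneg: "0 \<le> B x"
  using B_0[of x] B_pos[of x] by (cases "x \<le> 0") auto

text \<open>The function falls from 1 to 0 while x runs from n P to n (P + 1), so each derivative
  gains a factor 1 / n.\<close>

lemma smooth_decreasing_step:
  assumes "n > 0"
  shows "smooth_on UNIV (\<lambda>x. 1 - A (x / n - P))"
    and "((\<lambda>x. 1 - A (x / n - P)) has_real_derivative - (A' (x / n - P) / n)) (at x)"
    and "((\<lambda>x. - (A' (x / n - P) / n)) has_real_derivative - (A'' (x / n - P) / n\<^sup>2)) (at x)"
proof -
  have d: "((\<lambda>x. x / n - P) has_real_derivative 1 / n) (at x)" for x
    using assms by (auto intro!: derivative_eq_intros)
  have "smooth_on UNIV (\<lambda>x. (1 / n) * x + (- P))"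
    by (intro smooth_on_add smooth_on_cmult smooth_on_id smooth_on_const open_UNIV)
  then have "smooth_on UNIV (\<lambda>x. A ((1 / n) * x + (- P)))"
    by (rule smooth_on_compose_UNIV[OF open_UNIV smooth_A])
  then show "smooth_on UNIV (\<lambda>x. 1 - A (x / n - P))"
    using smooth_on_diff[OF open_UNIV smooth_on_const[OF open_UNIV, of 1]] by simp
  show "((\<lambda>x. 1 - A (x / n - P)) has_real_derivative - (A' (x / n - P) / n)) (at x)"
    using DERIV_diff[OF DERIV_const[of 1] DERIV_chain2[OF dA d], of x] by simp
  show "((\<lambda>x. - (A' (x / n - P) / n)) has_real_derivative - (A'' (x / n - P) / n\<^sup>2)) (at x)"
    using DERIV_minus[OF DERIV_cdivide[OF DERIV_chain2[OF dA' d], of n]] by (simp add: power2_eq_square)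
qed

text \<open>
  The barrier \<open>q = B \<ell>\<^sub>1 B \<ell>\<^sub>2\<close> is supported in a triangle based on the strip; the condition on the
  conormal product of the two linear forms makes it subharmonic, so the mass of the triangle is
  controlled by the mass of its base.
\<close>

lemma block_part_bound:
  assumes cross: "1 \<le> - (a1 * a2 + b * (a1 * b2 + b1 * a2) + b1 * b2)" and pos: "a2 > 0" "b2 > 0"
  shows "\<exists>C M. C \<ge> 0 \<and> M > 0 \<and> (\<forall>n\<ge>1. measure \<Lambda> (block n \<inter> {p. 2 * n \<le> a1 * fst p + b1 * snd p})
      \<le> C * n\<^sup>2 * measure \<Lambda> (strip 2 (n / M)))"
proof -
  \<comment> \<open>a1 u + b1 v \<le> M (u + v), so the barrier lives where u + v \<ge> n / M; the
    summand 1 keeps M positive.\<close>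
  define M where "M = \<bar>a1\<bar> + \<bar>b1\<bar> + 1"
  \<comment> \<open>This value makes \<open>l2\<close> at least 1 wherever u + v \<le> 2 n, in
    particular on the shell. Conversely \<open>l2\<close> > 0 forces u + v \<le> P n with P = D /
    m.\<close>
  define D where "D = 1 + 2 * (a2 + b2)"
  define m where "m = min a2 b2"
  define P where "P = D / m"
  have m: "m > 0" "m \<le> a2" "m \<le> b2" using pos by (auto simp: m_def)
  have D: "D \<ge> 1" using pos by (simp add: D_def)
  have P: "P \<ge> 2" using m D unfolding P_def D_def by (simp add: field_simps)
  have M: "M > 0" by (simp add: M_def)
  \<comment> \<open>The sum of the bounds for |q|, |qu| and |qv| on the support, where B(l1) \<le> M
    P and B(l2) \<le> D; factors 1 / n are dropped because n \<ge> 1.\<close>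
  define g1 where "g1 = M * P * D + (M * P * a2 + \<bar>a1\<bar> * D) + (M * P * b2 + \<bar>b1\<bar> * D)"
  have g1: "g1 \<ge> 0" using M P D pos unfolding g1_def by (intro add_nonneg_nonneg mult_nonneg_nonneg) auto
  have main: "measure \<Lambda> (block n \<inter> {p. 2 * n \<le> a1 * fst p + b1 * snd p})
      \<le> (4 * c\<^sup>2 * g1) * n\<^sup>2 * measure \<Lambda> (strip 2 (n / M))" if n: "n \<ge> 1" for n
  proof -
    define l1 where "l1 p = (a1 / n) * fst p + (b1 / n) * snd p + (-1)" for p :: "real \<times> real"
    define l2 where "l2 p = (- a2 / n) * fst p + (- b2 / n) * snd p + D" for p :: "real \<times> real"
    have l1: "l1 p = (a1 * fst p + b1 * snd p) / n - 1" for p using n by (simp add: l1_def field_simps)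
    have l2: "l2 p = D - (a2 * fst p + b2 * snd p) / n" for p using n by (simp add: l2_def field_simps)
    define q where "q p = B (l1 p) * B (l2 p)" for p
    define qu where "qu p = B (l1 p) * (A (l2 p) * (- a2 / n)) + (A (l1 p) * (a1 / n)) * B (l2 p)" for p
    define qv where "qv p = B (l1 p) * (A (l2 p) * (- b2 / n)) + (A (l1 p) * (b1 / n)) * B (l2 p)" for p
    define quu where "quu p = B (l1 p) * (A' (l2 p) * (- a2 / n)\<^sup>2)
      + 2 * ((A (l1 p) * (a1 / n)) * (A (l2 p) * (- a2 / n))) + (A' (l1 p) * (a1 / n)\<^sup>2) * B (l2 p)" for p
    define quv where "quv p = B (l1 p) * (A' (l2 p) * ((- a2 / n) * (- b2 / n)))
      + (A (l1 p) * (a1 / n)) * (A (l2 p) * (- b2 / n)) + (A (l1 p) * (b1 / n)) * (A (l2 p) * (- a2 / n))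
      + (A' (l1 p) * ((a1 / n) * (b1 / n))) * B (l2 p)" for p
    define qvv where "qvv p = B (l1 p) * (A' (l2 p) * (- b2 / n)\<^sup>2)
      + 2 * ((A (l1 p) * (b1 / n)) * (A (l2 p) * (- b2 / n))) + (A' (l1 p) * (b1 / n)\<^sup>2) * B (l2 p)" for p
    have j1: "jet (\<lambda>p. B (l1 p)) (\<lambda>p. A (l1 p) * (a1 / n)) (\<lambda>p. A (l1 p) * (b1 / n))
      (\<lambda>p. A' (l1 p) * (a1 / n)\<^sup>2) (\<lambda>p. A' (l1 p) * ((a1 / n) * (b1 / n))) (\<lambda>p. A' (l1 p) * (b1 / n)\<^sup>2)"
      using jet_compose[OF jet_affine[of "a1 / n" "b1 / n" "-1"], where g = B and g' = A and g'' = A'] dA dB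
      by (simp add: l1_def[abs_def])
    have j2: "jet (\<lambda>p. B (l2 p)) (\<lambda>p. A (l2 p) * (- a2 / n)) (\<lambda>p. A (l2 p) * (- b2 / n))
      (\<lambda>p. A' (l2 p) * (- a2 / n)\<^sup>2) (\<lambda>p. A' (l2 p) * ((- a2 / n) * (- b2 / n))) (\<lambda>p. A' (l2 p) * (- b2 / n)\<^sup>2)"
      using jet_compose[OF jet_affine[of "- a2 / n" "- b2 / n" D], where g = B and g' = A and g'' = A'] dA dB
      by (simp add: l2_def[abs_def])
    have jq: "jet q qu qv quu quv qvv"
      using jet_mult[OF j1 j2]
      unfolding q_def[abs_def] qu_def[abs_def] qv_def[abs_def] quu_def[abs_def] quv_def[abs_def] qvv_def[abs_def] .
    have sq: "smooth_on quadrant q"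
      unfolding q_def[abs_def] l1_def l2_def
      by (rule smooth_on_mult; rule smooth_on_compose_affine open_quadrant; simp add: smooth_B)
    have lap_q: "lap quu quv qvv p = B (l1 p) * A' (l2 p) * (a2\<^sup>2 + 2 * b * (a2 * b2) + b2\<^sup>2) / n\<^sup>2
       + A' (l1 p) * B (l2 p) * (a1\<^sup>2 + 2 * b * (a1 * b1) + b1\<^sup>2) / n\<^sup>2
       + 2 * (A (l1 p) * A (l2 p)) * (- (a1 * a2 + b * (a1 * b2 + b1 * a2) + b1 * b2)) / n\<^sup>2" for p
      unfolding lap_def quu_def quv_def qvv_def
      using n by (simp add: field_simps power2_eq_square)
    \<comment> \<open>The terms containing \<open>A'\<close> are nonnegative because the quadratic
      form is; the hypothesis \<open>cross\<close> bounds the remaining term from below.\<close>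
    have lap_ge: "2 * (A (l1 p) * A (l2 p)) / n\<^sup>2 \<le> lap quu quv qvv p" for p
    proof -
      have "0 \<le> B (l1 p) * A' (l2 p) * (a2\<^sup>2 + 2 * b * (a2 * b2) + b2\<^sup>2) / n\<^sup>2"
        "0 \<le> A' (l1 p) * B (l2 p) * (a1\<^sup>2 + 2 * b * (a1 * b1) + b1\<^sup>2) / n\<^sup>2"
        by (intro divide_nonneg_nonneg mult_nonneg_nonneg B_nonneg A'_ge quadratic_form_nonneg zero_le_power2)+
      moreover have "2 * (A (l1 p) * A (l2 p)) * 1 / n\<^sup>2 \<le>
          2 * (A (l1 p) * A (l2 p)) * (- (a1 * a2 + b * (a1 * b2 + b1 * a2) + b1 * b2)) / n\<^sup>2"
        using cross A_ge by (intro divide_right_mono mult_left_mono) auto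
      ultimately show ?thesis unfolding lap_q by linarith
    qed
    \<comment> \<open>On the corner the support of q already lies in u + v \<le> P n, where Y = 1.
      The cutoff at infinity therefore adds no error.\<close>
    define N where "N = (P + 1) * n"
    define Y where "Y x = 1 - A (x / n - P)" for x
    define Y' where "Y' x = - (A' (x / n - P) / n)" for x
    define Y'' where "Y'' x = - (A'' (x / n - P) / n\<^sup>2)" for x
    note Yd = smooth_decreasing_step[of n P, folded Y_def Y'_def Y''_def, unfolded Y_def[abs_def, symmetric] Y'_def[abs_def, symmetric]]
    have Y0: "Y x = 0" if "x > N" for x
      using that n by (simp add: Y_def N_def A_1 field_simps)
    have Y1: "Y x = 1" "Y' x = 0" "Y'' x = 0" if "x \<le> P * n" for x
    proof -
      have "x / n - P \<le> 0" using that n by (simp add: field_simps)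
      then show "Y x = 1" "Y' x = 0" "Y'' x = 0" by (simp_all add: Y_def Y'_def Y''_def A_0 A'_0 A''_0)
    qed
    have Yge: "Y x \<ge> 0" for x by (simp add: Y_def A_le)
    define E where "E = block n \<inter> {p. 2 * n \<le> a1 * fst p + b1 * snd p}"
    have errb: "err Y Y' Y'' q qu qv p \<le> g1 * indicator (strip 2 (n / M)) p + 0 * indicator {} p + 0 * indicator {} p"
      if p: "p \<in> corner N" for p
    proof (cases "l1 p > 0 \<and> l2 p > 0")
      case False
      then have "q p = 0" "qu p = 0" "qv p = 0"
        by (auto simp: q_def qu_def qv_def A_0 B_0 not_less)
      then have "err Y Y' Y'' q qu qv p = 0" by (simp add: err_def)
      then show ?thesis using g1 by simp
    next
      case True
      have uv: "fst p \<ge> 1" "snd p \<ge> 1" using p by (auto simp: corner_def)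
      have "m * fst p + m * snd p \<le> a2 * fst p + b2 * snd p"
        using m uv by (intro add_mono mult_right_mono) auto
      also have "\<dots> \<le> D * n" using True n unfolding l2 by (simp add: field_simps)
      finally have le: "fst p + snd p \<le> P * n"
        using m by (simp add: P_def field_simps)
      have "a1 * fst p + b1 * snd p \<le> \<bar>a1\<bar> * fst p + \<bar>b1\<bar> * snd p"
        using uv by (intro add_mono mult_right_mono) auto
      also have "\<dots> \<le> M * fst p + M * snd p"
        using uv by (intro add_mono mult_right_mono) (auto simp: M_def)
      finally have ab: "a1 * fst p + b1 * snd p \<le> M * (fst p + snd p)" by (simp add: algebra_simps)
      have "n \<le> a1 * fst p + b1 * snd p" using True n unfolding l1 by (simp add: field_simps)
      with ab have ge: "n / M \<le> fst p + snd p" using M by (simp add: field_simps)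
      note y = Y1[OF le]
      show ?thesis
      proof (cases "fst p \<le> 2 \<or> snd p \<le> 2")
        case False
        then have "err Y Y' Y'' q qu qv p = 0" by (simp add: err_def y)
        then show ?thesis using g1 by simp
      next
        case strip: True
        have "l1 p \<le> (M * (P * n)) / n"
        proof -
          have "l1 p \<le> (M * (fst p + snd p)) / n"
            unfolding l1 using divide_right_mono[OF ab, of n] n by simp
          also have "\<dots> \<le> (M * (P * n)) / n"
            using le M n by (intro divide_right_mono mult_left_mono) auto
          finally show ?thesis .
        qed
        then have l1_le: "l1 p \<le> M * P" using n by simp
        have l2_le: "l2 p \<le> D" unfolding l2 using pos uv n by simp
        have B1: "B (l1 p) \<le> M * P" and B2: "B (l2 p) \<le> D"
          using B_pos[of "l1 p"] B_pos[of "l2 p"] True l1_le l2_le by auto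
        have q_le: "\<bar>q p\<bar> \<le> M * P * D"
          unfolding q_def abs_mult using B1 B2 B_nonneg M P by (intro mult_mono) auto
        have dq: "\<bar>B (l1 p) * (A (l2 p) * (- z2 / n)) + (A (l1 p) * (z1 / n)) * B (l2 p)\<bar> \<le> M * P * z2 + \<bar>z1\<bar> * D"
          if "z2 > 0" for z1 z2
        proof -
          have "\<bar>B (l1 p) * (A (l2 p) * (- z2 / n))\<bar> = B (l1 p) * (A (l2 p) * (z2 / n))"
            using that n A_ge B_nonneg by (simp add: abs_mult)
          also have "\<dots> \<le> (M * P) * (1 * z2)"
            using B1 that n A_ge[of "l2 p"] A_le[of "l2 p"] B_nonneg[of "l1 p"] M P
            by (intro mult_mono) (auto simp: field_simps)
          finally have 1: "\<bar>B (l1 p) * (A (l2 p) * (- z2 / n))\<bar> \<le> M * P * z2" by simp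
          have "\<bar>(A (l1 p) * (z1 / n)) * B (l2 p)\<bar> = (A (l1 p) * (\<bar>z1\<bar> / n)) * B (l2 p)"
            using n A_ge B_nonneg by (simp add: abs_mult)
          also have "\<dots> \<le> (1 * \<bar>z1\<bar>) * D"
          proof (intro mult_mono)
            have "\<bar>z1\<bar> * 1 \<le> \<bar>z1\<bar> * n" using n by (intro mult_left_mono) auto
            then show "\<bar>z1\<bar> / n \<le> \<bar>z1\<bar>" using n by (simp add: field_simps)
          qed (use A_ge A_le B2 B_nonneg n in auto)
          finally have 2: "\<bar>(A (l1 p) * (z1 / n)) * B (l2 p)\<bar> \<le> \<bar>z1\<bar> * D" by simp
          show ?thesis using 1 2 by linarith
        qed
        have "\<bar>qu p\<bar> \<le> M * P * a2 + \<bar>a1\<bar> * D" "\<bar>qv p\<bar> \<le> M * P * b2 + \<bar>b1\<bar> * D"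
          unfolding qu_def qv_def by (rule dq[OF pos(1)], rule dq[OF pos(2)])
        with q_le have "err Y Y' Y'' q qu qv p \<le> g1"
          using strip by (simp add: err_def y g1_def)
        moreover have "p \<in> strip 2 (n / M)" using uv strip ge by (auto simp: strip_def)
        ultimately show ?thesis by simp
      qed
    qed
    have est: "\<bar>LINT p:corner N|\<Lambda>. cutoff Y p * lap quu quv qvv p\<bar>
        \<le> 8 * c\<^sup>2 * (g1 * measure \<Lambda> (strip 2 (n / M)) + 0 * measure \<Lambda> {} + 0 * measure \<Lambda> {})"
      by (rule cutoff_estimate[OF sq jq Yd Y0 errb]) (use n g1 in auto)
    have Em: "E \<in> fmeasurable \<Lambda>"
      unfolding E_def by (rule fmeasurable_Int_fmeasurable) (auto intro!: borel_closed closed_Collect_le continuous_intros)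
    have E_int: "set_integrable \<Lambda> E (\<lambda>p. 2 / n\<^sup>2)"
      using Em unfolding set_integrable_def by (auto simp: fmeasurable_def)
    have "(LINT p:E|\<Lambda>. 2 / n\<^sup>2) \<le> (LINT p:corner N|\<Lambda>. cutoff Y p * lap quu quv qvv p)"
    proof (rule set_integral_lower_bound[OF _ E_int])
      show "set_integrable \<Lambda> (corner N) (\<lambda>p. cutoff Y p * lap quu quv qvv p)"
        by (rule integrable_cutoff_lap[OF sq jq Yd(1)]) (use n in auto)
      have "2 * n \<le> N" using P n by (simp add: N_def)
      then show "E \<subseteq> corner N" by (auto simp: E_def block_def corner_def)
      show "0 \<le> cutoff Y p * lap quu quv qvv p" for p
        using lap_ge[of p] A_ge Yge unfolding cutoff_def
        by (intro mult_nonneg_nonneg) (auto intro: order_trans[rotated])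
      fix p assume p: "p \<in> E"
      then have uv: "2 \<le> fst p" "2 \<le> snd p" "fst p + snd p \<le> 2 * n" "2 * n \<le> a1 * fst p + b1 * snd p"
        by (auto simp: E_def block_def)
      have "2 * n \<le> P * n" using P n by simp
      then have "Y (fst p + snd p) = 1" using Y1(1)[OF order_trans[OF uv(3)]] by blast
      then have C1: "cutoff Y p = 1" using uv by (simp add: cutoff_def A_1)
      have "l1 p \<ge> 1" unfolding l1 using uv n by (simp add: field_simps)
      moreover have "l2 p \<ge> 1"
      proof -
        have "a2 * fst p + b2 * snd p \<le> (a2 + b2) * fst p + (a2 + b2) * snd p"
          using pos uv by (intro add_mono mult_right_mono) auto
        also have "\<dots> = (a2 + b2) * (fst p + snd p)" by (simp add: algebra_simps)
        also have "\<dots> \<le> (a2 + b2) * (2 * n)" using pos uv by (intro mult_left_mono) auto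
        finally have "(a2 * fst p + b2 * snd p) / n \<le> 2 * (a2 + b2)" using n by (simp add: field_simps)
        then show ?thesis unfolding l2 D_def by linarith
      qed
      ultimately have "2 / n\<^sup>2 \<le> lap quu quv qvv p" using lap_ge[of p] by (simp add: A_1)
      then show "2 / n\<^sup>2 \<le> cutoff Y p * lap quu quv qvv p" using C1 by simp
    qed
    also have "\<dots> \<le> 8 * c\<^sup>2 * (g1 * measure \<Lambda> (strip 2 (n / M)))" using est by simp
    finally have "2 / n\<^sup>2 * measure \<Lambda> E \<le> 8 * c\<^sup>2 * (g1 * measure \<Lambda> (strip 2 (n / M)))"
      using Em by (simp add: set_lebesgue_integral_def fmeasurable_def mult.commute)
    then have "measure \<Lambda> E \<le> (4 * c\<^sup>2 * g1) * n\<^sup>2 * measure \<Lambda> (strip 2 (n / M))"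
      using n by (simp add: field_simps)
    then show ?thesis unfolding E_def .
  qed
  have "4 * c\<^sup>2 * g1 \<ge> 0" using g1 by simp
  then show ?thesis using main M by blast
qed

text \<open>Each half of the shell, v \<le> u and u \<le> v, is covered by one barrier, with first
  linear form a (u - k v) or a (v - k u). Taking k < 1 puts the half shell into the region where
  this form is large; k > b permits a second form with positive coefficients whose product with the
  first is sufficiently negative.\<close>

lemma block_subquadratic: "(\<lambda>n. measure \<Lambda> (block (real n)) / (real n)\<^sup>2) \<longlonglongrightarrow> 0"
proof -
  \<comment> \<open>Any number strictly between |b| and 1 would do. The choice a (1 - k) = 4 gives a
    u - k a v \<ge> 4 u \<ge> 2 n when v \<le> u, and k2 (k - b) = 3 outweighs b k - 1 \<ge>
    -2.\<close>
  define k where "k = (1 + \<bar>b\<bar>) / 2"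
  define a where "a = 4 / (1 - k)"
  define k2 where "k2 = 3 / (k - b)"
  have k: "0 < k" "k < 1" "k > b" using b by (auto simp: k_def)
  have a: "a \<ge> 4" using k by (simp add: a_def field_simps)
  have "4 / d * d = 4" if "d > 0" for d :: real using that by simp
  from this[of "1 - k"] have a4: "a * (1 - k) = 4" using k by (simp only: a_def diff_gt_0_iff_gt)
  have "3 / d * d = 3" if "d > 0" for d :: real using that by simp
  from this[of "k - b"] have k2: "k2 > 0" "k2 * (k - b) = 3"
    using k by (simp add: k2_def, simp only: k2_def diff_gt_0_iff_gt)
  have bk: "b * k \<ge> -1"
  proof -
    have "\<bar>b * k\<bar> \<le> 1 * 1" unfolding abs_mult using b k by (intro mult_mono) auto
    then show ?thesis by linarith
  qed
  have "a * 1 \<le> a * (k2 * (k - b) + b * k - 1)" using a bk k2 by (intro mult_left_mono) auto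
  then have cr: "1 \<le> a * (k2 * (k - b) + b * k - 1)" using a by linarith
  have c1: "1 \<le> - (a * 1 + b * (a * k2 + (- k * a) * 1) + (- k * a) * k2)"
    using cr by (simp add: algebra_simps)
  have c2: "1 \<le> - ((- k * a) * k2 + b * ((- k * a) * 1 + a * k2) + a * 1)"
    using cr by (simp add: algebra_simps)
  from block_part_bound[OF c1 zero_less_one k2(1)]
  obtain C1 M1 where 1: "C1 \<ge> 0" "M1 > 0" "\<And>n. n \<ge> 1 \<Longrightarrow> measure \<Lambda> (block n \<inter> {p. 2 * n \<le> a * fst p + (- k * a) * snd p})
      \<le> C1 * n\<^sup>2 * measure \<Lambda> (strip 2 (n / M1))" by blast
  from block_part_bound[OF c2 k2(1) zero_less_one]
  obtain C2 M2 where 2: "C2 \<ge> 0" "M2 > 0" "\<And>n. n \<ge> 1 \<Longrightarrow> measure \<Lambda> (block n \<inter> {p. 2 * n \<le> (- k * a) * fst p + a * snd p})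
      \<le> C2 * n\<^sup>2 * measure \<Lambda> (strip 2 (n / M2))" by blast
  have ub: "measure \<Lambda> (block n) / n\<^sup>2 \<le> C1 * measure \<Lambda> (strip 2 (n / M1)) + C2 * measure \<Lambda> (strip 2 (n / M2))"
    if n: "n \<ge> 1" for n
  proof -
    let ?S = "block n \<inter> {p. 2 * n \<le> a * fst p + (- k * a) * snd p}"
    let ?T = "block n \<inter> {p. 2 * n \<le> (- k * a) * fst p + a * snd p}"
    have ineq: "2 * n \<le> a * u - k * a * v" if "v \<le> u" "n \<le> u + v" for u v
    proof -
      have "n \<le> 2 * u" using that by linarith
      then have "2 * n \<le> 4 * u" by linarith
      also have "\<dots> = a * (1 - k) * u" by (simp only: a4)
      also have "\<dots> = a * u - (k * a) * u" by (simp add: algebra_simps)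
      also have "\<dots> \<le> a * u - k * a * v" using that a k by (intro diff_left_mono mult_left_mono) auto
      finally show ?thesis .
    qed
    have "block n \<subseteq> ?S \<union> ?T"
    proof
      fix p assume p: "p \<in> block n"
      then have "n \<le> fst p + snd p" "n \<le> snd p + fst p" by (auto simp: block_def)
      then show "p \<in> ?S \<union> ?T"
        using p ineq[of "snd p" "fst p"] ineq[of "fst p" "snd p"] by (cases "snd p \<le> fst p") auto
    qed
    moreover have fS: "?S \<in> fmeasurable \<Lambda>" "?T \<in> fmeasurable \<Lambda>"
      by (rule fmeasurable_Int_fmeasurable; auto intro!: borel_closed closed_Collect_le continuous_intros)+
    ultimately have "measure \<Lambda> (block n) \<le> measure \<Lambda> (?S \<union> ?T)"
      by (intro measure_mono_fmeasurable) auto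
    also have "\<dots> \<le> measure \<Lambda> ?S + measure \<Lambda> ?T"
      using fS by (intro measure_Un_le) (auto simp: fmeasurable_def)
    also have "\<dots> \<le> C1 * n\<^sup>2 * measure \<Lambda> (strip 2 (n / M1)) + C2 * n\<^sup>2 * measure \<Lambda> (strip 2 (n / M2))"
      by (intro add_mono 1(3) 2(3) n)
    finally show ?thesis using n by (simp add: field_simps)
  qed
  have lim: "(\<lambda>n. C1 * measure \<Lambda> (strip 2 (real n / M1)) + C2 * measure \<Lambda> (strip 2 (real n / M2))) \<longlonglongrightarrow> C1 * 0 + C2 * 0"
    by (intro tendsto_intros strip_tail 1 2)
  show ?thesis
  proof (rule tendsto_sandwich[OF _ _ tendsto_const])
    show "\<forall>\<^sub>F n in sequentially. 0 \<le> measure \<Lambda> (block (real n)) / (real n)\<^sup>2" by simp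
    show "\<forall>\<^sub>F n in sequentially. measure \<Lambda> (block (real n)) / (real n)\<^sup>2 \<le>
        C1 * measure \<Lambda> (strip 2 (real n / M1)) + C2 * measure \<Lambda> (strip 2 (real n / M2))"
      using eventually_ge_at_top[of 1] by eventually_elim (use ub in auto)
  qed (use lim in simp)
qed

section \<open>Shells have mass o(n)\<close>

definition wedge :: "real \<Rightarrow> (real \<times> real) set" where
  "wedge N = {p. 2 \<le> fst p \<and> 2 \<le> snd p \<and> fst p + snd p \<le> N}"

lemma fmeasurable_wedge [simp, intro]: "wedge N \<in> fmeasurable \<Lambda>"
proof (rule fmeasurableI2[OF fmeasurable_corner[of N]])
  have "closed (wedge N)" unfolding wedge_def by (intro closed_Collect_conj closed_Collect_le continuous_intros)
  then show "wedge N \<in> sets \<Lambda>" by (simp add: borel_closed)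
qed (force simp: wedge_def corner_def)

lemma wedge_subset: "wedge N \<subseteq> corner N"
  by (auto simp: wedge_def corner_def)

lemma set_integrable_wedge:
  fixes f :: "real \<times> real \<Rightarrow> real"
  assumes "continuous_on quadrant f"
  shows "set_integrable \<Lambda> (wedge N) f"
  using integrable_corner[OF assms, of N] fmeasurable_wedge[of N] wedge_subset
  by (rule_tac set_integrable_subset) (auto simp: fmeasurable_def)

text \<open>
  The test function is the concave function \<open>q = h - B (h - R)\<close>, a truncation of \<open>h = u v / (u + v)\<close>;
  it is constant where \<open>h > R + 1\<close>, which keeps the error of the cutoff at infinity under control.
\<close>

lemma wedge_integral_bounded:
  "\<exists>C. \<forall>N. (LINT p:wedge N|\<Lambda>. 1 / (fst p + snd p)) \<le> C"
proof -
  \<comment> \<open>The limit of \<open>rhs\<close> as n tends to infinity with R fixed. Only the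
    strip of width 2 survives, so the bound does not depend on R.\<close>
  define Kc where "Kc = 8 * c\<^sup>2 * ((1 + 2 * c) * 4 * measure \<Lambda> (strip 2 0))"
  have "(1 - \<bar>b\<bar>) * (LINT p:wedge R|\<Lambda>. 1 / (fst p + snd p)) \<le> Kc" for R
  proof -
    \<comment> \<open>On \<open>wedge R\<close> one has h \<le> u \<le> R0, so the truncation is
      inactive there.\<close>
    define R0 where "R0 = max R 1"
    have R0: "R0 \<ge> 1" "R0 \<ge> R" by (auto simp: R0_def)
    define rhs where "rhs n = 8 * c\<^sup>2 * ((1 + 2 * c) * 4 * measure \<Lambda> (strip 2 0)
        + (R0 + 1) * c / (real n)\<^sup>2 * measure \<Lambda> (block (real n)) + 2 * c / real n * measure \<Lambda> (strip (2 * R0 + 2) 0))" for n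
    have "(1 - \<bar>b\<bar>) * (LINT p:wedge R|\<Lambda>. 1 / (fst p + snd p)) \<le> rhs k" if k: "real k \<ge> R0" for k
    proof -
      define n where "n = real k"
      have n: "n \<ge> 1" "n \<ge> R" using k R0 by (auto simp: n_def)
      define h where "h p = fst p * snd p / (fst p + snd p)" for p :: "real \<times> real"
      define hu where "hu p = (snd p)\<^sup>2 / (fst p + snd p)\<^sup>2" for p :: "real \<times> real"
      define hv where "hv p = (fst p)\<^sup>2 / (fst p + snd p)\<^sup>2" for p :: "real \<times> real"
      define huu where "huu p = - 2 * (snd p)\<^sup>2 / (fst p + snd p) ^ 3" for p :: "real \<times> real"
      define huv where "huv p = 2 * (fst p * snd p) / (fst p + snd p) ^ 3" for p :: "real \<times> real"
      define hvv where "hvv p = - 2 * (fst p)\<^sup>2 / (fst p + snd p) ^ 3" for p :: "real \<times> real"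
      have jh: "jet h hu hv huu huv hvv"
        unfolding jet_def
      proof (intro ballI conjI)
        fix p assume p: "p \<in> quadrant"
        then have s: "fst p + snd p \<noteq> 0" by (auto simp: quadrant_def)
        then have s2: "(fst p + snd p)\<^sup>2 \<noteq> 0" by simp
        note d1 = has_derivative_fst[OF has_derivative_ident, of "at p"]
        note d2 = has_derivative_snd[OF has_derivative_ident, of "at p"]
        note ds = has_derivative_add[OF d1 d2]
        show "(h has_derivative (\<lambda>x. fst x * hu p + snd x * hv p)) (at p)"
          unfolding h_def hu_def hv_def
          by (rule has_derivative_eq_rhs[OF has_derivative_divide'[OF has_derivative_mult[OF d1 d2] ds s]])
            (use s in \<open>(simp add: fun_eq_iff divide_simps power2_eq_square power3_eq_cube, simp add: algebra_simps)\<close>)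
        show "(hu has_derivative (\<lambda>x. fst x * huu p + snd x * huv p)) (at p)"
          unfolding huu_def hu_def huv_def
          by (rule has_derivative_eq_rhs[OF has_derivative_divide'[OF has_derivative_power[OF d2] has_derivative_power[OF ds] s2]])
            (use s in \<open>(simp add: fun_eq_iff divide_simps power2_eq_square power3_eq_cube, simp add: algebra_simps)\<close>)
        show "(hv has_derivative (\<lambda>x. fst x * huv p + snd x * hvv p)) (at p)"
          unfolding hvv_def hv_def huv_def
          by (rule has_derivative_eq_rhs[OF has_derivative_divide'[OF has_derivative_power[OF d1] has_derivative_power[OF ds] s2]])
            (use s in \<open>(simp add: fun_eq_iff divide_simps power2_eq_square power3_eq_cube, simp add: algebra_simps)\<close>)
      qed
      \<comment> \<open>g' = 1 - A(x - R0) \<ge> 0 and g'' = - A'(x - R0) \<le> 0, so composing with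
        g preserves a negative Laplacian.\<close>
      define g where "g x = x - B (x - R0)" for x
      define q where "q p = g (h p)" for p
      define qu where "qu p = (1 - A (h p - R0)) * hu p" for p
      define qv where "qv p = (1 - A (h p - R0)) * hv p" for p
      define quu where "quu p = - A' (h p - R0) * (hu p)\<^sup>2 + (1 - A (h p - R0)) * huu p" for p
      define quv where "quv p = - A' (h p - R0) * (hu p * hv p) + (1 - A (h p - R0)) * huv p" for p
      define qvv where "qvv p = - A' (h p - R0) * (hv p)\<^sup>2 + (1 - A (h p - R0)) * hvv p" for p
      have dg: "(g has_real_derivative 1 - A (x - R0)) (at x)"
        "((\<lambda>x. 1 - A (x - R0)) has_real_derivative - A' (x - R0)) (at x)" for x
      proof -
        have d: "((\<lambda>x. x - R0) has_real_derivative 1) (at x)" by (auto intro!: derivative_eq_intros)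
        show "(g has_real_derivative 1 - A (x - R0)) (at x)"
          unfolding g_def using DERIV_diff[OF DERIV_ident DERIV_chain2[OF dB d]] by simp
        show "((\<lambda>x. 1 - A (x - R0)) has_real_derivative - A' (x - R0)) (at x)"
          using DERIV_diff[OF DERIV_const[of 1] DERIV_chain2[OF dA d]] by simp
      qed
      have jq: "jet q qu qv quu quv qvv"
        using jet_compose[OF jh, where g = g and g' = "\<lambda>x. 1 - A (x - R0)" and g'' = "\<lambda>x. - A' (x - R0)", OF dg]
        unfolding q_def[abs_def] qu_def[abs_def] qv_def[abs_def] quu_def[abs_def] quv_def[abs_def] qvv_def[abs_def] .
      have sh: "smooth_on quadrant h"
        unfolding h_def
        by (rule smooth_on_divide; (rule smooth_on_mult smooth_on_add)?)
          (auto simp: quadrant_def[THEN eq_reflection] intro!: smooth_on_fst smooth_on_snd open_quadrant[unfolded quadrant_def])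
      have sg: "smooth_on UNIV g"
      proof (rule smooth_on_antiderivative[OF dg(1)])
        show "smooth_on UNIV (\<lambda>x. 1 - A (x - R0))"
          using smooth_decreasing_step(1)[of 1 R0] by simp
      qed
      have sq: "smooth_on quadrant q"
        unfolding q_def[abs_def] by (rule smooth_on_compose_UNIV[OF open_quadrant sg sh])
      have lap_q: "lap quu quv qvv p = - A' (h p - R0) * ((hu p)\<^sup>2 + 2 * b * (hu p * hv p) + (hv p)\<^sup>2)
          + (1 - A (h p - R0)) * (huu p + 2 * b * huv p + hvv p)" for p
        unfolding lap_def quu_def quv_def qvv_def by (simp add: algebra_simps)
      have lap_h: "(1 - \<bar>b\<bar>) / (fst p + snd p) \<le> - (huu p + 2 * b * huv p + hvv p)" if p: "p \<in> quadrant" for p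
      proof -
        define u v where "u = fst p" and "v = snd p"
        have uv: "u > 0" "v > 0" using p by (auto simp: quadrant_def u_def v_def)
        have "b * (u * v) \<le> \<bar>b\<bar> * (u * v)" using uv by (intro mult_right_mono) auto
        \<comment> \<open>With |b| in place of b, the two sides of the inequality to be shown differ
          by exactly this square.\<close>
        moreover have "0 \<le> (1 + \<bar>b\<bar>) * (u - v)\<^sup>2" by simp
        ultimately have "(1 - \<bar>b\<bar>) * (u + v)\<^sup>2 \<le> 2 * u\<^sup>2 + 2 * v\<^sup>2 - 4 * (b * (u * v))"
          by (simp add: power2_eq_square algebra_simps)
        then have "(1 - \<bar>b\<bar>) * (u + v)\<^sup>2 / (u + v) ^ 3 \<le> (2 * u\<^sup>2 + 2 * v\<^sup>2 - 4 * (b * (u * v))) / (u + v) ^ 3"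
          using uv by (intro divide_right_mono) auto
        moreover have "(1 - \<bar>b\<bar>) * (u + v)\<^sup>2 / (u + v) ^ 3 = (1 - \<bar>b\<bar>) / (u + v)"
          using uv by (simp add: power2_eq_square power3_eq_cube)
        moreover have "(2 * u\<^sup>2 + 2 * v\<^sup>2 - 4 * (b * (u * v))) / (u + v) ^ 3 = - (huu p + 2 * b * huv p + hvv p)"
          unfolding huu_def huv_def hvv_def u_def[symmetric] v_def[symmetric]
          by (simp add: diff_divide_distrib add_divide_distrib)
        ultimately show ?thesis by (simp add: u_def v_def)
      qed
      have nlap_ge: "(1 - A (h p - R0)) * ((1 - \<bar>b\<bar>) / (fst p + snd p)) \<le> - lap quu quv qvv p" if p: "p \<in> quadrant" for p
      proof -
        have "0 \<le> A' (h p - R0) * ((hu p)\<^sup>2 + 2 * b * (hu p * hv p) + (hv p)\<^sup>2)"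
          by (intro mult_nonneg_nonneg A'_ge quadratic_form_nonneg)
        moreover have "(1 - A (h p - R0)) * ((1 - \<bar>b\<bar>) / (fst p + snd p)) \<le>
            (1 - A (h p - R0)) * (- (huu p + 2 * b * huv p + hvv p))"
          using lap_h[OF p] A_le by (intro mult_left_mono) auto
        ultimately show ?thesis unfolding lap_q mult_minus_right mult_minus_left by linarith
      qed
      have h_min: "0 \<le> h p" "h p \<le> fst p" "h p \<le> snd p" "min (fst p) (snd p) \<le> 2 * h p"
        "0 \<le> hu p" "hu p \<le> 1" "0 \<le> hv p" "hv p \<le> 1" if p: "p \<in> quadrant" for p
      proof -
        define u v where "u = fst p" and "v = snd p"
        have uv: "u > 0" "v > 0" using p by (auto simp: quadrant_def u_def v_def)
        have he: "h p = u * v / (u + v)" by (simp add: h_def u_def v_def)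
        show "0 \<le> h p" "h p \<le> fst p" "h p \<le> snd p"
          unfolding he u_def[symmetric] v_def[symmetric] using uv by (auto simp: field_simps)
        show "min (fst p) (snd p) \<le> 2 * h p"
        proof (cases "u \<le> v")
          case True
          then have "u * (u + v) \<le> u * (2 * v)" using uv by (intro mult_left_mono) auto
          then show ?thesis
            unfolding he u_def[symmetric] v_def[symmetric] using True uv by (simp add: field_simps)
        next
          case False
          then have "v * (u + v) \<le> v * (2 * u)" using uv by (intro mult_left_mono) auto
          then show ?thesis
            unfolding he u_def[symmetric] v_def[symmetric] using False uv by (simp add: field_simps)
        qed
        show "0 \<le> hu p" "hu p \<le> 1" "0 \<le> hv p" "hv p \<le> 1"
          unfolding hu_def hv_def u_def[symmetric] v_def[symmetric]
          using uv by (auto simp: divide_le_eq_1 intro!: power_mono)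
      qed
      have q_bounds: "0 \<le> q p" "q p \<le> h p" "q p \<le> R0 + 1" if p: "p \<in> quadrant" for p
      proof -
        show "q p \<le> h p" using B_nonneg by (simp add: q_def g_def)
        show "q p \<le> R0 + 1" using B_ge[of "h p - R0"] by (simp add: q_def g_def)
        show "0 \<le> q p"
        proof (cases "h p \<le> R0")
          case True then show ?thesis using B_0[of "h p - R0"] h_min(1)[OF p] by (simp add: q_def g_def)
        next
          case False then show ?thesis using B_pos[of "h p - R0"] R0 by (simp add: q_def g_def)
        qed
      qed
      have dq_bounds: "\<bar>qu p\<bar> \<le> 1" "\<bar>qv p\<bar> \<le> 1" if p: "p \<in> quadrant" for p
      proof -
        have "\<bar>1 - A (h p - R0)\<bar> \<le> 1" using A_ge[of "h p - R0"] A_le[of "h p - R0"] by simp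
        moreover have "\<bar>hu p\<bar> \<le> 1" "\<bar>hv p\<bar> \<le> 1" using h_min[OF p] by simp_all
        ultimately have "\<bar>1 - A (h p - R0)\<bar> * \<bar>hu p\<bar> \<le> 1 * 1" "\<bar>1 - A (h p - R0)\<bar> * \<bar>hv p\<bar> \<le> 1 * 1"
          by (intro mult_mono; simp)+
        then show "\<bar>qu p\<bar> \<le> 1" "\<bar>qv p\<bar> \<le> 1" by (simp_all add: qu_def qv_def abs_mult)
      qed
      define N where "N = 2 * n"
      define Y where "Y x = 1 - A (x / n - 1)" for x
      define Y' where "Y' x = - (A' (x / n - 1) / n)" for x
      define Y'' where "Y'' x = - (A'' (x / n - 1) / n\<^sup>2)" for x
      note Yd = smooth_decreasing_step[of n 1, folded Y_def Y'_def Y''_def, unfolded Y_def[abs_def, symmetric] Y'_def[abs_def, symmetric]]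
      have Y0: "Y x = 0" if "x > N" for x
        using that n by (simp add: Y_def N_def A_1 field_simps)
      have Y1: "Y x = 1" if "x \<le> n" for x
        using that n by (simp add: Y_def A_0 field_simps)
      have Yb: "0 \<le> Y x" "Y x \<le> 1" "\<bar>Y' x\<bar> \<le> c / n" "\<bar>Y'' x\<bar> \<le> c / n\<^sup>2" for x
        using A_ge A_le A'_ge A'_le A''_le n by (auto simp: Y_def Y'_def Y''_def abs_divide intro!: divide_right_mono)
      have cn: "c / n \<le> c" "c / n\<^sup>2 \<le> c"
        using n c by (auto simp: divide_le_eq mult_le_cancel_left1 one_le_power)
      have Yz: "Y' x = 0" "Y'' x = 0" if "\<not> (n \<le> x \<and> x \<le> 2 * n)" for x
      proof -
        have "x / n - 1 \<le> 0 \<or> x / n - 1 \<ge> 1" using that n by (auto simp: field_simps)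
        then show "Y' x = 0" "Y'' x = 0" by (simp_all add: Y'_def Y''_def A'_0 A''_0)
      qed
      define g1 where "g1 = (1 + 2 * c) * 4"
      define g2 where "g2 = (R0 + 1) * c / n\<^sup>2"
      define g3 where "g3 = 2 * c / n"
      have g: "g1 \<ge> 0" "g2 \<ge> 0" "g3 \<ge> 0" using c n R0 by (auto simp: g1_def g2_def g3_def)
      have errb: "err Y Y' Y'' q qu qv p \<le> g1 * indicator (strip 2 0) p + g2 * indicator (block n) p
          + g3 * indicator (strip (2 * R0 + 2) 0) p"
        if p: "p \<in> corner N" for p
      proof -
        have pq: "p \<in> quadrant" using p corner_subset by auto
        have uv: "1 \<le> fst p" "1 \<le> snd p" using p by (auto simp: corner_def)
        show ?thesis
        proof (cases "fst p \<le> 2 \<or> snd p \<le> 2")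
          case True
          define x where "x = fst p + snd p"
          \<comment> \<open>Since h is at most the smaller coordinate, q is bounded near the edges
            independently of \<open>R0\<close>.\<close>
          have "\<bar>q p\<bar> \<le> 2" using q_bounds[OF pq] h_min[OF pq] True by auto
          then have "\<bar>q p\<bar> + \<bar>qu p\<bar> + \<bar>qv p\<bar> \<le> 4" using dq_bounds[OF pq] by linarith
          moreover have "\<bar>Y x\<bar> + \<bar>Y' x\<bar> + \<bar>Y'' x\<bar> \<le> 1 + 2 * c"
            using Yb[of x] cn by linarith
          ultimately have "(\<bar>Y x\<bar> + \<bar>Y' x\<bar> + \<bar>Y'' x\<bar>) * (\<bar>q p\<bar> + \<bar>qu p\<bar> + \<bar>qv p\<bar>) \<le> (1 + 2 * c) * 4"
            using c by (intro mult_mono) auto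
          then have "err Y Y' Y'' q qu qv p \<le> g1" using True by (simp add: err_def x_def g1_def)
          moreover have "p \<in> strip 2 0" using True uv by (auto simp: strip_def)
          ultimately show ?thesis using g by (auto simp: indicator_def)
        next
          case False
          define x where "x = fst p + snd p"
          have e: "err Y Y' Y'' q qu qv p = \<bar>q p\<bar> * \<bar>Y'' x\<bar> + \<bar>Y' x\<bar> * (\<bar>qu p\<bar> + \<bar>qv p\<bar>)"
            using False by (simp add: err_def x_def)
          have 1: "\<bar>q p\<bar> * \<bar>Y'' x\<bar> \<le> g2 * indicator (block n) p"
          proof (cases "n \<le> x \<and> x \<le> 2 * n")
            case True
            then have "p \<in> block n" using False by (auto simp: block_def x_def)
            moreover have "\<bar>q p\<bar> * \<bar>Y'' x\<bar> \<le> (R0 + 1) * (c / n\<^sup>2)"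
              using q_bounds[OF pq] Yb[of x] R0 by (intro mult_mono) auto
            ultimately show ?thesis by (simp add: g2_def)
          qed (use Yz g in auto)
          \<comment> \<open>The gradient of q vanishes where h > R0 + 1. Elsewhere the smaller
            coordinate is at most 2 h, which puts the point into a strip; its finite mass is beaten
            by the factor 1 / n.\<close>
          have 2: "\<bar>Y' x\<bar> * (\<bar>qu p\<bar> + \<bar>qv p\<bar>) \<le> g3 * indicator (strip (2 * R0 + 2) 0) p"
          proof (cases "h p \<le> R0 + 1")
            case True
            then have "p \<in> strip (2 * R0 + 2) 0" using h_min(4)[OF pq] uv by (auto simp: strip_def min_def split: if_splits)
            moreover have "\<bar>Y' x\<bar> * (\<bar>qu p\<bar> + \<bar>qv p\<bar>) \<le> (c / n) * 2"
              using dq_bounds[OF pq] Yb[of x] by (intro mult_mono) auto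
            ultimately show ?thesis by (simp add: g3_def mult.commute)
          next
            case False
            then show ?thesis using g by (simp add: qu_def qv_def A_1)
          qed
          have "0 \<le> g1 * indicator (strip 2 0) p" using g by simp
          then show ?thesis using 1 2 e by linarith
        qed
      qed
      have est: "\<bar>LINT p:corner N|\<Lambda>. cutoff Y p * lap quu quv qvv p\<bar>
          \<le> 8 * c\<^sup>2 * (g1 * measure \<Lambda> (strip 2 0) + g2 * measure \<Lambda> (block n) + g3 * measure \<Lambda> (strip (2 * R0 + 2) 0))"
        by (rule cutoff_estimate[OF sq jq Yd Y0 errb]) (use n g in auto)
      have int: "set_integrable \<Lambda> (corner N) (\<lambda>p. - (cutoff Y p * lap quu quv qvv p))"
        using integrable_cutoff_lap[OF sq jq Yd(1), of N] n unfolding set_integrable_def by simp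
      have i2: "set_integrable \<Lambda> (wedge R) (\<lambda>p. (1 - \<bar>b\<bar>) * (1 / (fst p + snd p)))"
        by (rule set_integrable_wedge) (auto intro!: continuous_intros simp: quadrant_def)
      have "(LINT p:wedge R|\<Lambda>. (1 - \<bar>b\<bar>) * (1 / (fst p + snd p)))
          \<le> (LINT p:corner N|\<Lambda>. - (cutoff Y p * lap quu quv qvv p))"
      proof (rule set_integral_lower_bound[OF int i2])
        show "wedge R \<subseteq> corner N" using n by (auto simp: wedge_def corner_def N_def)
        have pos: "0 \<le> - lap quu quv qvv p" if "p \<in> quadrant" for p
        proof -
          have "0 \<le> (1 - A (h p - R0)) * ((1 - \<bar>b\<bar>) / (fst p + snd p))"
            using that b A_le by (intro mult_nonneg_nonneg divide_nonneg_nonneg) (auto simp: quadrant_def)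
          then show ?thesis using nlap_ge[OF that] by linarith
        qed
        show "0 \<le> - (cutoff Y p * lap quu quv qvv p)" if "p \<in> corner N" for p
        proof -
          have "p \<in> quadrant" using that corner_subset by blast
          from pos[OF this] have "0 \<le> cutoff Y p * (- lap quu quv qvv p)"
            unfolding cutoff_def using A_ge Yb by (intro mult_nonneg_nonneg) auto
          then show ?thesis by simp
        qed
        fix p assume p: "p \<in> wedge R"
        then have uv: "2 \<le> fst p" "2 \<le> snd p" "fst p + snd p \<le> R" by (auto simp: wedge_def)
        then have pq: "p \<in> quadrant" by (auto simp: quadrant_def)
        have "fst p + snd p \<le> n" using uv n by linarith
        then have C1: "cutoff Y p = 1" using uv Y1 by (simp add: cutoff_def A_1)
        have "h p - R0 \<le> 0" using h_min[OF pq] uv R0 by linarith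
        then show "(1 - \<bar>b\<bar>) * (1 / (fst p + snd p)) \<le> - (cutoff Y p * lap quu quv qvv p)"
          using nlap_ge[OF pq] C1 by (simp add: A_0)
      qed
      also have "\<dots> = - (LINT p:corner N|\<Lambda>. cutoff Y p * lap quu quv qvv p)"
        unfolding set_lebesgue_integral_def by simp
      also have "\<dots> \<le> rhs k"
        using est unfolding rhs_def g1_def g2_def g3_def n_def by linarith
      finally show ?thesis by (simp only: set_integral_mult_right)
    qed
    then have ev: "\<forall>\<^sub>F k in sequentially. (1 - \<bar>b\<bar>) * (LINT p:wedge R|\<Lambda>. 1 / (fst p + snd p)) \<le> rhs k"
      using eventually_ge_at_top[of "nat \<lceil>R0\<rceil>"] by (elim eventually_mono) (simp add: ceiling_le_iff nat_le_iff)
    have rhs_eq: "rhs = (\<lambda>n. 8 * c\<^sup>2 * ((1 + 2 * c) * 4 * measure \<Lambda> (strip 2 0)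
        + (R0 + 1) * c * (measure \<Lambda> (block (real n)) / (real n)\<^sup>2)
        + 2 * c * measure \<Lambda> (strip (2 * R0 + 2) 0) * inverse (real n)))"
      unfolding rhs_def by (simp add: fun_eq_iff divide_inverse mult_ac)
    have "rhs \<longlonglongrightarrow> 8 * c\<^sup>2 * ((1 + 2 * c) * 4 * measure \<Lambda> (strip 2 0) + (R0 + 1) * c * 0
        + 2 * c * measure \<Lambda> (strip (2 * R0 + 2) 0) * 0)"
      unfolding rhs_eq by (intro tendsto_intros block_subquadratic lim_inverse_n)
    then have "rhs \<longlonglongrightarrow> Kc" by (simp add: Kc_def)
    from tendsto_lowerbound[OF this ev] show ?thesis by simp
  qed
  then have "\<forall>N. (LINT p:wedge N|\<Lambda>. 1 / (fst p + snd p)) \<le> Kc / (1 - \<bar>b\<bar>)"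
    using b by (simp add: pos_le_divide_eq mult.commute)
  then show ?thesis by blast
qed

text \<open>The increasing integrals \<open>J\<close> converge, so their increments between n div 2
  and 2 n tend to 0, while the integrand is at least 1 / (2 n) on the shell. Halving n makes the
  smaller wedge disjoint from the shell; the wedge up to n would share the line u + v = n with
  it.\<close>

lemma block_sublinear: "(\<lambda>n. measure \<Lambda> (block (real n)) / real n) \<longlonglongrightarrow> 0"
proof -
  define J where "J n = (LINT p:wedge (real n)|\<Lambda>. 1 / (fst p + snd p))" for n :: nat
  have int: "set_integrable \<Lambda> (wedge N) (\<lambda>p. 1 / (fst p + snd p))" for N
    by (rule set_integrable_wedge) (auto intro!: continuous_intros simp: quadrant_def)
  have mono: "incseq J"
  proof (rule incseq_SucI)
    fix n
    show "J n \<le> J (Suc n)" unfolding J_def set_lebesgue_integral_def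
    proof (rule integral_mono)
      fix p :: "real \<times> real"
      show "indicat_real (wedge (real n)) p *\<^sub>R (1 / (fst p + snd p)) \<le> indicat_real (wedge (real (Suc n))) p *\<^sub>R (1 / (fst p + snd p))"
        by (auto simp: indicator_def wedge_def)
    qed (use int in \<open>auto simp: set_integrable_def\<close>)
  qed
  obtain C where "\<And>n. J n \<le> C" using wedge_integral_bounded by (auto simp: J_def)
  with mono obtain L where L: "J \<longlonglongrightarrow> L" using incseq_convergent[of J C] by blast
  have "filterlim (\<lambda>n::nat. n div 2) sequentially sequentially"
    unfolding filterlim_at_top
  proof
    fix Z :: nat
    show "eventually (\<lambda>n. Z \<le> n div 2) sequentially"
      using eventually_ge_at_top[of "2 * Z"] by eventually_elim auto
  qed
  then have l1: "(\<lambda>n. J (n div 2)) \<longlonglongrightarrow> L" by (rule filterlim_compose[OF L])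
  have "filterlim (\<lambda>n::nat. 2 * n) sequentially sequentially"
    unfolding filterlim_at_top
  proof
    fix Z :: nat
    show "eventually (\<lambda>n. Z \<le> 2 * n) sequentially"
      using eventually_ge_at_top[of Z] by eventually_elim auto
  qed
  then have l2: "(\<lambda>n. J (2 * n)) \<longlonglongrightarrow> L" by (rule filterlim_compose[OF L])
  have lim: "(\<lambda>n. 2 * (J (2 * n) - J (n div 2))) \<longlonglongrightarrow> 2 * (L - L)"
    by (intro tendsto_intros l1 l2)
  have ub: "measure \<Lambda> (block (real n)) / real n \<le> 2 * (J (2 * n) - J (n div 2))" if n: "n \<ge> 1" for n
  proof -
    have bm: "emeasure \<Lambda> (block (real n)) < \<infinity>"
      using fmeasurable_block[of "real n"] by (simp add: fmeasurable_def)
    have "(\<integral>p. indicator (block (real n)) p * (1 / (2 * real n)) + indicator (wedge (real (n div 2))) p *\<^sub>R (1 / (fst p + snd p)) \<partial>\<Lambda>)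
        \<le> J (2 * n)"
      unfolding J_def set_lebesgue_integral_def
    proof (rule integral_mono)
      fix p :: "real \<times> real"
      have half: "real (n div 2) < real n" using n by simp
      show "indicat_real (block (real n)) p * (1 / (2 * real n)) + indicat_real (wedge (real (n div 2))) p *\<^sub>R (1 / (fst p + snd p))
          \<le> indicat_real (wedge (real (2 * n))) p *\<^sub>R (1 / (fst p + snd p))"
      proof (cases "p \<in> block (real n)")
        case True
        then have "p \<notin> wedge (real (n div 2))" "p \<in> wedge (real (2 * n))" "fst p + snd p \<le> 2 * real n" "fst p + snd p > 0"
          using half by (auto simp: block_def wedge_def)
        then show ?thesis using True n by (simp add: divide_simps)
      next
        case False
        have "wedge (real (n div 2)) \<subseteq> wedge (real (2 * n))" using half by (auto simp: wedge_def)
        then show ?thesis using False by (auto simp: indicator_def wedge_def)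
      qed
    qed (use int bm in \<open>auto simp: set_integrable_def intro!: Bochner_Integration.integrable_add\<close>)
    also have "(\<integral>p. indicator (block (real n)) p * (1 / (2 * real n)) + indicator (wedge (real (n div 2))) p *\<^sub>R (1 / (fst p + snd p)) \<partial>\<Lambda>)
        = measure \<Lambda> (block (real n)) / (2 * real n) + J (n div 2)"
      using int bm by (subst Bochner_Integration.integral_add) (auto simp: set_integrable_def J_def set_lebesgue_integral_def)
    finally show ?thesis using n by (simp add: field_simps)
  qed
  show ?thesis
  proof (rule tendsto_sandwich[OF _ _ tendsto_const])
    show "\<forall>\<^sub>F n in sequentially. 0 \<le> measure \<Lambda> (block (real n)) / real n" by simp
    show "\<forall>\<^sub>F n in sequentially. measure \<Lambda> (block (real n)) / real n \<le> 2 * (J (2 * n) - J (n div 2))"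
      using eventually_ge_at_top[of 1] by eventually_elim (use ub in auto)
  qed (use lim in simp)
qed

text \<open>
  In the coordinates of the bidisc the potential is \<open>- ln (\<bar>z\<bar>\<^sup>2 + \<bar>w\<bar>\<^sup>2 + \<rho>) / 2\<close>; on the ball of squared radius \<open>\<rho>\<close>
  its negative Laplacian dominates the area density of the leaf divided by \<open>\<rho>\<close>.
\<close>

lemma log_potential_estimate:
  fixes M N \<rho> :: real and K n :: nat
  assumes MN: "M > 0" "N > 0" and \<rho>: "0 < \<rho>" "\<rho> \<le> 1" and K: "1 \<le> K" "2 * K \<le> n" "n0 \<le> real n"
  defines "E \<equiv> {p. 2 \<le> fst p \<and> 2 \<le> snd p \<and> 2 * real K \<le> fst p + snd p \<and> fst p + snd p \<le> n0 \<and>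
      exp (- 2 * M * fst p) + exp (- 2 * N * snd p) < \<rho>}"
  shows "(LINT p:E|\<Lambda>. (M\<^sup>2 * exp (- 2 * M * fst p) + N\<^sup>2 * exp (- 2 * N * snd p)) / (2 * \<rho>))
     \<le> 8 * c\<^sup>2 * (8 * c\<^sup>2 * (3 * (M + N) + 1) * measure \<Lambda> (strip 2 (real K))
        + 3 * (M + N + 1) * c / real K * measure \<Lambda> (block (real K))
        + 3 * (M + N + 1) * c / real n * measure \<Lambda> (block (real n)))"
proof -
  define e1 where "e1 p = exp (- 2 * M * fst p)" for p :: "real \<times> real"
  define e2 where "e2 p = exp (- 2 * N * snd p)" for p :: "real \<times> real"
  have e_pos: "e1 p > 0" "e2 p > 0" for p by (simp_all add: e1_def e2_def)
  define S where "S p = e1 p + e2 p + \<rho>" for p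
  have S_pos: "S p > 0" for p using e_pos[of p] \<rho> by (simp add: S_def)
  define q where "q p = - (ln (S p) / 2)" for p
  define qu where "qu p = M * e1 p / S p" for p
  define qv where "qv p = N * e2 p / S p" for p
  define quu where "quu p = (1 / (2 * (S p)\<^sup>2)) * (- 2 * M * e1 p)\<^sup>2 + - (1 / (2 * S p)) * (4 * M\<^sup>2 * e1 p)" for p
  define quv where "quv p = (1 / (2 * (S p)\<^sup>2)) * ((- 2 * M * e1 p) * (- 2 * N * e2 p)) + - (1 / (2 * S p)) * 0" for p
  define qvv where "qvv p = (1 / (2 * (S p)\<^sup>2)) * (- 2 * N * e2 p)\<^sup>2 + - (1 / (2 * S p)) * (4 * N\<^sup>2 * e2 p)" for p
  have jS: "jet S (\<lambda>p. - 2 * M * e1 p) (\<lambda>p. - 2 * N * e2 p) (\<lambda>p. 4 * M\<^sup>2 * e1 p) (\<lambda>p. 0) (\<lambda>p. 4 * N\<^sup>2 * e2 p)"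
    unfolding jet_def S_def e1_def e2_def
    by (auto intro!: derivative_eq_intros simp: algebra_simps power2_eq_square)
  have "((\<lambda>x. - (ln x / 2)) has_real_derivative - (1 / (2 * x))) (at x)"
    "((\<lambda>x. - (1 / (2 * x))) has_real_derivative 1 / (2 * x\<^sup>2)) (at x)" if "x > 0" for x :: real
    using that by (auto intro!: derivative_eq_intros simp: power2_eq_square field_simps)
  note dln = this
  have "jet q (\<lambda>p. - (1 / (2 * S p)) * (- 2 * M * e1 p)) (\<lambda>p. - (1 / (2 * S p)) * (- 2 * N * e2 p)) quu quv qvv"
    unfolding q_def[abs_def] quu_def[abs_def] quv_def[abs_def] qvv_def[abs_def]
    by (rule jet_compose[OF jS, where g = "\<lambda>x. - (ln x / 2)" and g' = "\<lambda>x. - (1 / (2 * x))" and g'' = "\<lambda>x. 1 / (2 * x\<^sup>2)"])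
      (use dln S_pos in blast)+
  then have jq: "jet q qu qv quu quv qvv"
    unfolding qu_def[abs_def] qv_def[abs_def] by simp
  have lin1: "smooth_on quadrant (\<lambda>p. exp ((- 2 * M) * fst p + 0 * snd p + 0))"
    by (rule smooth_on_exp[OF open_quadrant smooth_on_affine[OF open_quadrant]])
  have lin2: "smooth_on quadrant (\<lambda>p. exp (0 * fst p + (- 2 * N) * snd p + 0))"
    by (rule smooth_on_exp[OF open_quadrant smooth_on_affine[OF open_quadrant]])
  have sS: "smooth_on quadrant S"
    using smooth_on_add[OF open_quadrant smooth_on_add[OF open_quadrant lin1 lin2] smooth_on_const[OF open_quadrant, of \<rho>]]
    by (simp add: S_def[abs_def] e1_def e2_def)
  have sq: "smooth_on quadrant q"
    using smooth_on_cmult[OF open_quadrant smooth_on_ln[OF open_quadrant _ sS], of "-1/2"] S_pos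
    by (simp add: q_def[abs_def])
  \<comment> \<open>The squares of e1 and e2 cancel against the gradient term. What remains is the
    \<rho> term and a multiple of e1 e2, nonnegative by the quadratic form at (M, -N).\<close>
  have nlap: "2 * \<rho> * (M\<^sup>2 * e1 p + N\<^sup>2 * e2 p) / (S p)\<^sup>2 \<le> - lap quu quv qvv p" for p
  proof -
    have "- lap quu quv qvv p = 2 * ((M\<^sup>2 * e1 p + N\<^sup>2 * e2 p) * S p - ((M * e1 p)\<^sup>2 + 2 * b * (M * e1 p * (N * e2 p)) + (N * e2 p)\<^sup>2)) / (S p)\<^sup>2"
      unfolding lap_def quu_def quv_def qvv_def
      using S_pos[of p] by (simp add: divide_simps power2_eq_square) (simp add: algebra_simps)
    also have "(M\<^sup>2 * e1 p + N\<^sup>2 * e2 p) * S p - ((M * e1 p)\<^sup>2 + 2 * b * (M * e1 p * (N * e2 p)) + (N * e2 p)\<^sup>2)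
        = \<rho> * (M\<^sup>2 * e1 p + N\<^sup>2 * e2 p) + (M\<^sup>2 + 2 * b * (M * (- N)) + (- N)\<^sup>2) * (e1 p * e2 p)"
      by (simp add: S_def algebra_simps power2_eq_square)
    finally have eq: "- lap quu quv qvv p = 2 * (\<rho> * (M\<^sup>2 * e1 p + N\<^sup>2 * e2 p) + (M\<^sup>2 + 2 * b * (M * (- N)) + (- N)\<^sup>2) * (e1 p * e2 p)) / (S p)\<^sup>2" .
    have gen: "2 * r * x \<le> 2 * (r * x + y)" if "0 \<le> y" for r x y :: real
      using that by (simp add: algebra_simps)
    have "0 \<le> (M\<^sup>2 + 2 * b * (M * (- N)) + (- N)\<^sup>2) * (e1 p * e2 p)"
      using quadratic_form_nonneg[of M "- N"] e_pos[of p] by (intro mult_nonneg_nonneg) auto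
    then have "2 * \<rho> * (M\<^sup>2 * e1 p + N\<^sup>2 * e2 p)
        \<le> 2 * (\<rho> * (M\<^sup>2 * e1 p + N\<^sup>2 * e2 p) + (M\<^sup>2 + 2 * b * (M * (- N)) + (- N)\<^sup>2) * (e1 p * e2 p))" by (rule gen)
    then show ?thesis unfolding eq by (rule divide_right_mono) simp
  qed
  have dq: "\<bar>qu p\<bar> \<le> M" "\<bar>qv p\<bar> \<le> N" for p
  proof -
    have "e1 p / S p \<le> 1" "e2 p / S p \<le> 1" using e_pos[of p] \<rho> by (auto simp: S_def)
    then have "M * (e1 p / S p) \<le> M * 1" "N * (e2 p / S p) \<le> N * 1"
      using MN by (intro mult_left_mono; simp)+
    moreover have "0 \<le> M * e1 p / S p" "0 \<le> N * e2 p / S p" using MN e_pos[of p] S_pos[of p] by auto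
    ultimately show "\<bar>qu p\<bar> \<le> M" "\<bar>qv p\<bar> \<le> N" by (simp_all add: qu_def qv_def)
  qed
  \<comment> \<open>These bounds do not involve \<rho>, so the errors of the cutoff are uniform as
    \<rho> tends to 0. The lower bound comes from S \<le> 3 \<le> exp 2.\<close>
  have q_le: "q p \<le> M * fst p" "q p \<le> N * snd p" "- 1 \<le> q p" if "0 \<le> fst p" "0 \<le> snd p" for p
  proof -
    have "ln (e1 p) \<le> ln (S p)" "ln (e2 p) \<le> ln (S p)" using e_pos[of p] \<rho> by (auto simp: S_def)
    then show "q p \<le> M * fst p" "q p \<le> N * snd p" by (auto simp: q_def e1_def e2_def)
    have "e1 p \<le> 1" "e2 p \<le> 1" using that MN by (auto simp: e1_def e2_def)
    then have "S p \<le> 1 + 2" using \<rho> by (simp add: S_def)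
    also have "\<dots> \<le> exp 2" by (rule exp_ge_add_one_self)
    finally have "ln (S p) \<le> ln (exp 2)"
      using S_pos[of p] by (simp only: ln_le_cancel_iff exp_gt_zero)
    then show "- 1 \<le> q p" by (simp add: q_def)
  qed
  define k where "k = real K"
  define m where "m = real n"
  have km: "1 \<le> k" "2 * k \<le> m" "1 \<le> m" "n0 \<le> m" using K by (auto simp: k_def m_def)
  \<comment> \<open>Y rises from 0 to 1 over [k, 2 k] and falls back to 0 over [m, 2 m]; 2 k \<le> m
    keeps the two transitions apart.\<close>
  define Y1 where "Y1 x = A (x / k - 1)" for x
  define Y1' where "Y1' x = A' (x / k - 1) / k" for x
  define Y1'' where "Y1'' x = A'' (x / k - 1) / k\<^sup>2" for x
  define Y2 where "Y2 x = 1 - A (x / m - 1)" for x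
  define Y2' where "Y2' x = - (A' (x / m - 1) / m)" for x
  define Y2'' where "Y2'' x = - (A'' (x / m - 1) / m\<^sup>2)" for x
  define Y where "Y x = Y1 x * Y2 x" for x
  define Y' where "Y' x = Y1 x * Y2' x + Y1' x * Y2 x" for x
  define Y'' where "Y'' x = (Y1 x * Y2'' x + Y1' x * Y2' x) + (Y1' x * Y2' x + Y1'' x * Y2 x)" for x
  have m0: "m > 0" and k0: "k > 0" using km by auto
  note Y2d = smooth_decreasing_step[OF m0, of 1, folded Y2_def Y2'_def Y2''_def, unfolded Y2_def[abs_def, symmetric] Y2'_def[abs_def, symmetric]]
  have Y1s: "smooth_on UNIV Y1"
    using smooth_on_diff[OF open_UNIV smooth_on_const[OF open_UNIV, of 1] smooth_decreasing_step(1)[OF k0, of 1]]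
    by (simp add: Y1_def[abs_def])
  have Y1d: "(Y1 has_real_derivative Y1' x) (at x)" "(Y1' has_real_derivative Y1'' x) (at x)" for x
    using DERIV_diff[OF DERIV_const[of 1] smooth_decreasing_step(2)[OF k0, of 1 x]]
      DERIV_minus[OF smooth_decreasing_step(3)[OF k0, of 1 x]]
    by (simp_all add: Y1_def[abs_def] Y1'_def[abs_def] Y1''_def[abs_def])
  have Ys: "smooth_on UNIV Y" unfolding Y_def[abs_def] by (rule smooth_on_mult[OF open_UNIV Y1s Y2d(1)])
  have Yd: "(Y has_real_derivative Y' x) (at x)" for x
    unfolding Y_def[abs_def] Y'_def using DERIV_mult[OF Y1d(1) Y2d(2)] by (simp add: algebra_simps)
  have Yd': "(Y' has_real_derivative Y'' x) (at x)" for x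
    unfolding Y''_def Y'_def[abs_def]
    using DERIV_add[OF DERIV_mult[OF Y1d(1) Y2d(3)] DERIV_mult[OF Y1d(2) Y2d(2)]] by (simp add: algebra_simps)
  have Y0: "Y x = 0" if "x > 2 * m" for x
    using that km by (simp add: Y_def Y2_def A_1 field_simps)
  have b1: "0 \<le> Y1 x" "Y1 x \<le> 1" "\<bar>Y1' x\<bar> \<le> c / k" "\<bar>Y1'' x\<bar> \<le> c / k\<^sup>2" for x
    using A_ge A_le A'_ge A'_le A''_le km by (auto simp: Y1_def Y1'_def Y1''_def abs_divide intro!: divide_right_mono)
  have b2: "0 \<le> Y2 x" "Y2 x \<le> 1" "\<bar>Y2' x\<bar> \<le> c / m" "\<bar>Y2'' x\<bar> \<le> c / m\<^sup>2" for x
    using A_ge A_le A'_ge A'_le A''_le km by (auto simp: Y2_def Y2'_def Y2''_def abs_divide intro!: divide_right_mono)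
  have ck: "c / x \<le> c" "c / x\<^sup>2 \<le> c" if "x \<ge> 1" for x
    using that c by (auto simp: divide_le_eq mult_le_cancel_left1 one_le_power)
  have z1: "Y1 x = 0" "Y1' x = 0" "Y1'' x = 0" if "x \<le> k" for x
    using that km by (auto simp: Y1_def Y1'_def Y1''_def A_0 A'_0 A''_0 field_simps)
  have z1': "Y1 x = 1" "Y1' x = 0" "Y1'' x = 0" if "x \<ge> 2 * k" for x
  proof -
    have "x / k - 1 \<ge> 1" using that k0 by (simp add: field_simps)
    then show "Y1 x = 1" "Y1' x = 0" "Y1'' x = 0" by (auto simp: Y1_def Y1'_def Y1''_def A_1 A'_0 A''_0)
  qed
  have z2: "Y2 x = 1" "Y2' x = 0" "Y2'' x = 0" if "x \<le> m" for x
    using that km by (auto simp: Y2_def Y2'_def Y2''_def A_0 A'_0 A''_0 field_simps)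
  define g1 where "g1 = 8 * c\<^sup>2 * (3 * (M + N) + 1)"
  define g2 where "g2 = 3 * (M + N + 1) * c / k"
  define g3 where "g3 = 3 * (M + N + 1) * c / m"
  have g: "g1 \<ge> 0" "g2 \<ge> 0" "g3 \<ge> 0" using c km MN by (auto simp: g1_def g2_def g3_def)
  \<comment> \<open>Both transitions, at t = k and t = m, obey the same bound: |q| is at most linear
    in u + v \<le> 2 t, while the derivatives of Y contribute c / t and c / t^2.\<close>
  have interior: "\<bar>q p\<bar> * \<bar>y''\<bar> + \<bar>y'\<bar> * (\<bar>qu p\<bar> + \<bar>qv p\<bar>) \<le> 3 * (M + N + 1) * c / t"
    if "t > 0" "\<bar>q p\<bar> \<le> (M + N + 1) * (2 * t)" "\<bar>y''\<bar> \<le> c / t\<^sup>2" "\<bar>y'\<bar> \<le> c / t" for p t y' y''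
  proof -
    have "\<bar>q p\<bar> * \<bar>y''\<bar> \<le> (M + N + 1) * (2 * t) * (c / t\<^sup>2)"
      using that MN by (intro mult_mono) auto
    also have "\<dots> = 2 * (M + N + 1) * c / t" using that(1) by (simp add: power2_eq_square field_simps)
    finally have 1: "\<bar>q p\<bar> * \<bar>y''\<bar> \<le> 2 * (M + N + 1) * c / t" .
    have "\<bar>y'\<bar> * (\<bar>qu p\<bar> + \<bar>qv p\<bar>) \<le> (c / t) * (M + N + 1)"
      using that dq[of p] c by (intro mult_mono) auto
    also have "\<dots> = (M + N + 1) * c / t" by simp
    finally have "\<bar>q p\<bar> * \<bar>y''\<bar> + \<bar>y'\<bar> * (\<bar>qu p\<bar> + \<bar>qv p\<bar>) \<le> 2 * (M + N + 1) * c / t + (M + N + 1) * c / t"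
      using 1 by linarith
    also have "\<dots> = 3 * (M + N + 1) * c / t"
      unfolding add_divide_distrib[symmetric] by (simp add: algebra_simps)
    finally show ?thesis .
  qed
  have errb: "err Y Y' Y'' q qu qv p \<le> g1 * indicator (strip 2 k) p + g2 * indicator (block k) p + g3 * indicator (block m) p"
    if p: "p \<in> corner (2 * m)" for p
  proof -
    define x where "x = fst p + snd p"
    have uv: "1 \<le> fst p" "1 \<le> snd p" "x \<le> 2 * m" using p by (auto simp: corner_def x_def)
    have n0: "0 \<le> g1 * indicator (strip 2 k) p" "0 \<le> g2 * indicator (block k) p" "0 \<le> g3 * indicator (block m) p"
      using g by auto
    show ?thesis
    proof (cases "fst p \<le> 2 \<or> snd p \<le> 2")
      case True
      then have e: "err Y Y' Y'' q qu qv p = (\<bar>Y x\<bar> + \<bar>Y' x\<bar> + \<bar>Y'' x\<bar>) * (\<bar>q p\<bar> + \<bar>qu p\<bar> + \<bar>qv p\<bar>)"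
        by (simp add: err_def x_def)
      show ?thesis
      proof (cases "x \<le> k")
        case True
        then have "err Y Y' Y'' q qu qv p = 0" unfolding e by (simp add: Y_def Y'_def Y''_def z1)
        then show ?thesis using n0 by linarith
      next
        case False
        have "M * fst p \<le> M * 2 \<or> N * snd p \<le> N * 2" using True MN by auto
        then have "\<bar>q p\<bar> \<le> 2 * (M + N) + 1" using q_le[of p] uv MN by argo
        then have 1: "\<bar>q p\<bar> + \<bar>qu p\<bar> + \<bar>qv p\<bar> \<le> 3 * (M + N) + 1" using dq[of p] by argo
        have cc: "c \<le> c\<^sup>2" "1 \<le> c\<^sup>2" using c by (auto simp: power2_eq_square intro: order_trans[OF c])
        have pr: "\<bar>s * t\<bar> \<le> B1 * B2" if "\<bar>s\<bar> \<le> B1" "\<bar>t\<bar> \<le> B2" for s t B1 B2 :: real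
          unfolding abs_mult using that by (intro mult_mono) auto
        have bb: "\<bar>Y1 x\<bar> \<le> 1" "\<bar>Y1' x\<bar> \<le> c" "\<bar>Y1'' x\<bar> \<le> c" "\<bar>Y2 x\<bar> \<le> 1" "\<bar>Y2' x\<bar> \<le> c" "\<bar>Y2'' x\<bar> \<le> c"
          using b1[of x] b2[of x] ck[OF km(1)] ck[OF km(3)] by (auto intro: order_trans)
        have "\<bar>Y x\<bar> \<le> 1 * 1" unfolding Y_def by (intro pr bb)
        moreover have "\<bar>Y' x\<bar> \<le> 1 * c + c * 1" unfolding Y'_def
          by (intro order_trans[OF abs_triangle_ineq] add_mono pr bb)
        moreover have "\<bar>Y'' x\<bar> \<le> (1 * c + c * c) + (c * c + c * 1)" unfolding Y''_def
          by (intro order_trans[OF abs_triangle_ineq] add_mono pr bb)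
        ultimately have 2: "\<bar>Y x\<bar> + \<bar>Y' x\<bar> + \<bar>Y'' x\<bar> \<le> 8 * c\<^sup>2"
          using cc by (simp add: power2_eq_square)
        have "err Y Y' Y'' q qu qv p \<le> g1" unfolding e g1_def using 1 2 by (intro mult_mono) auto
        moreover have "p \<in> strip 2 k" using True False uv by (auto simp: strip_def x_def)
        ultimately show ?thesis using n0 by simp
      qed
    next
      case False
      then have e: "err Y Y' Y'' q qu qv p = \<bar>q p\<bar> * \<bar>Y'' x\<bar> + \<bar>Y' x\<bar> * (\<bar>qu p\<bar> + \<bar>qv p\<bar>)"
        by (simp add: err_def x_def)
      have "M * fst p + 1 \<le> (M + N + 1) * x"
      proof -
        have "M * fst p \<le> (M + N) * x" using MN uv unfolding x_def by (intro mult_mono) auto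
        then show ?thesis using uv by (simp add: algebra_simps x_def)
      qed
      moreover have "\<bar>q p\<bar> \<le> M * fst p + 1"
      proof -
        have "0 \<le> M * fst p" using MN uv by auto
        then show ?thesis using q_le[of p] uv by auto
      qed
      ultimately have qx: "\<bar>q p\<bar> \<le> (M + N + 1) * x" by linarith
      consider "x < k" | "k \<le> x" "x \<le> 2 * k" | "2 * k < x" "x < m" | "2 * k < x" "m \<le> x" by linarith
      then show ?thesis
      proof cases
        case 1
        then have "err Y Y' Y'' q qu qv p = 0" unfolding e by (simp add: Y'_def Y''_def z1)
        then show ?thesis using n0 by linarith
      next
        case 2
        then have z: "Y2 x = 1" "Y2' x = 0" "Y2'' x = 0" using z2[of x] km by auto
        have "(M + N + 1) * x \<le> (M + N + 1) * (2 * k)" using 2 MN by (intro mult_left_mono) auto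
        then have "err Y Y' Y'' q qu qv p \<le> g2"
          unfolding e g2_def using k0 qx b1[of x] by (intro interior) (auto simp: Y'_def Y''_def z)
        moreover have "p \<in> block k" using False 2 by (auto simp: block_def x_def)
        ultimately show ?thesis using n0 by simp
      next
        case 3
        then have "err Y Y' Y'' q qu qv p = 0" unfolding e using z1'[of x] z2[of x] by (simp add: Y'_def Y''_def)
        then show ?thesis using n0 by linarith
      next
        case 4
        then have z: "Y1 x = 1" "Y1' x = 0" "Y1'' x = 0" using z1'[of x] by auto
        have "(M + N + 1) * x \<le> (M + N + 1) * (2 * m)" using uv MN by (intro mult_left_mono) auto
        then have "err Y Y' Y'' q qu qv p \<le> g3"
          unfolding e g3_def using m0 qx b2[of x] by (intro interior) (auto simp: Y'_def Y''_def z)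
        moreover have "p \<in> block m" using False 4 uv by (auto simp: block_def x_def)
        ultimately show ?thesis using n0 by simp
      qed
    qed
  qed
  have est: "\<bar>LINT p:corner (2 * m)|\<Lambda>. cutoff Y p * lap quu quv qvv p\<bar>
      \<le> 8 * c\<^sup>2 * (g1 * measure \<Lambda> (strip 2 k) + g2 * measure \<Lambda> (block k) + g3 * measure \<Lambda> (block m))"
    by (rule cutoff_estimate[OF sq jq Ys Yd Yd' Y0 errb]) (use g in auto)
  have int: "set_integrable \<Lambda> (corner (2 * m)) (\<lambda>p. - (cutoff Y p * lap quu quv qvv p))"
    using integrable_cutoff_lap[OF sq jq Ys, of "2 * m"] unfolding set_integrable_def by simp
  have E_sub: "E \<subseteq> corner (2 * m)" using km by (auto simp: E_def corner_def)
  have E_sets: "E \<in> sets borel"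
  proof -
    have eq: "E = {p. 2 \<le> fst p \<and> 2 \<le> snd p \<and> 2 * real K \<le> fst p + snd p} \<inter>
        {p. exp (- 2 * M * fst p) + exp (- 2 * N * snd p) < \<rho> \<and> fst p + snd p \<le> n0}"
      by (auto simp: E_def)
    have "closed {p :: real \<times> real. 2 \<le> fst p \<and> 2 \<le> snd p \<and> 2 * real K \<le> fst p + snd p}"
      by (intro closed_Collect_conj closed_Collect_le continuous_intros)
    from sets.Int[OF borel_closed[OF this] sets_exp_sublevel]
    show ?thesis unfolding eq .
  qed
  have "continuous_on quadrant (\<lambda>p. (M\<^sup>2 * e1 p + N\<^sup>2 * e2 p) / (2 * \<rho>))"
    unfolding e1_def e2_def using \<rho> by (intro continuous_intros) auto
  then have i2: "set_integrable \<Lambda> E (\<lambda>p. (M\<^sup>2 * e1 p + N\<^sup>2 * e2 p) / (2 * \<rho>))"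
    by (rule set_integrable_subset[OF integrable_corner _ E_sub]) (simp add: E_sets)
  have "(LINT p:E|\<Lambda>. (M\<^sup>2 * e1 p + N\<^sup>2 * e2 p) / (2 * \<rho>))
      \<le> (LINT p:corner (2 * m)|\<Lambda>. - (cutoff Y p * lap quu quv qvv p))"
  proof (rule set_integral_lower_bound[OF int i2 E_sub])
    have pos: "0 \<le> - lap quu quv qvv p" for p
    proof -
      have "0 \<le> 2 * \<rho> * (M\<^sup>2 * e1 p + N\<^sup>2 * e2 p) / (S p)\<^sup>2"
        using \<rho> e_pos[of p] by (intro divide_nonneg_nonneg mult_nonneg_nonneg add_nonneg_nonneg) auto
      then show ?thesis using nlap[of p] by linarith
    qed
    show "0 \<le> - (cutoff Y p * lap quu quv qvv p)" for p
    proof -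
      from pos[of p] have "0 \<le> cutoff Y p * (- lap quu quv qvv p)"
        unfolding cutoff_def Y_def using A_ge b1 b2 by (intro mult_nonneg_nonneg) auto
      then show ?thesis by simp
    qed
    fix p assume p: "p \<in> E"
    then have uv: "2 \<le> fst p" "2 \<le> snd p" "2 * k \<le> fst p + snd p" "fst p + snd p \<le> n0" "e1 p + e2 p < \<rho>"
      by (auto simp: E_def k_def e1_def e2_def)
    then have C1: "cutoff Y p = 1"
      using z1'(1)[of "fst p + snd p"] z2(1)[of "fst p + snd p"] km by (simp add: cutoff_def A_1 Y_def)
    have gen: "2 * r * x / (2 * r)\<^sup>2 = x / (2 * r)" if "r > 0" for r x :: real
      using that by (simp add: power2_eq_square)
    \<comment> \<open>On \<open>E\<close> the sum e1 + e2 is below \<rho>, so S < 2 \<rho>, and the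
      lower bound for the negative Laplacian becomes the density over 2 \<rho>.\<close>
    have "(S p)\<^sup>2 \<le> (2 * \<rho>)\<^sup>2" using uv S_pos[of p] by (intro power_mono) (auto simp: S_def)
    then have "2 * \<rho> * (M\<^sup>2 * e1 p + N\<^sup>2 * e2 p) / (2 * \<rho>)\<^sup>2 \<le> 2 * \<rho> * (M\<^sup>2 * e1 p + N\<^sup>2 * e2 p) / (S p)\<^sup>2"
      using \<rho> e_pos[of p] S_pos[of p] by (intro divide_left_mono mult_nonneg_nonneg add_nonneg_nonneg) auto
    moreover have "2 * \<rho> * (M\<^sup>2 * e1 p + N\<^sup>2 * e2 p) / (2 * \<rho>)\<^sup>2 = (M\<^sup>2 * e1 p + N\<^sup>2 * e2 p) / (2 * \<rho>)"
      by (rule gen) (rule \<rho>)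
    ultimately show "(M\<^sup>2 * e1 p + N\<^sup>2 * e2 p) / (2 * \<rho>) \<le> - (cutoff Y p * lap quu quv qvv p)"
      using nlap[of p] unfolding C1 mult_1 by linarith
  qed
  also have "\<dots> = - (LINT p:corner (2 * m)|\<Lambda>. cutoff Y p * lap quu quv qvv p)"
    unfolding set_lebesgue_integral_def by simp
  also have "\<dots> \<le> 8 * c\<^sup>2 * (g1 * measure \<Lambda> (strip 2 k) + g2 * measure \<Lambda> (block k) + g3 * measure \<Lambda> (block m))"
    using est by linarith
  finally show ?thesis
    by (simp only: e1_def e2_def g1_def g2_def g3_def k_def m_def)
qed

end

text \<open>The order of the choices matters: K from \<epsilon>, making the strip tail and the inner
  shell small; \<rho>0 from K; and finally, for each truncation level n0, a far cutoff n. The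
  truncation gives the region finite mass, and the resulting bound does not depend on it.\<close>

lemma (in weakly_harmonic) ball_mass_vanishes:
  fixes M N :: real
  assumes MN: "M > 0" "N > 0" and \<epsilon>: "\<epsilon> > 0"
  shows "\<exists>\<rho>0>0. \<forall>\<rho>. 0 < \<rho> \<and> \<rho> < \<rho>0 \<longrightarrow> (\<forall>n0.
    (\<integral>\<^sup>+p\<in>{p. exp (- 2 * M * fst p) + exp (- 2 * N * snd p) < \<rho> \<and> fst p + snd p \<le> n0}.
        ennreal (M\<^sup>2 * exp (- 2 * M * fst p) + N\<^sup>2 * exp (- 2 * N * snd p)) \<partial>\<Lambda>) \<le> ennreal (\<epsilon> * \<rho>))"
proof -
  obtain A A' A'' B c where "step_and_ramp A A' A'' B c" using exists_step_and_ramp by blast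
  then interpret weakly_harmonic_cutoff \<Lambda> b A A' A'' B c
    by (simp add: weakly_harmonic_axioms weakly_harmonic_cutoff_def)
  define G where "G K = 8 * c\<^sup>2 * (8 * c\<^sup>2 * (3 * (M + N) + 1) * measure \<Lambda> (strip 2 (real K))
        + 3 * (M + N + 1) * c * (measure \<Lambda> (block (real K)) / real K))" for K :: nat
  define G' where "G' n = 8 * c\<^sup>2 * (3 * (M + N + 1) * c * (measure \<Lambda> (block (real n)) / real n))" for n :: nat
  have "G \<longlonglongrightarrow> 8 * c\<^sup>2 * (8 * c\<^sup>2 * (3 * (M + N) + 1) * 0 + 3 * (M + N + 1) * c * 0)"
    unfolding G_def using strip_tail[of 1 2] by (intro tendsto_intros block_sublinear) simp
  then have "G \<longlonglongrightarrow> 0" by simp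
  then have "\<forall>\<^sub>F K in sequentially. G K < \<epsilon> / 4" using \<epsilon> by (intro order_tendstoD(2)) auto
  then obtain K where K: "K \<ge> 1" "G K < \<epsilon> / 4"
    using eventually_conj[OF _ eventually_ge_at_top[of 1]] by (metis (mono_tags, lifting) eventually_sequentially nle_le)
  have "G' \<longlonglongrightarrow> 8 * c\<^sup>2 * (3 * (M + N + 1) * c * 0)"
    unfolding G'_def by (intro tendsto_intros block_sublinear)
  then have G'0: "G' \<longlonglongrightarrow> 0" by simp
  \<comment> \<open>If \<rho> < \<rho>0, then both exponentials being below \<rho> forces u, v > 2 K
    + 2, hence u, v \<ge> 2 and u + v \<ge> 2 K.\<close>
  define \<rho>0 where "\<rho>0 = exp (- 2 * max M N * (2 * real K + 2))"
  have \<rho>0: "\<rho>0 > 0" "\<rho>0 \<le> 1" using MN by (auto simp: \<rho>0_def mult_nonneg_nonneg)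
  have "(\<integral>\<^sup>+p\<in>{p. exp (- 2 * M * fst p) + exp (- 2 * N * snd p) < \<rho> \<and> fst p + snd p \<le> n0}.
        ennreal (M\<^sup>2 * exp (- 2 * M * fst p) + N\<^sup>2 * exp (- 2 * N * snd p)) \<partial>\<Lambda>) \<le> ennreal (\<epsilon> * \<rho>)"
    if \<rho>: "0 < \<rho>" "\<rho> < \<rho>0" for \<rho> n0
  proof -
    have "\<forall>\<^sub>F n in sequentially. G' n < \<epsilon> / 4" using G'0 \<epsilon> by (intro order_tendstoD(2)) auto
    then have "\<forall>\<^sub>F n in sequentially. G' n < \<epsilon> / 4 \<and> max (2 * K) (nat \<lceil>n0\<rceil>) \<le> n"
      by (intro eventually_conj eventually_ge_at_top)
    then obtain n where "G' n < \<epsilon> / 4" "max (2 * K) (nat \<lceil>n0\<rceil>) \<le> n"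
      using eventually_happens'[OF sequentially_bot] by blast
    then have n: "G' n < \<epsilon> / 4" "2 * K \<le> n" "n0 \<le> real n" by linarith+
    let ?E = "{p. 2 \<le> fst p \<and> 2 \<le> snd p \<and> 2 * real K \<le> fst p + snd p \<and> fst p + snd p \<le> n0 \<and>
      exp (- 2 * M * fst p) + exp (- 2 * N * snd p) < \<rho>}"
    have large: "2 * real K + 2 < x" if "exp (- 2 * L * x) < \<rho>" "0 < L" "L \<le> max M N" for x L
    proof (rule ccontr)
      assume "\<not> 2 * real K + 2 < x"
      then have "L * x \<le> max M N * (2 * real K + 2)"
      proof (cases "x \<ge> 0")
        case True
        then show ?thesis using that MN \<open>\<not> 2 * real K + 2 < x\<close> by (intro mult_mono) auto
      next
        case False
        then have "L * x \<le> 0" using that by (simp add: mult_nonneg_nonpos)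
        also have "0 \<le> max M N * (2 * real K + 2)" using MN by (intro mult_nonneg_nonneg) auto
        finally show ?thesis .
      qed
      then have "\<rho>0 \<le> exp (- 2 * L * x)" by (simp add: \<rho>0_def)
      then show False using that \<rho> by linarith
    qed
    have E: "{p. exp (- 2 * M * fst p) + exp (- 2 * N * snd p) < \<rho> \<and> fst p + snd p \<le> n0} = ?E"
    proof (intro set_eqI iffI)
      fix p assume "p \<in> {p. exp (- 2 * M * fst p) + exp (- 2 * N * snd p) < \<rho> \<and> fst p + snd p \<le> n0}"
      then have p: "exp (- 2 * M * fst p) + exp (- 2 * N * snd p) < \<rho>" "fst p + snd p \<le> n0" by auto
      have "exp (- 2 * M * fst p) < \<rho>" "exp (- 2 * N * snd p) < \<rho>"
        using p(1) exp_gt_zero[of "- 2 * M * fst p"] exp_gt_zero[of "- 2 * N * snd p"] by linarith+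
      then have "2 * real K + 2 < fst p" "2 * real K + 2 < snd p"
        using large[of M "fst p"] large[of N "snd p"] MN by auto
      then show "p \<in> ?E" using p by auto
    qed auto
    have "(LINT p:?E|\<Lambda>. (M\<^sup>2 * exp (- 2 * M * fst p) + N\<^sup>2 * exp (- 2 * N * snd p)) / (2 * \<rho>))
     \<le> 8 * c\<^sup>2 * (8 * c\<^sup>2 * (3 * (M + N) + 1) * measure \<Lambda> (strip 2 (real K))
        + 3 * (M + N + 1) * c / real K * measure \<Lambda> (block (real K))
        + 3 * (M + N + 1) * c / real n * measure \<Lambda> (block (real n)))"
      using MN \<rho> \<rho>0 K n by (intro log_potential_estimate) auto
    also have "\<dots> = G K + G' n" by (simp only: G_def G'_def distrib_left add.assoc times_divide_eq_left times_divide_eq_right)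
    also have "\<dots> \<le> \<epsilon> / 2" using K n by linarith
    finally have le: "(LINT p:?E|\<Lambda>. M\<^sup>2 * exp (- 2 * M * fst p) + N\<^sup>2 * exp (- 2 * N * snd p)) \<le> \<epsilon> * \<rho>"
      using \<rho> by (simp add: field_simps)
    have E_sets: "?E \<in> sets borel"
      unfolding E[symmetric] by (rule sets_exp_sublevel)
    have E_sub: "?E \<subseteq> corner n0" by (auto simp: corner_def)
    have "continuous_on quadrant (\<lambda>p. M\<^sup>2 * exp (- 2 * M * fst p) + N\<^sup>2 * exp (- 2 * N * snd p))"
      by (intro continuous_intros)
    then have "set_integrable \<Lambda> ?E (\<lambda>p. M\<^sup>2 * exp (- 2 * M * fst p) + N\<^sup>2 * exp (- 2 * N * snd p))"
      by (rule set_integrable_subset[OF integrable_corner _ E_sub]) (simp only: sets_\<Lambda> E_sets)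
    then have int: "integrable \<Lambda> (\<lambda>p. indicator ?E p * (M\<^sup>2 * exp (- 2 * M * fst p) + N\<^sup>2 * exp (- 2 * N * snd p)))"
      by (simp add: set_integrable_def)
    have "(\<integral>\<^sup>+p\<in>?E. ennreal (M\<^sup>2 * exp (- 2 * M * fst p) + N\<^sup>2 * exp (- 2 * N * snd p)) \<partial>\<Lambda>)
        = (\<integral>\<^sup>+p. ennreal (indicator ?E p * (M\<^sup>2 * exp (- 2 * M * fst p) + N\<^sup>2 * exp (- 2 * N * snd p))) \<partial>\<Lambda>)"
      by (intro nn_integral_cong) (simp add: indicator_def)
    also have "\<dots> = ennreal (LINT p:?E|\<Lambda>. M\<^sup>2 * exp (- 2 * M * fst p) + N\<^sup>2 * exp (- 2 * N * snd p))"
      unfolding set_lebesgue_integral_def real_scaleR_def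
      by (rule nn_integral_eq_integral[OF int]) (simp add: indicator_def)
    also have "\<dots> \<le> ennreal (\<epsilon> * \<rho>)" using le by (rule ennreal_leI)
    finally show ?thesis unfolding E .
  qed
  then show ?thesis using \<rho>0 by blast
qed

section \<open>Functions that are smooth along the leaves\<close>

lemma flow_add: "flow mu lam (s + t) p = flow mu lam s (flow mu lam t p)"
  by (simp add: flow_def distrib_left exp_add)

lemma continuous_on_flow [continuous_intros]:
  "continuous_on S f \<Longrightarrow> continuous_on S g \<Longrightarrow> continuous_on S (\<lambda>x. flow mu lam (f x) (g x))"
  unfolding flow_def by (intro continuous_intros)

lemma open_flow_vimage:
  "open U \<Longrightarrow> open {s::real. flow mu lam (of_real s * v) p \<in> U}"
  using open_vimage[of U "\<lambda>s::real. flow mu lam (of_real s * v) p"]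
  by (simp add: vimage_def continuous_on_flow continuous_on_mult continuous_on_of_real continuous_on_id continuous_on_const)

lemma open_flow_vimage':
  "open U \<Longrightarrow> open {t. flow mu lam t p \<in> U}"
  using open_vimage[of U "\<lambda>t. flow mu lam t p"]
  by (simp add: vimage_def continuous_on_flow continuous_on_id continuous_on_const)

locale linear_flow =
  fixes mu lam :: complex
begin

text \<open>\<open>leaf_deriv\<close> is a value of \<open>vector_derivative\<close>, which means
  nothing where no derivative exists; the relation records existence as well.\<close>

definition has_leaf_deriv :: "(pt \<Rightarrow> complex) \<Rightarrow> complex \<Rightarrow> complex \<Rightarrow> pt \<Rightarrow> bool" where
  "has_leaf_deriv f D v p \<longleftrightarrow>
     ((\<lambda>s::real. f (flow mu lam (of_real s * v) p)) has_vector_derivative D) (at 0)"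

lemma has_leaf_deriv_imp: "has_leaf_deriv f D v p \<Longrightarrow> leaf_deriv mu lam v f p = D"
  unfolding has_leaf_deriv_def leaf_deriv_def by (rule vector_derivative_at)

lemma has_leaf_deriv_works:
  "(\<lambda>s::real. f (flow mu lam (of_real s * v) p)) differentiable (at 0) \<Longrightarrow>
    has_leaf_deriv f (leaf_deriv mu lam v f p) v p"
  unfolding has_leaf_deriv_def leaf_deriv_def by (simp add: vector_derivative_works)

lemma has_leaf_deriv_cong:
  assumes "open U" "p \<in> U" "\<And>q. q \<in> U \<Longrightarrow> f q = g q"
  shows "has_leaf_deriv f D v p \<longleftrightarrow> has_leaf_deriv g D v p"
proof -
  let ?S = "{s::real. flow mu lam (of_real s * v) p \<in> U}"
  have S: "open ?S" "0 \<in> ?S" using open_flow_vimage[OF assms(1)] assms(2) by (auto simp: flow_0)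
  show ?thesis unfolding has_leaf_deriv_def
    using has_vector_derivative_transform_within_open[OF _ S] assms(3) by (metis (no_types, lifting) mem_Collect_eq)
qed

lemma leaf_deriv_cong:
  assumes "open U" "p \<in> U" "\<And>q. q \<in> U \<Longrightarrow> f q = g q"
  shows "leaf_deriv mu lam v f p = leaf_deriv mu lam v g p"
proof -
  have "has_leaf_deriv f D v p \<longleftrightarrow> has_leaf_deriv g D v p" for D
    by (rule has_leaf_deriv_cong[OF assms])
  then show ?thesis
    unfolding has_leaf_deriv_def leaf_deriv_def vector_derivative_def by simp
qed

text \<open>Unlike \<open>leaf_smooth\<close> this is relative to a set \<open>U\<close>, so that
  functions can be glued from open pieces. Continuity is demanded at every order because
  differentiability along leaves says nothing about the transversal behavior.\<close>

primrec leaf_Ck :: "pt set \<Rightarrow> nat \<Rightarrow> (pt \<Rightarrow> complex) \<Rightarrow> bool" where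
  "leaf_Ck U 0 f = continuous_on U f"
| "leaf_Ck U (Suc k) f = (continuous_on U f \<and> (\<forall>v\<in>{1, \<i>}.
      (\<forall>p\<in>U. has_leaf_deriv f (leaf_deriv mu lam v f p) v p) \<and> leaf_Ck U k (leaf_deriv mu lam v f)))"

definition leaf_smooth_on :: "pt set \<Rightarrow> (pt \<Rightarrow> complex) \<Rightarrow> bool" where
  "leaf_smooth_on U f \<longleftrightarrow> (\<forall>k. leaf_Ck U k f)"

lemma leaf_Ck_continuous: "leaf_Ck U k f \<Longrightarrow> continuous_on U f"
  by (cases k) auto

lemma leaf_Ck_cong:
  assumes "open U" "\<And>q. q \<in> U \<Longrightarrow> f q = g q"
  shows "leaf_Ck U k f \<longleftrightarrow> leaf_Ck U k g"
  using assms(2)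
proof (induction k arbitrary: f g)
  case 0
  then show ?case by (simp cong: continuous_on_cong)
next
  case (Suc k)
  have "leaf_deriv mu lam v f p = leaf_deriv mu lam v g p" if "p \<in> U" for p v
    using leaf_deriv_cong[OF assms(1) that] Suc.prems by blast
  moreover from this have "leaf_Ck U k (leaf_deriv mu lam v f) = leaf_Ck U k (leaf_deriv mu lam v g)" for v
    by (intro Suc.IH)
  moreover have "has_leaf_deriv f D v p = has_leaf_deriv g D v p" if "p \<in> U" for p v D
    using has_leaf_deriv_cong[OF assms(1) that] Suc.prems by blast
  moreover have "continuous_on U f \<longleftrightarrow> continuous_on U g" using Suc.prems by (simp cong: continuous_on_cong)
  ultimately show ?case by simp
qed

lemma leaf_Ck_SucI:
  assumes "open U" "continuous_on U f"
    "\<And>v p. v \<in> {1, \<i>} \<Longrightarrow> p \<in> U \<Longrightarrow> has_leaf_deriv f (D v p) v p"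
    "\<And>v. v \<in> {1, \<i>} \<Longrightarrow> leaf_Ck U k (D v)"
  shows "leaf_Ck U (Suc k) f"
proof -
  have eq: "leaf_deriv mu lam v f p = D v p" if "v \<in> {1, \<i>}" "p \<in> U" for v p
    using has_leaf_deriv_imp[OF assms(3)[OF that]] .
  have "leaf_Ck U k (leaf_deriv mu lam v f)" if "v \<in> {1, \<i>}" for v
    using leaf_Ck_cong[OF assms(1), of "leaf_deriv mu lam v f" "D v"] eq[OF that] assms(4)[OF that] by blast
  moreover have "has_leaf_deriv f (leaf_deriv mu lam v f p) v p" if "v \<in> {1, \<i>}" "p \<in> U" for v p
    using assms(3)[OF that] eq[OF that] by simp
  ultimately show ?thesis using assms(2) by simp
qed

lemma leaf_Ck_SucD: "leaf_Ck U (Suc k) f \<Longrightarrow> leaf_Ck U k f"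
proof (induction k arbitrary: f)
  case (Suc k)
  then show ?case by (metis leaf_Ck.simps(2))
qed simp

lemma has_leaf_deriv_add:
  "has_leaf_deriv f D v p \<Longrightarrow> has_leaf_deriv g E v p \<Longrightarrow> has_leaf_deriv (\<lambda>p. f p + g p) (D + E) v p"
  unfolding has_leaf_deriv_def by (rule has_vector_derivative_add)

lemma has_leaf_deriv_mult:
  "has_leaf_deriv f D v p \<Longrightarrow> has_leaf_deriv g E v p \<Longrightarrow>
    has_leaf_deriv (\<lambda>p. f p * g p) (f p * E + D * g p) v p"
  unfolding has_leaf_deriv_def
  by (drule (1) has_vector_derivative_mult) (simp add: flow_0)

lemma has_leaf_deriv_cnj:
  "has_leaf_deriv f D v p \<Longrightarrow> has_leaf_deriv (\<lambda>p. cnj (f p)) (cnj D) v p"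
  unfolding has_leaf_deriv_def by (rule bounded_linear.has_vector_derivative[OF bounded_linear_cnj])

lemma has_leaf_deriv_const: "has_leaf_deriv (\<lambda>p. c) 0 v p"
  unfolding has_leaf_deriv_def by simp

lemma leaf_Ck_const: "open U \<Longrightarrow> leaf_Ck U k (\<lambda>p. c)"
proof (induction k arbitrary: c)
  case (Suc k)
  show ?case
    by (rule leaf_Ck_SucI[where D = "\<lambda>v p. 0"])
      (simp_all add: Suc has_leaf_deriv_const)
qed simp

lemma leaf_Ck_add: "open U \<Longrightarrow> leaf_Ck U k f \<Longrightarrow> leaf_Ck U k g \<Longrightarrow> leaf_Ck U k (\<lambda>p. f p + g p)"
proof (induction k arbitrary: f g)
  case (Suc k)
  show ?case
  proof (rule leaf_Ck_SucI[where D = "\<lambda>v p. leaf_deriv mu lam v f p + leaf_deriv mu lam v g p"])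
    show "continuous_on U (\<lambda>p. f p + g p)" using Suc.prems by (intro continuous_on_add) auto
    show "has_leaf_deriv (\<lambda>p. f p + g p) (leaf_deriv mu lam v f p + leaf_deriv mu lam v g p) v p"
      if "v \<in> {1, \<i>}" "p \<in> U" for v p
      using Suc.prems that by (intro has_leaf_deriv_add) auto
    show "leaf_Ck U k (\<lambda>p. leaf_deriv mu lam v f p + leaf_deriv mu lam v g p)" if "v \<in> {1, \<i>}" for v
      using Suc.prems that by (intro Suc.IH) auto
  qed (rule Suc.prems)
qed (auto intro: continuous_on_add)

lemma leaf_Ck_mult: "open U \<Longrightarrow> leaf_Ck U k f \<Longrightarrow> leaf_Ck U k g \<Longrightarrow> leaf_Ck U k (\<lambda>p. f p * g p)"
proof (induction k arbitrary: f g)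
  case (Suc k)
  show ?case
  proof (rule leaf_Ck_SucI[where D = "\<lambda>v p. f p * leaf_deriv mu lam v g p + leaf_deriv mu lam v f p * g p"])
    show "continuous_on U (\<lambda>p. f p * g p)" using Suc.prems by (intro continuous_on_mult) auto
    show "has_leaf_deriv (\<lambda>p. f p * g p) (f p * leaf_deriv mu lam v g p + leaf_deriv mu lam v f p * g p) v p"
      if "v \<in> {1, \<i>}" "p \<in> U" for v p
      using Suc.prems that by (intro has_leaf_deriv_mult) auto
    show "leaf_Ck U k (\<lambda>p. f p * leaf_deriv mu lam v g p + leaf_deriv mu lam v f p * g p)" if v: "v \<in> {1, \<i>}" for v
    proof (rule leaf_Ck_add[OF Suc.prems(1)])
      note ck = leaf_Ck_SucD[OF Suc.prems(2)] leaf_Ck_SucD[OF Suc.prems(3)]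
      have "leaf_Ck U k (leaf_deriv mu lam v g)" "leaf_Ck U k (leaf_deriv mu lam v f)" using Suc.prems v by auto
      then show "leaf_Ck U k (\<lambda>p. f p * leaf_deriv mu lam v g p)" "leaf_Ck U k (\<lambda>p. leaf_deriv mu lam v f p * g p)"
        using ck by (auto intro: Suc.IH[OF Suc.prems(1)])
    qed
  qed (rule Suc.prems)
qed (auto intro: continuous_on_mult)

lemma leaf_Ck_cnj: "open U \<Longrightarrow> leaf_Ck U k f \<Longrightarrow> leaf_Ck U k (\<lambda>p. cnj (f p))"
proof (induction k arbitrary: f)
  case (Suc k)
  show ?case
  proof (rule leaf_Ck_SucI[where D = "\<lambda>v p. cnj (leaf_deriv mu lam v f p)"])
    show "continuous_on U (\<lambda>p. cnj (f p))" using Suc.prems by (intro continuous_on_cnj) auto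
  qed (use Suc in \<open>auto intro: has_leaf_deriv_cnj\<close>)
qed (auto intro: continuous_on_cnj)

lemma has_leaf_deriv_inverse:
  assumes "has_leaf_deriv f D v p" "f p \<noteq> 0"
  shows "has_leaf_deriv (\<lambda>p. inverse (f p)) ((- D) * (inverse (f p) * inverse (f p))) v p"
proof -
  have "(inverse has_field_derivative - (inverse (f p) * inverse (f p))) (at (f p))"
    using assms(2) by (auto intro!: derivative_eq_intros)
  then have "(inverse has_field_derivative - (inverse (f p) * inverse (f p))) (at (f (flow mu lam (of_real 0 * v) p)))"
    by (simp add: flow_0)
  from field_vector_diff_chain_at[OF assms(1)[unfolded has_leaf_deriv_def] this]
  show ?thesis unfolding has_leaf_deriv_def by (simp add: o_def mult_ac)
qed

lemma leaf_Ck_inverse: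
  "open U \<Longrightarrow> (\<And>p. p \<in> U \<Longrightarrow> f p \<noteq> 0) \<Longrightarrow> leaf_Ck U k f \<Longrightarrow> leaf_Ck U k (\<lambda>p. inverse (f p))"
proof (induction k)
  case 0
  then show ?case by (auto intro: continuous_on_inverse)
next
  case (Suc k)
  have ck: "leaf_Ck U k (\<lambda>p. inverse (f p))"
    using Suc leaf_Ck_SucD by blast
  show ?case
  proof (rule leaf_Ck_SucI[where D = "\<lambda>v p. (- leaf_deriv mu lam v f p) * (inverse (f p) * inverse (f p))"])
    show "continuous_on U (\<lambda>p. inverse (f p))" using Suc.prems by (intro continuous_on_inverse) auto
    show "has_leaf_deriv (\<lambda>p. inverse (f p)) (- leaf_deriv mu lam v f p * (inverse (f p) * inverse (f p))) v p"
      if "v \<in> {1, \<i>}" "p \<in> U" for v p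
      using Suc.prems that by (intro has_leaf_deriv_inverse) auto
    show "leaf_Ck U k (\<lambda>p. - leaf_deriv mu lam v f p * (inverse (f p) * inverse (f p)))" if v: "v \<in> {1, \<i>}" for v
    proof -
      have "leaf_Ck U k (\<lambda>p. (-1) * leaf_deriv mu lam v f p)"
        by (rule leaf_Ck_mult[OF Suc.prems(1) leaf_Ck_const[OF Suc.prems(1)]]) (use Suc.prems v in auto)
      then have "leaf_Ck U k (\<lambda>p. ((-1) * leaf_deriv mu lam v f p) * (inverse (f p) * inverse (f p)))"
        by (rule leaf_Ck_mult[OF Suc.prems(1) _ leaf_Ck_mult[OF Suc.prems(1) ck ck]])
      then show ?thesis by simp
    qed
  qed (rule Suc.prems)
qed

lemma leaf_Ck_Un:
  "open U \<Longrightarrow> open V \<Longrightarrow> leaf_Ck U k f \<Longrightarrow> leaf_Ck V k f \<Longrightarrow> leaf_Ck (U \<union> V) k f"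
proof (induction k arbitrary: f)
  case (Suc k)
  have "continuous_on (U \<union> V) f" using Suc.prems by (intro continuous_on_open_Un) auto
  moreover have "leaf_Ck (U \<union> V) k (leaf_deriv mu lam v f)" if "v \<in> {1, \<i>}" for v
    using Suc.prems that by (intro Suc.IH) auto
  ultimately show ?case using Suc.prems by auto
qed (auto intro: continuous_on_open_Un)

lemma leaf_Ck_subset: "leaf_Ck U k f \<Longrightarrow> V \<subseteq> U \<Longrightarrow> leaf_Ck V k f"
  by (induction k arbitrary: f) (auto intro: continuous_on_subset)

text \<open>The velocity \<open>w v\<close> of \<pi> along the flow does not depend on the point, so
  a leaf derivative of F after \<pi> is a directional derivative of F after \<pi>, to which the
  induction hypothesis applies.\<close>

lemma leaf_Ck_compose_smooth:
  fixes \<pi> :: "pt \<Rightarrow> real \<times> real" and w :: "complex \<Rightarrow> real \<times> real"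
  assumes U: "open U" and S: "open S" and cont: "continuous_on U \<pi>" and img: "\<And>p. p \<in> U \<Longrightarrow> \<pi> p \<in> S"
    and der: "\<And>p v. p \<in> U \<Longrightarrow> ((\<lambda>s::real. \<pi> (flow mu lam (of_real s * v) p)) has_vector_derivative w v) (at 0)"
    and F: "Ck S k F"
  shows "leaf_Ck U k (\<lambda>p. of_real (F (\<pi> p)))"
  using F
proof (induction k arbitrary: F)
  case 0
  then have "continuous_on U (\<lambda>p. F (\<pi> p))"
    using cont img by (auto intro: continuous_on_compose2)
  then show ?case by (auto intro: continuous_on_of_real)
next
  case (Suc k)
  have "continuous_on S F" using Suc.prems Ck_SucD[of S k F] by (meson Ck.simps(2) differentiable_imp_continuous_on differentiable_on_def differentiable_at_withinI)
  then have c: "continuous_on U (\<lambda>p. F (\<pi> p))"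
    using cont img by (auto intro: continuous_on_compose2)
  show ?case
  proof (rule leaf_Ck_SucI[where D = "\<lambda>v p. of_real (frechet_derivative F (at (\<pi> p)) (w v))"])
    show "has_leaf_deriv (\<lambda>p. of_real (F (\<pi> p))) (of_real (frechet_derivative F (at (\<pi> p)) (w v))) v p" if "p \<in> U" for v p
    proof -
      have "F differentiable (at (\<pi> p))" using Suc.prems img[OF that] by simp
      then have "(F has_derivative frechet_derivative F (at (\<pi> p))) (at (\<pi> (flow mu lam (of_real 0 * v) p)))"
        by (simp add: frechet_derivative_works flow_0)
      from vector_derivative_diff_chain_within[OF der[OF that, of v] has_derivative_at_withinI[OF this]]
      have "((\<lambda>s::real. F (\<pi> (flow mu lam (of_real s * v) p))) has_vector_derivative frechet_derivative F (at (\<pi> p)) (w v)) (at 0)"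
        by (simp add: o_def)
      then show ?thesis unfolding has_leaf_deriv_def
        by (rule bounded_linear.has_vector_derivative[OF bounded_linear_of_real])
    qed
    show "leaf_Ck U k (\<lambda>p. of_real (frechet_derivative F (at (\<pi> p)) (w v)))" for v
    proof (rule Suc.IH)
      show "Ck S k (\<lambda>x. frechet_derivative F (at x) (w v))"
        using Suc.prems unfolding Ck.simps by blast
    qed
  qed (use U c in \<open>auto intro: continuous_on_of_real\<close>)
qed

lemma leaf_Ck_compose_real:
  assumes U: "open U" and T: "open T" and img: "\<And>p. p \<in> U \<Longrightarrow> r p \<in> T"
    and r: "leaf_Ck U k (\<lambda>p. of_real (r p))" and g: "Ck T k g"
  shows "leaf_Ck U k (\<lambda>p. of_real (g (r p)))"
  using r g
proof (induction k arbitrary: g)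
  case 0
  then have "continuous_on U (\<lambda>p. Re (of_real (r p)))" by (intro continuous_on_Re) simp
  then have "continuous_on U r" by simp
  then show ?case using 0 img by (auto intro!: continuous_on_of_real intro: continuous_on_compose2)
next
  case (Suc k)
  have cr: "continuous_on U r"
    using continuous_on_Re[OF leaf_Ck_continuous[OF Suc.prems(1)]] by simp
  have "continuous_on T g" using Suc.prems(2) by (meson Ck.simps(2) differentiable_imp_continuous_on differentiable_on_def differentiable_at_withinI)
  then have cg: "continuous_on U (\<lambda>p. g (r p))"
    using cr img by (auto intro: continuous_on_compose2)
  let ?D = "\<lambda>v p. leaf_deriv mu lam v (\<lambda>p. of_real (r p)) p"
  show ?case
  proof (rule leaf_Ck_SucI[where D = "\<lambda>v p. of_real (frechet_derivative g (at (r p)) 1) * ?D v p"])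
    fix v p assume v: "v \<in> {1, \<i>}" and p: "p \<in> U"
    have d: "has_leaf_deriv (\<lambda>p. of_real (r p)) (?D v p) v p" using Suc.prems(1) v p by auto
    then have dRe: "((\<lambda>s::real. r (flow mu lam (of_real s * v) p)) has_vector_derivative Re (?D v p)) (at 0)"
      unfolding has_leaf_deriv_def using bounded_linear.has_vector_derivative[OF bounded_linear_Re] by fastforce
    then have "((\<lambda>s::real. complex_of_real (r (flow mu lam (of_real s * v) p))) has_vector_derivative of_real (Re (?D v p))) (at 0)"
      by (rule bounded_linear.has_vector_derivative[OF bounded_linear_of_real])
    \<comment> \<open>The derivative of a real function along real time is real. This lets the
      complex factor \<open>?D\<close> stand in the chain rule, so that \<open>leaf_Ck_mult\<close>
      applies.\<close>
    then have eq: "?D v p = of_real (Re (?D v p))"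
      by (intro has_leaf_deriv_imp) (simp add: has_leaf_deriv_def)
    have gd: "g differentiable (at (r p))" using Suc.prems(2) img[OF p] by simp
    then have "(g has_derivative frechet_derivative g (at (r p))) (at (r (flow mu lam (of_real 0 * v) p)))"
      by (simp add: frechet_derivative_works flow_0)
    from vector_derivative_diff_chain_within[OF dRe has_derivative_at_withinI[OF this]]
    have "((\<lambda>s::real. g (r (flow mu lam (of_real s * v) p))) has_vector_derivative frechet_derivative g (at (r p)) (Re (?D v p))) (at 0)"
      by (simp add: o_def)
    then have "has_leaf_deriv (\<lambda>p. of_real (g (r p))) (of_real (frechet_derivative g (at (r p)) (Re (?D v p)))) v p"
      unfolding has_leaf_deriv_def by (rule bounded_linear.has_vector_derivative[OF bounded_linear_of_real])
    moreover have "frechet_derivative g (at (r p)) (Re (?D v p)) = Re (?D v p) * frechet_derivative g (at (r p)) 1"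
      using linear_cmul[OF linear_frechet_derivative[OF gd], of "Re (?D v p)" 1] by simp
    ultimately show "has_leaf_deriv (\<lambda>p. of_real (g (r p))) (of_real (frechet_derivative g (at (r p)) 1) * ?D v p) v p"
      using eq by (metis mult.commute of_real_mult)
  next
    fix v assume v: "v \<in> {1, \<i>}"
    have "leaf_Ck U k (\<lambda>p. of_real (frechet_derivative g (at (r p)) 1))"
      using Suc.IH[of "\<lambda>x. frechet_derivative g (at x) 1"] leaf_Ck_SucD[OF Suc.prems(1)] Suc.prems(2) by simp
    then show "leaf_Ck U k (\<lambda>p. of_real (frechet_derivative g (at (r p)) 1) * ?D v p)"
      by (rule leaf_Ck_mult[OF U]) (use Suc.prems(1) v in auto)
  qed (use U cg in \<open>auto intro: continuous_on_of_real\<close>)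
qed

lemma has_leaf_deriv_fst: "has_leaf_deriv fst (mu * v * fst p) v p"
  and has_leaf_deriv_snd: "has_leaf_deriv snd (lam * v * snd p) v p"
proof -
  have "((\<lambda>s::real. exp (m * (of_real s * v)) * z) has_vector_derivative m * v * z) (at 0)" for m z :: complex
    by (rule has_vector_derivative_real_field[of "\<lambda>s. exp (m * (s * v)) * z", simplified])
      (auto intro!: derivative_eq_intros)
  then show "has_leaf_deriv fst (mu * v * fst p) v p" "has_leaf_deriv snd (lam * v * snd p) v p"
    by (simp_all add: has_leaf_deriv_def flow_def)
qed

lemma leaf_Ck_fst: "open U \<Longrightarrow> leaf_Ck U k fst"
proof (induction k)
  case (Suc k)
  show ?case
    by (rule leaf_Ck_SucI[where D = "\<lambda>v p. mu * v * fst p"])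
      (use Suc has_leaf_deriv_fst in \<open>auto intro!: continuous_on_fst leaf_Ck_mult leaf_Ck_const\<close>)
qed (auto intro!: continuous_on_fst)

lemma leaf_Ck_snd: "open U \<Longrightarrow> leaf_Ck U k snd"
proof (induction k)
  case (Suc k)
  show ?case
    by (rule leaf_Ck_SucI[where D = "\<lambda>v p. lam * v * snd p"])
      (use Suc has_leaf_deriv_snd in \<open>auto intro!: continuous_on_snd leaf_Ck_mult leaf_Ck_const\<close>)
qed (auto intro!: continuous_on_snd)

lemma leaf_smooth_iff: "leaf_smooth mu lam f \<longleftrightarrow> leaf_smooth_on punctured_bidisc f"
proof
  have diff: "has_leaf_deriv f D v p \<Longrightarrow> (\<lambda>s::real. f (flow mu lam (of_real s * v) p)) differentiable (at 0)" for f D v p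
    unfolding has_leaf_deriv_def by (rule differentiableI_vector)
  assume f: "leaf_smooth_on punctured_bidisc f"
  have "leaf_smooth_on punctured_bidisc (leaf_derivs mu lam vs f)" if "vs \<in> lists {1, \<i>}" for vs
    using that
  proof (induction vs)
    case Nil
    then show ?case using f by (simp add: leaf_derivs_def)
  next
    case (Cons v vs)
    have "leaf_Ck punctured_bidisc k (leaf_derivs mu lam (v # vs) f)" for k
    proof -
      have "leaf_Ck punctured_bidisc (Suc k) (leaf_derivs mu lam vs f)"
        using Cons.IH unfolding leaf_smooth_on_def by blast
      then show ?thesis using Cons.hyps by (auto simp: leaf_derivs_def)
    qed
    then show ?case unfolding leaf_smooth_on_def by blast
  qed
  then have ck: "leaf_Ck punctured_bidisc (Suc 0) (leaf_derivs mu lam vs f)" if "vs \<in> lists {1, \<i>}" for vs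
    using that unfolding leaf_smooth_on_def by blast
  show "leaf_smooth mu lam f"
    unfolding leaf_smooth_def
  proof (intro ballI conjI)
    show "continuous_on punctured_bidisc (leaf_derivs mu lam vs f)" if "vs \<in> lists {1, \<i>}" for vs
      using ck[OF that] by simp
    show "(\<lambda>s::real. leaf_derivs mu lam vs f (flow mu lam (of_real s * v) p)) differentiable (at 0)"
      if "vs \<in> lists {1, \<i>}" "v \<in> {1, \<i>}" "p \<in> punctured_bidisc" for vs v p
      using ck[OF that(1), unfolded leaf_Ck.simps] that(2,3) diff by blast
  qed
next
  assume "leaf_smooth mu lam f"
  moreover have "leaf_Ck punctured_bidisc k f" if "leaf_smooth mu lam f" for k f
    using that
  proof (induction k arbitrary: f)
    case 0
    then have "continuous_on punctured_bidisc (leaf_derivs mu lam [] f)" unfolding leaf_smooth_def by blast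
    then show ?case by (simp add: leaf_derivs_def)
  next
    case (Suc k)
    note d = Suc.prems[unfolded leaf_smooth_def, rule_format]
    have "leaf_smooth mu lam (leaf_deriv mu lam v f)" if v: "v \<in> {1, \<i>}" for v
      unfolding leaf_smooth_def
    proof (intro ballI)
      fix vs :: "complex list" assume "vs \<in> lists {1, \<i>}"
      \<comment> \<open>\<open>foldr\<close> applies the last entry first, so appending
        \<open>v\<close> differentiates f in the direction v before all other directions.\<close>
      then have "vs @ [v] \<in> lists {1, \<i>}" using v by auto
      moreover have "leaf_derivs mu lam (vs @ [v]) f = leaf_derivs mu lam vs (leaf_deriv mu lam v f)"
        by (simp add: leaf_derivs_def)
      ultimately show "continuous_on punctured_bidisc (leaf_derivs mu lam vs (leaf_deriv mu lam v f)) \<and>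
        (\<forall>v'\<in>{1, \<i>}. \<forall>p\<in>punctured_bidisc. (\<lambda>s::real. leaf_derivs mu lam vs (leaf_deriv mu lam v f)
            (flow mu lam (of_real s * v') p)) differentiable (at 0))"
        using d[of "vs @ [v]"] by metis
    qed
    then have "leaf_Ck punctured_bidisc k (leaf_deriv mu lam v f)" if "v \<in> {1, \<i>}" for v
      using that by (intro Suc.IH)
    moreover have "continuous_on punctured_bidisc f" "\<forall>v\<in>{1, \<i>}. \<forall>p\<in>punctured_bidisc. has_leaf_deriv f (leaf_deriv mu lam v f p) v p"
      using d[of "[]"] has_leaf_deriv_works[of f] by (auto simp: leaf_derivs_def)
    ultimately show ?case by simp
  qed
  ultimately show "leaf_smooth_on punctured_bidisc f" by (simp add: leaf_smooth_on_def)
qed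

lemma open_punctured_bidisc: "open punctured_bidisc"
  by (intro open_Diff open_Times open_ball closed_singleton)

text \<open>Extension by zero: f is smooth on \<open>U\<close> by hypothesis and off
  \<open>K\<close> because it vanishes there, and these two open sets cover the punctured
  bidisc.\<close>

lemma test_functionsI:
  assumes "open U" "compact K" "K \<subseteq> U" "U \<subseteq> punctured_bidisc" "leaf_smooth_on U f" "\<And>p. p \<notin> K \<Longrightarrow> f p = 0"
  shows "f \<in> test_functions mu lam"
proof -
  have "leaf_Ck (- K) k f" for k
    using leaf_Ck_cong[of "- K" "\<lambda>p. 0" f k] leaf_Ck_const[of "- K" k 0] assms(2,6)
    by (auto simp: compact_imp_closed open_Compl)
  then have "leaf_Ck (U \<union> - K) k f" for k
    using assms by (intro leaf_Ck_Un) (auto simp: leaf_smooth_on_def compact_imp_closed open_Compl)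
  moreover have "punctured_bidisc \<subseteq> U \<union> - K" using assms(3) by blast
  ultimately have "leaf_Ck punctured_bidisc k f" for k
    using leaf_Ck_subset by blast
  then have "leaf_smooth mu lam f" by (simp add: leaf_smooth_iff leaf_smooth_on_def)
  moreover have sub: "closure {p. f p \<noteq> 0} \<subseteq> K"
    using assms(2,6) by (intro closure_minimal) (auto simp: compact_imp_closed)
  moreover have "compact (closure {p. f p \<noteq> 0})"
    using compact_Int_closed[OF assms(2) closed_closure[of "{p. f p \<noteq> 0}"]] sub by (simp add: Int_absorb1)
  ultimately show ?thesis using assms(3,4) by (auto simp: test_functions_def)
qed

text \<open>Continuity extends across 0 and the boundary of the bidisc because the support is
  compact in the punctured bidisc; it supplies Borel measurability.\<close>

lemma test_functionsD:
  assumes "f \<in> test_functions mu lam"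
  shows "leaf_smooth_on punctured_bidisc f" "continuous_on UNIV f"
proof -
  show s: "leaf_smooth_on punctured_bidisc f"
    using assms by (simp add: test_functions_def leaf_smooth_iff)
  let ?K = "closure {p. f p \<noteq> 0}"
  have K: "?K \<subseteq> punctured_bidisc" using assms by (simp add: test_functions_def)
  have "continuous_on punctured_bidisc f" using s unfolding leaf_smooth_on_def by (metis leaf_Ck.simps(1))
  moreover have "continuous_on (- ?K) f"
  proof (rule continuous_on_eq[OF continuous_on_const[of _ 0]])
    show "0 = f p" if "p \<in> - ?K" for p
      using that closure_subset[of "{p. f p \<noteq> 0}"] by force
  qed
  ultimately have "continuous_on (punctured_bidisc \<union> - ?K) f"
    using open_punctured_bidisc by (intro continuous_on_open_Un) auto
  moreover have "punctured_bidisc \<union> - ?K = UNIV" using K by blast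
  ultimately show "continuous_on UNIV f" by simp
qed

end

section \<open>Functions holomorphic along the leaves\<close>

lemma leaf_linear_deriv: "deriv (\<lambda>t. exp (m * t) * z) 0 = m * z" for m z :: complex
  by (rule DERIV_imp_deriv) (auto intro!: derivative_eq_intros)

context linear_flow
begin

text \<open>Differentiability at time 0 at every point suffices, because the flow translates it to
  all other times in \<open>U\<close>.\<close>

definition leaf_holomorphic_on :: "pt set \<Rightarrow> (pt \<Rightarrow> complex) \<Rightarrow> bool" where
  "leaf_holomorphic_on U f \<longleftrightarrow> continuous_on U f \<and>
     (\<forall>p\<in>U. (\<lambda>t. f (flow mu lam t p)) field_differentiable (at 0))"

definition leaf_X :: "(pt \<Rightarrow> complex) \<Rightarrow> pt \<Rightarrow> complex" where
  "leaf_X f p = deriv (\<lambda>t. f (flow mu lam t p)) 0"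

lemma leaf_shift: "(\<lambda>t. f (flow mu lam t (flow mu lam s p))) = (\<lambda>t. f (flow mu lam t p)) \<circ> (\<lambda>t. t + s)"
  by (simp add: fun_eq_iff flow_add)

lemma leaf_X_flow: "leaf_X f (flow mu lam t p) = deriv (\<lambda>t. f (flow mu lam t p)) t"
  unfolding leaf_X_def leaf_shift using deriv_shift_0[of "\<lambda>t. f (flow mu lam t p)" t]
  by (simp add: o_def add.commute)

lemma leaf_holomorphic_imp:
  assumes "open U" "leaf_holomorphic_on U f"
  shows "(\<lambda>t. f (flow mu lam t p)) holomorphic_on {t. flow mu lam t p \<in> U}"
  unfolding holomorphic_on_def
proof
  fix t assume "t \<in> {t. flow mu lam t p \<in> U}"
  then have "(\<lambda>s. f (flow mu lam s (flow mu lam t p))) field_differentiable (at 0)"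
    using assms(2) by (auto simp: leaf_holomorphic_on_def)
  then obtain D where "((\<lambda>s. f (flow mu lam s (flow mu lam t p))) has_field_derivative D) (at 0)"
    by (auto simp: field_differentiable_def)
  then have "((\<lambda>s. f (flow mu lam (s + t) p)) has_field_derivative D) (at 0)"
    by (simp add: flow_add)
  then have "((\<lambda>t. f (flow mu lam t p)) has_field_derivative D) (at t)"
    using DERIV_shift[of "\<lambda>t. f (flow mu lam t p)" D 0 t] by simp
  then show "(\<lambda>t. f (flow mu lam t p)) field_differentiable (at t within {t. flow mu lam t p \<in> U})"
    by (auto simp: field_differentiable_def intro: has_field_derivative_at_within)
qed

text \<open>Cauchy's estimate for the difference of two functions along two orbits. It converts
  closeness of values on a small disc of times into closeness of derivatives, which is how
  \<open>leaf_X f\<close> becomes transversally continuous.\<close>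

lemma leaf_X_bound:
  assumes U: "open U" "leaf_holomorphic_on U f" "leaf_holomorphic_on U g" and r: "r > 0"
    and sub: "\<And>t. norm t \<le> r \<Longrightarrow> flow mu lam t p \<in> U \<and> flow mu lam t q \<in> U"
    and bd: "\<And>t. norm t \<le> r \<Longrightarrow> norm (f (flow mu lam t p) - g (flow mu lam t q)) \<le> C"
  shows "norm (leaf_X f p - leaf_X g q) \<le> C / r"
proof -
  let ?F = "\<lambda>t. f (flow mu lam t p)" and ?G = "\<lambda>t. g (flow mu lam t q)"
  have hF: "?F holomorphic_on cball 0 r" and hG: "?G holomorphic_on cball 0 r"
    by (rule holomorphic_on_subset[OF leaf_holomorphic_imp[OF U(1,2)]], use sub in auto,
        rule holomorphic_on_subset[OF leaf_holomorphic_imp[OF U(1,3)]], use sub in auto)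
  have dF: "?F field_differentiable (at 0)" and dG: "?G field_differentiable (at 0)"
    using U sub[of 0] r by (auto simp: leaf_holomorphic_on_def flow_0)
  have "norm ((deriv ^^ 1) (\<lambda>t. ?F t - ?G t) 0) \<le> fact 1 * C / r ^ 1"
  proof (rule Cauchy_inequality)
    show "(\<lambda>t. ?F t - ?G t) holomorphic_on ball 0 r"
      by (intro holomorphic_on_diff holomorphic_on_subset[OF hF] holomorphic_on_subset[OF hG]) auto
    show "continuous_on (cball 0 r) (\<lambda>t. ?F t - ?G t)"
      by (intro continuous_on_diff holomorphic_on_imp_continuous_on hF hG)
    show "norm (?F x - ?G x) \<le> C" if "norm (0 - x) = r" for x
      using that bd[of x] by simp
  qed (rule r)
  then show ?thesis
    using deriv_diff[OF dF dG] by (simp add: leaf_X_def)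
qed

lemma flow_nbhd:
  assumes "open U" "p \<in> U"
  shows "\<exists>r>0. \<exists>\<delta>>0. \<forall>t q. norm t \<le> r \<and> dist q p \<le> \<delta> \<longrightarrow> flow mu lam t q \<in> U"
proof -
  let ?f = "\<lambda>x. flow mu lam (fst x) (snd x)"
  have "continuous_on UNIV ?f"
    by (intro continuous_on_flow continuous_on_fst continuous_on_snd continuous_on_id)
  then have "open (?f -` U)" using assms(1) by (simp add: open_vimage)
  moreover have "(0, p) \<in> ?f -` U" using assms(2) by (simp add: flow_0)
  ultimately obtain A B where AB': "open A" "open B" "(0, p) \<in> A \<times> B" "A \<times> B \<subseteq> ?f -` U"
    by (rule open_prod_elim) blast
  then have AB: "open A" "open B" "0 \<in> A" "p \<in> B" "A \<times> B \<subseteq> ?f -` U" by auto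
  obtain r where r: "r > 0" "cball 0 r \<subseteq> A" using AB(1,3) open_contains_cball by blast
  obtain d where d: "d > 0" "cball p d \<subseteq> B" using AB(2,4) open_contains_cball by blast
  have "flow mu lam t q \<in> U" if "norm t \<le> r" "dist q p \<le> d" for t q
  proof -
    have "t \<in> A" "q \<in> B" using that r d by (auto simp: dist_commute)
    then show ?thesis using AB(5) by auto
  qed
  then show ?thesis using r d by blast
qed

text \<open>Along a leaf X f is the complex derivative of f, hence holomorphic. Transversally,
  uniform continuity of f on a compact product of a disc of times and a ball passes to X f by
  \<open>leaf_X_bound\<close>.\<close>

lemma leaf_holomorphic_X:
  assumes "open U" "leaf_holomorphic_on U f"
  shows "leaf_holomorphic_on U (leaf_X f)"
proof -
  have "(\<lambda>t. leaf_X f (flow mu lam t p)) field_differentiable (at 0)" if "p \<in> U" for p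
  proof -
    have "deriv (\<lambda>t. f (flow mu lam t p)) holomorphic_on {t. flow mu lam t p \<in> U}"
      by (rule holomorphic_deriv[OF leaf_holomorphic_imp[OF assms] open_flow_vimage'[OF assms(1)]])
    moreover have "0 \<in> {t. flow mu lam t p \<in> U}" using that by (simp add: flow_0)
    ultimately have "deriv (\<lambda>t. f (flow mu lam t p)) field_differentiable (at 0)"
      using open_flow_vimage'[OF assms(1)] holomorphic_on_imp_differentiable_at by blast
    then show ?thesis by (simp add: leaf_X_flow)
  qed
  moreover have "continuous_on U (leaf_X f)"
    unfolding continuous_on_iff
  proof (intro ballI allI impI)
    fix p and e :: real assume p: "p \<in> U" and e: "e > 0"
    obtain r d where r: "r > 0" and d: "d > 0" and rd: "\<And>t q. norm t \<le> r \<Longrightarrow> dist q p \<le> d \<Longrightarrow> flow mu lam t q \<in> U"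
      using flow_nbhd[OF assms(1) p] by metis
    let ?S = "cball (0::complex) r \<times> cball p d" and ?h = "\<lambda>x. f (flow mu lam (fst x) (snd x))"
    have "continuous_on ?S ?h"
    proof (rule continuous_on_compose2[of U f])
      show "continuous_on U f" using assms(2) by (simp add: leaf_holomorphic_on_def)
      show "continuous_on ?S (\<lambda>x. flow mu lam (fst x) (snd x))"
        by (intro continuous_on_flow continuous_on_fst continuous_on_snd continuous_on_id)
    qed (auto intro!: rd simp: dist_commute)
    moreover have "compact ?S" by (intro compact_Times compact_cball)
    ultimately have "uniformly_continuous_on ?S ?h" by (rule compact_uniformly_continuous)
    \<comment> \<open>The factor r compensates the 1 / r of Cauchy's estimate; the half leaves room
      for a strict inequality.\<close>
    moreover have "e * r / 2 > 0" using e r by simp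
    ultimately obtain d' where d': "d' > 0"
      "\<And>x y. x \<in> ?S \<Longrightarrow> y \<in> ?S \<Longrightarrow> dist y x < d' \<Longrightarrow> dist (?h y) (?h x) < e * r / 2"
      unfolding uniformly_continuous_on_def by metis
    show "\<exists>d>0. \<forall>x'\<in>U. dist x' p < d \<longrightarrow> dist (leaf_X f x') (leaf_X f p) < e"
    proof (intro exI[of _ "min d d'"] conjI ballI impI)
      fix q assume q: "q \<in> U" "dist q p < min d d'"
      have "norm (leaf_X f q - leaf_X f p) \<le> (e * r / 2) / r"
      proof (rule leaf_X_bound[OF assms assms(2) r])
        show "flow mu lam t q \<in> U \<and> flow mu lam t p \<in> U" if "norm t \<le> r" for t
          using that q d by (auto intro!: rd)
        show "norm (f (flow mu lam t q) - f (flow mu lam t p)) \<le> e * r / 2" if t: "norm t \<le> r" for t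
        proof -
          have "dist (t, q) (t, p) < d'" using q by (simp add: dist_Pair_Pair)
          then have "dist (?h (t, q)) (?h (t, p)) < e * r / 2"
            using t q d by (intro d'(2)) (auto simp: dist_commute)
          then show ?thesis by (simp add: dist_norm)
        qed
      qed
      then show "dist (leaf_X f q) (leaf_X f p) < e" using e r by (simp add: dist_norm)
    qed (use d d' in auto)
  qed
  ultimately show ?thesis by (simp add: leaf_holomorphic_on_def)
qed

lemma has_leaf_deriv_holomorphic:
  assumes "leaf_holomorphic_on U f" "p \<in> U"
  shows "has_leaf_deriv f (v * leaf_X f p) v p"
proof -
  have "((\<lambda>s::real. of_real s * v) has_vector_derivative v) (at 0)"
    by (auto intro!: derivative_eq_intros)
  moreover have "((\<lambda>t. f (flow mu lam t p)) has_field_derivative leaf_X f p) (at (of_real 0 * v))"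
    using assms by (auto simp: leaf_holomorphic_on_def leaf_X_def field_differentiable_derivI)
  ultimately have "((\<lambda>t. f (flow mu lam t p)) \<circ> (\<lambda>s::real. of_real s * v) has_vector_derivative v * leaf_X f p) (at 0)"
    by (rule field_vector_diff_chain_at)
  then show ?thesis by (simp add: has_leaf_deriv_def o_def)
qed

text \<open>The single complex derivative X f accounts for both real directions, and
  \<open>leaf_holomorphic_X\<close> keeps it in the class.\<close>

lemma leaf_Ck_holomorphic:
  "open U \<Longrightarrow> leaf_holomorphic_on U f \<Longrightarrow> leaf_Ck U k f"
proof (induction k arbitrary: f)
  case 0
  then show ?case by (simp add: leaf_holomorphic_on_def)
next
  case (Suc k)
  show ?case
  proof (rule leaf_Ck_SucI[where D = "\<lambda>v p. v * leaf_X f p"])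
    show "continuous_on U f" using Suc.prems by (simp add: leaf_holomorphic_on_def)
    show "has_leaf_deriv f (v * leaf_X f p) v p" if "p \<in> U" for v p
      using has_leaf_deriv_holomorphic[OF Suc.prems(2) that] .
    show "leaf_Ck U k (\<lambda>p. v * leaf_X f p)" for v
      by (rule leaf_Ck_mult[OF Suc.prems(1) leaf_Ck_const[OF Suc.prems(1)] Suc.IH[OF Suc.prems(1) leaf_holomorphic_X[OF Suc.prems]]])
  qed (rule Suc.prems)
qed

lemma leaf_holomorphic_fst: "leaf_holomorphic_on UNIV fst" and leaf_X_fst: "leaf_X fst p = mu * fst p"
  and leaf_holomorphic_snd: "leaf_holomorphic_on UNIV snd" and leaf_X_snd: "leaf_X snd p = lam * snd p"
proof -
  have "((\<lambda>t. exp (m * t) * z) has_field_derivative m * z) (at 0)" for m z :: complex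
    by (auto intro!: derivative_eq_intros)
  then have "(\<lambda>t. exp (m * t) * z) field_differentiable (at 0)" for m z :: complex
    unfolding field_differentiable_def by blast
  then show "leaf_holomorphic_on UNIV fst" "leaf_holomorphic_on UNIV snd"
    by (auto simp: leaf_holomorphic_on_def flow_def intro!: continuous_on_fst continuous_on_snd)
  show "leaf_X fst p = mu * fst p" "leaf_X snd p = lam * snd p"
    by (simp_all add: leaf_X_def flow_def leaf_linear_deriv)
qed

text \<open>On a leaf dtbar annihilates the holomorphic components and dt their conjugates, so each
  |f|^2 contributes only |X f|^2.\<close>

lemma leaf_laplacian_norm:
  assumes U: "open U" "p \<in> U" and hol: "leaf_holomorphic_on U (\<lambda>p. fst (y p))" "leaf_holomorphic_on U (\<lambda>p. snd (y p))"
  shows "leaf_dt mu lam (leaf_dtbar mu lam (\<lambda>q. of_real ((norm (y q))\<^sup>2))) p =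
    of_real ((norm (leaf_X (\<lambda>p. fst (y p)) p))\<^sup>2 + (norm (leaf_X (\<lambda>p. snd (y p)) p))\<^sup>2)"
proof -
  define f g where "f = (\<lambda>p. fst (y p))" and "g = (\<lambda>p. snd (y p))"
  have F: "of_real ((norm (y q))\<^sup>2) = f q * cnj (f q) + g q * cnj (g q)" for q
    by (simp add: norm_prod_def f_def g_def complex_norm_square[symmetric])
  have hf: "leaf_holomorphic_on U f" "leaf_holomorphic_on U g" using hol by (simp_all add: f_def g_def)
  note hX = hf[THEN leaf_holomorphic_X[OF U(1)]]
  have d1: "leaf_deriv mu lam v (\<lambda>q. f q * cnj (f q) + g q * cnj (g q)) q =
      (f q * cnj (v * leaf_X f q) + v * leaf_X f q * cnj (f q)) + (g q * cnj (v * leaf_X g q) + v * leaf_X g q * cnj (g q))"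
    if "q \<in> U" for v q
    by (intro has_leaf_deriv_imp has_leaf_deriv_add has_leaf_deriv_mult has_leaf_deriv_cnj has_leaf_deriv_holomorphic[OF hf(1) that]
      has_leaf_deriv_holomorphic[OF hf(2) that])
  have 1: "leaf_dtbar mu lam (\<lambda>q. of_real ((norm (y q))\<^sup>2)) q = f q * cnj (leaf_X f q) + g q * cnj (leaf_X g q)" if "q \<in> U" for q
    unfolding leaf_dtbar_def F d1[OF that] by (simp add: algebra_simps)
  have d2: "leaf_deriv mu lam v (leaf_dtbar mu lam (\<lambda>q. of_real ((norm (y q))\<^sup>2))) p =
      (f p * cnj (v * leaf_X (leaf_X f) p) + v * leaf_X f p * cnj (leaf_X f p))
      + (g p * cnj (v * leaf_X (leaf_X g) p) + v * leaf_X g p * cnj (leaf_X g p))" for v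
  proof -
    have "leaf_deriv mu lam v (leaf_dtbar mu lam (\<lambda>q. of_real ((norm (y q))\<^sup>2))) p =
        leaf_deriv mu lam v (\<lambda>q. f q * cnj (leaf_X f q) + g q * cnj (leaf_X g q)) p"
      by (rule leaf_deriv_cong[OF U 1])
    also have "\<dots> = (f p * cnj (v * leaf_X (leaf_X f) p) + v * leaf_X f p * cnj (leaf_X f p))
      + (g p * cnj (v * leaf_X (leaf_X g) p) + v * leaf_X g p * cnj (leaf_X g p))"
      by (intro has_leaf_deriv_imp has_leaf_deriv_add has_leaf_deriv_mult has_leaf_deriv_cnj
        has_leaf_deriv_holomorphic[OF hf(1) U(2)] has_leaf_deriv_holomorphic[OF hf(2) U(2)]
        has_leaf_deriv_holomorphic[OF hX(1) U(2)] has_leaf_deriv_holomorphic[OF hX(2) U(2)])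
    finally show ?thesis .
  qed
  have "leaf_dt mu lam (leaf_dtbar mu lam (\<lambda>q. of_real ((norm (y q))\<^sup>2))) p =
      leaf_X f p * cnj (leaf_X f p) + leaf_X g p * cnj (leaf_X g p)"
    unfolding leaf_dt_def d2 by (simp add: algebra_simps)
  also have "\<dots> = of_real ((norm (leaf_X f p))\<^sup>2 + (norm (leaf_X g p))\<^sup>2)"
    by (simp add: complex_norm_square[symmetric])
  finally show ?thesis by (simp add: f_def g_def)
qed

text \<open>The squared Euclidean length of the vector field, which is the coefficient of i ddbar of
  the squared norm in the flow coordinate.\<close>

definition leaf_density :: "pt \<Rightarrow> real" where
  "leaf_density p = (norm (mu * fst p))\<^sup>2 + (norm (lam * snd p))\<^sup>2"

lemma leaf_laplacian_norm_id:
  "leaf_dt mu lam (leaf_dtbar mu lam (\<lambda>q. of_real ((norm q)\<^sup>2))) p = of_real (leaf_density p)"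
  using leaf_laplacian_norm[OF open_UNIV UNIV_I, of "\<lambda>p. p" p] leaf_holomorphic_fst leaf_holomorphic_snd
  by (simp add: leaf_density_def leaf_X_fst leaf_X_snd)

lemma leaf_density_pos: "mu \<noteq> 0 \<Longrightarrow> lam \<noteq> 0 \<Longrightarrow> p \<noteq> 0 \<Longrightarrow> leaf_density p > 0"
  by (auto simp: leaf_density_def prod_eq_iff norm_mult intro: add_pos_nonneg add_nonneg_pos)

end

section \<open>Logarithmic coordinates off the separatrices\<close>

text \<open>Derivatives at a point of an open set are determined by the values there. This is needed
  because test functions are only assumed to vanish off a corner, with nothing said about their
  derivatives.\<close>

lemma jet_unique_zero:
  assumes "jet F Fu Fv Fuu Fuv Fvv" "open W" "W \<subseteq> quadrant" "\<And>x. x \<in> W \<Longrightarrow> F x = 0" "x \<in> W"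
  shows "Fu x = 0" "Fv x = 0" "Fuu x = 0" "Fuv x = 0" "Fvv x = 0"
proof -
  have z: "G1 y = 0" "G2 y = 0"
    if G: "\<And>p. p \<in> W \<Longrightarrow> (G has_derivative (\<lambda>h. fst h * G1 p + snd h * G2 p)) (at p)" "\<And>p. p \<in> W \<Longrightarrow> G p = 0" "y \<in> W"
    for G G1 G2 :: "real \<times> real \<Rightarrow> real" and y
  proof -
    have "((\<lambda>p. 0) has_derivative (\<lambda>h. fst h * G1 y + snd h * G2 y)) (at y)"
      by (rule has_derivative_transform_within_open[OF G(1)[OF that(3)] assms(2) that(3)]) (use G(2) in auto)
    then have "(\<lambda>h. fst h * G1 y + snd h * G2 y) = (\<lambda>h. 0)"
      using has_derivative_unique[OF _ has_derivative_const] by blast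
    then have "fst h * G1 y + snd h * G2 y = 0" for h :: "real \<times> real" by meson
    from this[of "(1, 0)"] this[of "(0, 1)"] show "G1 y = 0" "G2 y = 0" by simp_all
  qed
  note d = assms(1)[unfolded jet_def, rule_format, OF subsetD[OF assms(3)]]
  have u: "Fu y = 0" "Fv y = 0" if "y \<in> W" for y
    using z[of F Fu Fv y] d assms(4) that by blast+
  then show "Fu x = 0" "Fv x = 0" using assms(5) by auto
  show "Fuu x = 0" "Fuv x = 0" using z[of Fu Fuu Fuv x] d u assms(5) by blast+
  show "Fvv x = 0" using z[of Fv Fuv Fvv x] d u assms(5) by blast
qed

locale hyperbolic_flow = linear_flow +
  assumes mu: "mu \<noteq> 0" and lam: "lam \<noteq> 0" and nonreal: "lam / mu \<notin> \<real>"
begin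

definition off_axes :: "pt set" where
  "off_axes = {p \<in> bidisc. fst p \<noteq> 0 \<and> snd p \<noteq> 0}"

text \<open>
  In the real coordinates \<open>u = - ln \<bar>z\<bar> / \<bar>mu\<bar>\<close>, \<open>v = - ln \<bar>w\<bar> / \<bar>lam\<bar>\<close> every leaf other than the separatrices
  is the quadrant \<open>u, v > 0\<close>, and its Laplacian becomes \<open>(\<partial>\<^sub>u\<^sub>u + 2 b \<partial>\<^sub>u\<^sub>v + \<partial>\<^sub>v\<^sub>v) / 4\<close> with \<open>b = coupling\<close>.
\<close>

definition log_coord :: "pt \<Rightarrow> real \<times> real" where
  "log_coord p = (- ln (norm (fst p)) / norm mu, - ln (norm (snd p)) / norm lam)"

text \<open>The constant velocity of \<open>log_coord\<close> along the flow in the direction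
  \<open>v\<close> of complex time.\<close>

definition log_dir :: "complex \<Rightarrow> real \<times> real" where
  "log_dir v = (- Re (mu * v) / norm mu, - Re (lam * v) / norm lam)"

definition coupling :: real where
  "coupling = Re (mu * cnj lam) / (norm mu * norm lam)"

text \<open>Equality in |Re x| \<le> |x| for x = mu cnj lam would make x real, and with it lam / mu.
  Here the nonreality of the quotient enters: it makes u and v independent on a leaf and the
  operator elliptic.\<close>

lemma coupling_less_1: "\<bar>coupling\<bar> < 1"
proof -
  have "Im (mu * cnj lam) \<noteq> 0"
  proof
    assume "Im (mu * cnj lam) = 0"
    then have "Im (lam * cnj mu) = 0" by (simp add: algebra_simps)
    then have "Im (lam / mu) = 0"
      unfolding complex_div_cnj[of lam mu] by (metis Im_divide_of_real div_0 of_real_power)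
    then show False using nonreal by (simp add: complex_is_Real_iff)
  qed
  then have "(Re (mu * cnj lam))\<^sup>2 < (norm (mu * cnj lam))\<^sup>2"
    by (simp only: cmod_power2) simp
  then have "\<bar>Re (mu * cnj lam)\<bar> < norm (mu * cnj lam)"
    using power2_less_imp_less[of "\<bar>Re (mu * cnj lam)\<bar>" "norm (mu * cnj lam)"] by simp
  then show ?thesis using mu lam by (simp add: coupling_def norm_mult divide_simps abs_mult)
qed

lemma open_off_axes: "open off_axes"
proof -
  have eq: "off_axes = bidisc \<inter> {p. fst p \<noteq> 0} \<inter> {p. snd p \<noteq> 0}" by (auto simp: off_axes_def)
  have "open {p :: pt. fst p \<noteq> 0}" "open {p :: pt. snd p \<noteq> 0}"
    by (intro open_Collect_neq continuous_on_fst continuous_on_snd continuous_on_id continuous_on_const)+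
  then show ?thesis unfolding eq by (intro open_Int open_Times open_ball)
qed

lemma off_axes_subset: "off_axes \<subseteq> punctured_bidisc"
  by (auto simp: off_axes_def)

lemma log_coord_in_quadrant: "p \<in> off_axes \<Longrightarrow> log_coord p \<in> quadrant"
  using mu lam by (auto simp: off_axes_def log_coord_def quadrant_def divide_simps)

lemma continuous_log_coord: "continuous_on off_axes log_coord"
  unfolding log_coord_def
  by (intro continuous_intros) (use mu lam in \<open>auto simp: off_axes_def\<close>)

lemma log_coord_flow:
  assumes "fst p \<noteq> 0" "snd p \<noteq> 0"
  shows "log_coord (flow mu lam (of_real s * v) p) = log_coord p + s *\<^sub>R log_dir v"
proof -
  have "ln (norm (exp (m * (of_real s * v)) * z)) = s * Re (m * v) + ln (norm z)" if "z \<noteq> 0" for m z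
  proof -
    have "ln (norm (exp (m * (of_real s * v)) * z)) = ln (exp (Re (m * (of_real s * v)))) + ln (norm z)"
      using that by (simp add: norm_mult ln_mult del: ln_exp)
    also have "ln (exp (Re (m * (of_real s * v)))) = s * Re (m * v)"
      unfolding ln_exp by (simp add: algebra_simps)
    finally show ?thesis .
  qed
  then show ?thesis using assms
    by (simp add: log_coord_def log_dir_def flow_def divide_simps mu lam) (simp add: algebra_simps)
qed

lemma log_coord_deriv:
  assumes "p \<in> off_axes"
  shows "((\<lambda>s::real. log_coord (flow mu lam (of_real s * v) p)) has_vector_derivative log_dir v) (at 0)"
proof -
  have "(\<lambda>s::real. log_coord (flow mu lam (of_real s * v) p)) = (\<lambda>s. log_coord p + s *\<^sub>R log_dir v)"
    using assms log_coord_flow by (auto simp: off_axes_def)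
  then show ?thesis by (auto intro!: derivative_eq_intros)
qed

lemma norm_log_coord:
  assumes "p \<in> off_axes"
  shows "norm (fst p) = exp (- norm mu * fst (log_coord p))" "norm (snd p) = exp (- norm lam * snd (log_coord p))"
  using assms mu lam by (auto simp: off_axes_def log_coord_def)

definition log_density :: "real \<times> real \<Rightarrow> real" where
  "log_density x = (norm mu)\<^sup>2 * exp (- 2 * norm mu * fst x) + (norm lam)\<^sup>2 * exp (- 2 * norm lam * snd x)"

lemma norm_square_log_coord:
  assumes "p \<in> off_axes"
  shows "(norm (fst p))\<^sup>2 = exp (- 2 * norm mu * fst (log_coord p))"
    "(norm (snd p))\<^sup>2 = exp (- 2 * norm lam * snd (log_coord p))"
  unfolding norm_log_coord[OF assms] by (simp_all add: power2_eq_square exp_add[symmetric])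

lemma leaf_density_eq: "p \<in> off_axes \<Longrightarrow> leaf_density p = log_density (log_coord p)"
  by (simp only: leaf_density_def log_density_def norm_mult power_mult_distrib norm_square_log_coord)

lemma log_density_pos: "log_density x > 0"
  using mu lam by (auto simp: log_density_def intro!: add_pos_pos)

text \<open>The preimage of the square [1, N] x [1, N], described by moduli so that its compactness
  in the whole space is visible without logarithms.\<close>

definition polyannulus :: "real \<Rightarrow> pt set" where
  "polyannulus N = {p. exp (- norm mu * N) \<le> norm (fst p) \<and> norm (fst p) \<le> exp (- norm mu) \<and>
     exp (- norm lam * N) \<le> norm (snd p) \<and> norm (snd p) \<le> exp (- norm lam)}"

lemma compact_polyannulus: "compact (polyannulus N)"
proof -
  have "closed (polyannulus N)"
    unfolding polyannulus_def by (intro closed_Collect_conj closed_Collect_le continuous_intros)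
  moreover have "polyannulus N \<subseteq> cball 0 (exp (- norm mu)) \<times> cball 0 (exp (- norm lam))"
    by (auto simp: polyannulus_def)
  then have "bounded (polyannulus N)"
    by (rule bounded_subset[rotated]) (intro bounded_Times bounded_cball)
  ultimately show ?thesis by (simp add: compact_eq_bounded_closed)
qed

lemma polyannulus_subset: "polyannulus N \<subseteq> off_axes"
proof
  fix p assume p: "p \<in> polyannulus N"
  have e: "exp (- norm mu) < 1" "exp (- norm lam) < 1" using mu lam by auto
  have "0 < norm (fst p)" "0 < norm (snd p)"
    using p exp_gt_zero[of "- norm mu * N"] exp_gt_zero[of "- norm lam * N"]
    unfolding polyannulus_def mem_Collect_eq by linarith+
  moreover have "norm (fst p) < 1" "norm (snd p) < 1"
    using p e unfolding polyannulus_def mem_Collect_eq by linarith+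
  ultimately show "p \<in> off_axes" by (cases p) (auto simp: off_axes_def)
qed

lemma corner_in_polyannulus:
  assumes "p \<in> off_axes" "log_coord p \<in> corner N"
  shows "p \<in> polyannulus N"
proof -
  have "1 \<le> fst (log_coord p)" "1 \<le> snd (log_coord p)" "fst (log_coord p) \<le> N" "snd (log_coord p) \<le> N"
    using assms(2) by (auto simp: corner_def)
  then show ?thesis
    unfolding polyannulus_def mem_Collect_eq norm_log_coord[OF assms(1)] using mu lam by (simp add: mult_left_mono)
qed

text \<open>For F supported in a corner this is a smooth extension by zero across the axes and the
  boundary of the bidisc.\<close>

definition lift :: "(real \<times> real \<Rightarrow> real) \<Rightarrow> pt \<Rightarrow> complex" where
  "lift F p = (if p \<in> off_axes then of_real (F (log_coord p)) else 0)"

lemma lift_outside: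
  assumes "\<And>x. x \<in> quadrant - corner N \<Longrightarrow> F x = 0" "p \<notin> polyannulus N"
  shows "lift F p = 0"
proof (cases "p \<in> off_axes")
  case True
  then have "log_coord p \<in> quadrant - corner N"
    using assms(2) corner_in_polyannulus log_coord_in_quadrant by blast
  from assms(1)[OF this] show ?thesis by (simp add: lift_def)
qed (simp add: lift_def)

lemma lift_test_function:
  assumes "smooth_on quadrant F" "\<And>x. x \<in> quadrant - corner N \<Longrightarrow> F x = 0"
  shows "lift F \<in> test_functions mu lam"
proof (rule test_functionsI[OF open_off_axes compact_polyannulus[of N] polyannulus_subset off_axes_subset])
  have "leaf_Ck off_axes k (\<lambda>p. of_real (F (log_coord p)))" for k
    by (rule leaf_Ck_compose_smooth[OF open_off_axes open_quadrant continuous_log_coord log_coord_in_quadrant log_coord_deriv])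
      (use assms(1) in \<open>auto simp: smooth_on_def simp del: Ck.simps\<close>)
  then have "leaf_Ck off_axes k (lift F)" for k
    using leaf_Ck_cong[OF open_off_axes, of "lift F" "\<lambda>p. of_real (F (log_coord p))" k] by (simp add: lift_def)
  then show "leaf_smooth_on off_axes (lift F)" by (simp add: leaf_smooth_on_def)
qed (rule lift_outside[OF assms(2)])

lemma lift_leaf_deriv:
  assumes "(F has_derivative (\<lambda>h. fst h * a + snd h * c)) (at (log_coord p))" "p \<in> off_axes"
  shows "has_leaf_deriv (lift F) (of_real (fst (log_dir v) * a + snd (log_dir v) * c)) v p"
proof -
  have "(F has_derivative (\<lambda>h. fst h * a + snd h * c)) (at (log_coord (flow mu lam (of_real 0 * v) p)))"
    using assms(1) by (simp add: flow_0)
  from vector_derivative_diff_chain_within[OF log_coord_deriv[OF assms(2), of v] has_derivative_at_withinI[OF this]]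
  have "((\<lambda>s::real. F (log_coord (flow mu lam (of_real s * v) p))) has_vector_derivative
      (fst (log_dir v) * a + snd (log_dir v) * c)) (at 0)"
    by (simp add: o_def)
  then have "has_leaf_deriv (\<lambda>p. of_real (F (log_coord p))) (of_real (fst (log_dir v) * a + snd (log_dir v) * c)) v p"
    unfolding has_leaf_deriv_def by (rule bounded_linear.has_vector_derivative[OF bounded_linear_of_real])
  then show ?thesis
    using has_leaf_deriv_cong[OF open_off_axes assms(2), of "lift F" "\<lambda>p. of_real (F (log_coord p))"] by (simp add: lift_def)
qed

lemma has_leaf_deriv_cmult: "has_leaf_deriv f D v p \<Longrightarrow> has_leaf_deriv (\<lambda>p. k * f p) (k * D) v p"
  using has_leaf_deriv_mult[OF has_leaf_deriv_const, of f D v p k] by simp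

text \<open>The Gram matrix of the gradients of u and v with respect to complex time: two unit
  vectors with inner product \<open>coupling\<close>. Its entries are the coefficients of the
  leafwise Laplacian.\<close>

lemma log_dir_sums:
  "(fst (log_dir 1))\<^sup>2 + (fst (log_dir \<i>))\<^sup>2 = 1" "(snd (log_dir 1))\<^sup>2 + (snd (log_dir \<i>))\<^sup>2 = 1"
  "fst (log_dir 1) * snd (log_dir 1) + fst (log_dir \<i>) * snd (log_dir \<i>) = coupling"
proof -
  have "(Re m)\<^sup>2 / (norm m)\<^sup>2 + (Im m)\<^sup>2 / (norm m)\<^sup>2 = 1" if "m \<noteq> 0" for m
    unfolding add_divide_distrib[symmetric] cmod_power2[symmetric] using that by simp
  then show "(fst (log_dir 1))\<^sup>2 + (fst (log_dir \<i>))\<^sup>2 = 1" "(snd (log_dir 1))\<^sup>2 + (snd (log_dir \<i>))\<^sup>2 = 1"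
    using mu lam by (simp_all add: log_dir_def power_divide)
  show "fst (log_dir 1) * snd (log_dir 1) + fst (log_dir \<i>) * snd (log_dir \<i>) = coupling"
    by (simp add: log_dir_def coupling_def add_divide_distrib)
qed

text \<open>The factor 1/4 is that of dt dtbar compared with the real Laplacian. The imaginary parts
  cancel because the mixed derivative is symmetric.\<close>

lemma lift_laplacian:
  assumes jet: "jet F Fu Fv Fuu Fuv Fvv" and p: "p \<in> off_axes"
  shows "leaf_dt mu lam (leaf_dtbar mu lam (lift F)) p =
    of_real ((Fuu (log_coord p) + 2 * coupling * Fuv (log_coord p) + Fvv (log_coord p)) / 4)"
proof -
  note d = jet[unfolded jet_def, rule_format, OF log_coord_in_quadrant]
  define a where "a v = fst (log_dir v)" for v
  define e where "e v = snd (log_dir v)" for v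
  have 1: "leaf_deriv mu lam v (lift F) q = of_real (a v) * lift Fu q + of_real (e v) * lift Fv q" if "q \<in> off_axes" for v q
    using has_leaf_deriv_imp[OF lift_leaf_deriv[OF conjunct1[OF d[OF that]] that, of v]] that by (simp add: a_def e_def lift_def)
  define A where "A = (of_real (a 1) + \<i> * of_real (a \<i>)) / 2"
  define E where "E = (of_real (e 1) + \<i> * of_real (e \<i>)) / 2"
  have 2: "leaf_dtbar mu lam (lift F) q = A * lift Fu q + E * lift Fv q" if "q \<in> off_axes" for q
    unfolding leaf_dtbar_def 1[OF that] A_def E_def by (simp add: field_simps)
  have 3: "leaf_deriv mu lam v (leaf_dtbar mu lam (lift F)) p =
     A * of_real (a v * Fuu (log_coord p) + e v * Fuv (log_coord p)) + E * of_real (a v * Fuv (log_coord p) + e v * Fvv (log_coord p))" for v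
  proof -
    have "leaf_deriv mu lam v (leaf_dtbar mu lam (lift F)) p = leaf_deriv mu lam v (\<lambda>q. A * lift Fu q + E * lift Fv q) p"
      by (rule leaf_deriv_cong[OF open_off_axes p 2])
    also have "\<dots> = A * of_real (a v * Fuu (log_coord p) + e v * Fuv (log_coord p)) + E * of_real (a v * Fuv (log_coord p) + e v * Fvv (log_coord p))"
      unfolding a_def e_def
      using d[OF p] by (intro has_leaf_deriv_imp has_leaf_deriv_add has_leaf_deriv_cmult lift_leaf_deriv p) auto
    finally show ?thesis .
  qed
  have "leaf_dt mu lam (leaf_dtbar mu lam (lift F)) p =
      of_real (((a 1)\<^sup>2 + (a \<i>)\<^sup>2) * Fuu (log_coord p) + 2 * (a 1 * e 1 + a \<i> * e \<i>) * Fuv (log_coord p)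
        + ((e 1)\<^sup>2 + (e \<i>)\<^sup>2) * Fvv (log_coord p)) / 4"
    unfolding leaf_dt_def 3 A_def E_def
    by (simp add: complex_eq_iff power2_eq_square) (simp add: field_simps)
  then show ?thesis
    using log_dir_sums by (simp add: a_def e_def)
qed

lemma lift_laplacian_outside:
  assumes "\<And>x. x \<in> quadrant - corner N \<Longrightarrow> F x = 0" "p \<notin> polyannulus N"
  shows "leaf_dt mu lam (leaf_dtbar mu lam (lift F)) p = 0"
proof -
  have op: "open (- polyannulus N)" using compact_polyannulus by (simp add: compact_imp_closed open_Compl)
  have z: "leaf_deriv mu lam v f q = 0" if "q \<in> - polyannulus N" "\<And>q. q \<in> - polyannulus N \<Longrightarrow> f q = 0" for v f q
    using leaf_deriv_cong[OF op that(1), of f "\<lambda>p. 0" v] that(2) has_leaf_deriv_imp[OF has_leaf_deriv_const[of 0 v q]] by simp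
  have "lift F q = 0" if "q \<in> - polyannulus N" for q
    by (rule lift_outside[of N F, OF assms(1)]) (use that in simp_all)
  then have "leaf_dtbar mu lam (lift F) q = 0" if "q \<in> - polyannulus N" for q
    using z[OF that, of "lift F"] by (simp add: leaf_dtbar_def)
  then show ?thesis
    using z[of p "leaf_dtbar mu lam (lift F)"] assms(2) by (simp add: leaf_dt_def)
qed

lemma smooth_log_density: "smooth_on quadrant log_density"
proof -
  have e: "smooth_on quadrant (\<lambda>x. exp (\<alpha> * fst x + \<beta> * snd x + 0))" for \<alpha> \<beta>
    by (rule smooth_on_exp[OF open_quadrant smooth_on_affine[OF open_quadrant]])
  show ?thesis
    using smooth_on_add[OF open_quadrant
        smooth_on_cmult[OF open_quadrant e[of "- 2 * norm mu" 0], of "(norm mu)\<^sup>2"]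
        smooth_on_cmult[OF open_quadrant e[of 0 "- 2 * norm lam"], of "(norm lam)\<^sup>2"]]
    by (simp add: log_density_def[abs_def])
qed

text \<open>The quotient is the function to be integrated in \<open>integral_lift_laplacian\<close>.
  It vanishes off the corner because the jet of F does, and it is smooth because the density is
  positive.\<close>

lemma laplacian_quotient:
  assumes F: "smooth_on quadrant F" "jet F Fu Fv Fuu Fuv Fvv" "\<And>x. x \<in> quadrant - corner N \<Longrightarrow> F x = 0"
  defines "G \<equiv> \<lambda>x. (Fuu x + 2 * coupling * Fuv x + Fvv x) / log_density x"
  shows "x \<in> quadrant - corner N \<Longrightarrow> G x = 0" "lift G \<in> test_functions mu lam"
proof -
  have W: "open (quadrant - corner N)" using closed_corner by (simp add: open_Diff)
  show G0: "G x = 0" if "x \<in> quadrant - corner N" for x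
    using jet_unique_zero[OF F(2) W _ F(3) that] by (simp add: G_def)
  note sm = jet_smooth[OF F(1,2)]
  have sN: "smooth_on quadrant (\<lambda>x. (Fuu x + (2 * coupling) * Fuv x) + Fvv x)"
    by (rule smooth_on_add[OF open_quadrant smooth_on_add[OF open_quadrant sm(3) smooth_on_cmult[OF open_quadrant sm(4)]] sm(5)])
  have "smooth_on quadrant G"
    unfolding G_def
    by (rule smooth_on_divide[OF open_quadrant _ sN smooth_log_density]) (metis log_density_pos less_irrefl)
  then show "lift G \<in> test_functions mu lam" by (rule lift_test_function[OF _ G0])
qed

text \<open>Multiplying i ddbar of the squared norm by the quotient cancels the leaf density and
  leaves i ddbar of the lift of 4 F, on which \<open>T\<close> vanishes; the 4 undoes the factor 1/4
  of \<open>lift_laplacian\<close>.\<close>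

lemma integral_lift_laplacian:
  assumes T: "harmonic_current mu lam T" and m: "mass_measure mu lam T bidisc (\<lambda>p. p) m"
    and F: "smooth_on quadrant F" "jet F Fu Fv Fuu Fuv Fvv" "\<And>x. x \<in> quadrant - corner N \<Longrightarrow> F x = 0"
  shows "(\<integral>p. lift (\<lambda>x. (Fuu x + 2 * coupling * Fuv x + Fvv x) / log_density x) p \<partial>m) = 0"
proof -
  define G where "G x = (Fuu x + 2 * coupling * Fuv x + Fvv x) / log_density x" for x
  have G0: "G x = 0" if "x \<in> quadrant - corner N" for x
    unfolding G_def by (rule laplacian_quotient(1)[OF F that])
  have tG: "lift G \<in> test_functions mu lam"
    unfolding G_def[abs_def] by (rule laplacian_quotient(2)[OF F])
  have eq: "lift G p * leaf_dt mu lam (leaf_dtbar mu lam (\<lambda>q. of_real ((norm q)\<^sup>2))) p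
      = 4 * leaf_dt mu lam (leaf_dtbar mu lam (lift F)) p" for p
  proof (cases "p \<in> polyannulus N")
    case True
    then have p: "p \<in> off_axes" using polyannulus_subset by blast
    show ?thesis
      unfolding lift_laplacian[OF F(2) p] leaf_laplacian_norm_id leaf_density_eq[OF p]
      using p log_density_pos[of "log_coord p"] by (simp add: lift_def G_def)
  next
    case False
    then show ?thesis
      using lift_outside[of N G, OF G0] lift_laplacian_outside[of N F, OF F(3)] by simp
  qed
  have "(\<integral>p. lift G p \<partial>m) = T (\<lambda>p a b. lift G p * i_ddbar mu lam (\<lambda>q. of_real ((norm q)\<^sup>2)) p a b)"
  proof -
    have "closure {p. lift G p \<noteq> 0} \<subseteq> bidisc" using tG by (auto simp: test_functions_def)
    then show ?thesis using m tG unfolding mass_measure_def by blast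
  qed
  also have "(\<lambda>p a b. lift G p * i_ddbar mu lam (\<lambda>q. of_real ((norm q)\<^sup>2)) p a b)
      = i_ddbar mu lam (lift (\<lambda>x. 4 * F x))"
  \<comment> \<open>\<open>T\<close> is merely a function on forms, so the two forms have to
    coincide everywhere; off the polyannulus both are 0.\<close>
  proof (intro ext)
    fix p a b
    show "lift G p * i_ddbar mu lam (\<lambda>q. of_real ((norm q)\<^sup>2)) p a b = i_ddbar mu lam (lift (\<lambda>x. 4 * F x)) p a b"
    proof -
      have j4: "jet (\<lambda>x. 4 * F x) (\<lambda>x. 4 * Fu x) (\<lambda>x. 4 * Fv x) (\<lambda>x. 4 * Fuu x) (\<lambda>x. 4 * Fuv x) (\<lambda>x. 4 * Fvv x)"
        using jet_mult[OF jet_affine[of 0 0 4] F(2)] by simp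
      have "leaf_dt mu lam (leaf_dtbar mu lam (lift (\<lambda>x. 4 * F x))) p = 4 * leaf_dt mu lam (leaf_dtbar mu lam (lift F)) p"
      proof (cases "p \<in> polyannulus N")
        case True
        then have p: "p \<in> off_axes" using polyannulus_subset by blast
        show ?thesis unfolding lift_laplacian[OF F(2) p] lift_laplacian[OF j4 p] by simp
      next
        case False
        then show ?thesis
          using lift_laplacian_outside[of N F, OF F(3)] lift_laplacian_outside[of N "\<lambda>x. 4 * F x"] F(3) by simp
      qed
      then show ?thesis unfolding i_ddbar_def using eq[of p] by (simp add: mult.assoc[symmetric])
    qed
  qed
  also have "T \<dots> = 0"
  proof -
    have "lift (\<lambda>x. 4 * F x) \<in> test_functions mu lam"
      by (rule lift_test_function[OF smooth_on_cmult[OF open_quadrant F(1)]]) (use F(3) in simp)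
    then show ?thesis using T unfolding harmonic_current_def by blast
  qed
  finally show ?thesis unfolding G_def[abs_def] .
qed

section \<open>The pushed-forward measure and the mass of small balls\<close>

lemma borel_measurable_pt [measurable]:
  "(fst :: pt \<Rightarrow> complex) \<in> borel_measurable borel" "(snd :: pt \<Rightarrow> complex) \<in> borel_measurable borel"
  by (auto intro!: borel_measurable_continuous_onI continuous_on_fst continuous_on_snd)

lemma measurable_log_coord [measurable]: "log_coord \<in> borel_measurable borel"
  unfolding log_coord_def[abs_def] by (intro borel_measurable_Pair) measurable

lemma measurable_leaf_density [measurable]: "leaf_density \<in> borel_measurable borel"
  unfolding leaf_density_def[abs_def] by measurable

lemma sets_off_axes [measurable]: "off_axes \<in> sets borel"
  by (rule borel_open[OF open_off_axes])

text \<open>The measure m divided by the leaf density represents the current in flow time; its image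
  under \<open>log_coord\<close> satisfies the assumptions of \<open>weakly_harmonic\<close>. A ball
  becomes a sublevel set of a sum of two exponentials, with m recovered as the density times this
  image.\<close>

lemma ball_mass_bound:
  assumes T: "harmonic_current mu lam T" and m: "mass_measure mu lam T bidisc (\<lambda>p. p) m"
    and AE: "AE p in m. p \<in> off_axes" and \<epsilon>: "\<epsilon> > 0"
  shows "\<exists>\<rho>0>0. \<forall>\<rho>. 0 < \<rho> \<and> \<rho> < \<rho>0 \<longrightarrow> emeasure m {p. (norm p)\<^sup>2 < \<rho>} \<le> ennreal (\<epsilon> * \<rho>)"
proof -
  have sets_m [simp, measurable_cong]: "sets m = sets borel" using m by (simp add: mass_measure_def)
  have fin: "emeasure m K < \<infinity>" if "compact K" "K \<subseteq> punctured_bidisc" for K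
    using m that by (simp add: mass_measure_def)
  define D where "D p = 1 / leaf_density p" for p
  have D_meas [measurable]: "D \<in> borel_measurable borel" unfolding D_def[abs_def] by measurable
  have ld_nn: "leaf_density p \<ge> 0" for p by (simp add: leaf_density_def)
  have D_nn: "D p \<ge> 0" for p using ld_nn by (simp add: D_def)
  define \<Lambda> where "\<Lambda> = distr (density m (\<lambda>p. ennreal (D p))) borel log_coord"
  have nn: "(\<integral>\<^sup>+x. f x \<partial>\<Lambda>) = (\<integral>\<^sup>+p. ennreal (D p) * f (log_coord p) \<partial>m)" if [measurable]: "f \<in> borel_measurable borel" for f
    unfolding \<Lambda>_def by (simp add: nn_integral_distr nn_integral_density)
  interpret weakly_harmonic \<Lambda> coupling
  proof
    show "sets \<Lambda> = sets borel" by (simp add: \<Lambda>_def)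
    show "\<bar>coupling\<bar> < 1" by (rule coupling_less_1)
    show "emeasure \<Lambda> (strip w 0) < \<infinity>" for w
    proof -
      \<comment> \<open>Off the axes this contains the preimage of the strip; parts of the
        separatrices close it up. As a compact subset of the punctured bidisc it has finite mass,
        and since one of the moduli is bounded below on it, so is the leaf density.\<close>
      define K :: "pt set" where "K = {p. norm (fst p) \<le> exp (- norm mu) \<and> norm (snd p) \<le> exp (- norm lam) \<and>
        (exp (- norm mu * w) \<le> norm (fst p) \<or> exp (- norm lam * w) \<le> norm (snd p))}"
      have "closed K" unfolding K_def
        by (intro closed_Collect_conj closed_Collect_disj closed_Collect_le continuous_intros)
      moreover have "K \<subseteq> cball 0 (exp (- norm mu)) \<times> cball 0 (exp (- norm lam))"
        by (auto simp: K_def)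
      then have "bounded K" by (rule bounded_subset[rotated]) (intro bounded_Times bounded_cball)
      ultimately have K: "compact K" by (simp add: compact_eq_bounded_closed)
      have K_sub: "K \<subseteq> punctured_bidisc"
      proof
        fix p assume p: "p \<in> K"
        have "exp (- norm mu) < 1" "exp (- norm lam) < 1" using mu lam by auto
        then have "norm (fst p) < 1" "norm (snd p) < 1" using p unfolding K_def mem_Collect_eq by linarith+
        moreover have "p \<noteq> 0" using p exp_gt_zero[of "- norm mu * w"] exp_gt_zero[of "- norm lam * w"]
          unfolding K_def mem_Collect_eq by (auto simp: not_le[symmetric] simp del: exp_gt_zero)
        ultimately show "p \<in> punctured_bidisc" by (cases p) auto
      qed
      define \<kappa> where "\<kappa> = min ((norm mu * exp (- norm mu * w))\<^sup>2) ((norm lam * exp (- norm lam * w))\<^sup>2)"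
      have \<kappa>: "\<kappa> > 0" using mu lam by (simp add: \<kappa>_def)
      have dens: "\<kappa> \<le> leaf_density p" if "p \<in> K" for p
      proof -
        have "(norm mu * exp (- norm mu * w))\<^sup>2 \<le> (norm (mu * fst p))\<^sup>2 \<or> (norm lam * exp (- norm lam * w))\<^sup>2 \<le> (norm (lam * snd p))\<^sup>2"
          using that by (auto simp: K_def norm_mult intro!: power_mono mult_left_mono)
        then show ?thesis unfolding leaf_density_def \<kappa>_def
          by (smt (verit) zero_le_power2)
      qed
      have "emeasure \<Lambda> (strip w 0) = (\<integral>\<^sup>+x. indicator (strip w 0) x \<partial>\<Lambda>)"
        by (simp add: \<Lambda>_def)
      also have "\<dots> = (\<integral>\<^sup>+p. ennreal (D p) * indicator (strip w 0) (log_coord p) \<partial>m)"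
        by (rule nn) simp
      also have "\<dots> \<le> (\<integral>\<^sup>+p. ennreal (1 / \<kappa>) * indicator K p \<partial>m)"
      proof (rule nn_integral_mono_AE)
        show "AE p in m. ennreal (D p) * indicator (strip w 0) (log_coord p) \<le> ennreal (1 / \<kappa>) * indicator K p"
          using AE
        proof eventually_elim
          case (elim p)
          show ?case
          proof (cases "log_coord p \<in> strip w 0")
            case True
            then have c: "1 \<le> fst (log_coord p)" "1 \<le> snd (log_coord p)" "fst (log_coord p) \<le> w \<or> snd (log_coord p) \<le> w"
              by (auto simp: strip_def)
            have "p \<in> K"
              unfolding K_def mem_Collect_eq norm_log_coord[OF elim] using c mu lam by (auto simp: mult_left_mono)
            moreover from dens[OF this] have "D p \<le> 1 / \<kappa>" using \<kappa> by (simp add: D_def frac_le)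
            ultimately show ?thesis using True by (simp add: ennreal_leI)
          qed simp
        qed
      qed
      also have "\<dots> = ennreal (1 / \<kappa>) * emeasure m K"
        using K by (simp add: nn_integral_cmult_indicator borel_closed compact_imp_closed)
      also have "\<dots> < \<infinity>" using fin[OF K K_sub] by (simp add: ennreal_mult_less_top)
      finally show ?thesis .
    qed
    show "(LINT p:corner N|\<Lambda>. Fuu p + 2 * coupling * Fuv p + Fvv p) = 0"
      if F: "smooth_on quadrant F" "jet F Fu Fv Fuu Fuv Fvv" "\<And>p. p \<in> quadrant - corner N \<Longrightarrow> F p = 0"
      for F Fu Fv Fuu Fuv Fvv N
    proof -
      \<comment> \<open>The indicator belongs to \<open>H\<close> because the derivatives are
        continuous on the quadrant only, while measurability is needed on the whole plane.\<close>
      define H where "H x = indicator (corner N) x * (Fuu x + 2 * coupling * Fuv x + Fvv x)" for x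
      let ?G = "\<lambda>x. (Fuu x + 2 * coupling * Fuv x + Fvv x) / log_density x"
      have z: "?G x = 0" if "x \<in> quadrant - corner N" for x
        by (rule laplacian_quotient(1)[OF F that])
      have l: "continuous_on UNIV (lift ?G)"
        by (rule test_functionsD(2)[OF laplacian_quotient(2)[OF F]])
      have "continuous_on quadrant (\<lambda>x. Fuu x + 2 * coupling * Fuv x + Fvv x)"
        by (intro continuous_intros jet_smooth[OF F(1,2), THEN smooth_on_imp_continuous_on])
      then have "continuous_on (corner N) (\<lambda>x. Fuu x + 2 * coupling * Fuv x + Fvv x)"
        using corner_subset by (rule continuous_on_subset)
      from borel_measurable_continuous_on_indicator[OF borel_closed[OF closed_corner] this]
      have H_meas [measurable]: "H \<in> borel_measurable borel"
        by (simp only: H_def[abs_def] real_scaleR_def)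
      have "(LINT p:corner N|\<Lambda>. Fuu p + 2 * coupling * Fuv p + Fvv p) = (\<integral>x. H x \<partial>\<Lambda>)"
        by (simp add: set_lebesgue_integral_def H_def)
      also have "\<dots> = (\<integral>p. H (log_coord p) \<partial>density m (\<lambda>p. ennreal (D p)))"
        unfolding \<Lambda>_def by (rule integral_distr) auto
      also have "\<dots> = (\<integral>p. D p *\<^sub>R H (log_coord p) \<partial>m)"
        by (rule integral_density) (auto simp: D_nn)
      finally have 1: "(LINT p:corner N|\<Lambda>. Fuu p + 2 * coupling * Fuv p + Fvv p) = (\<integral>p. D p *\<^sub>R H (log_coord p) \<partial>m)" .
      have "complex_of_real (\<integral>p. D p *\<^sub>R H (log_coord p) \<partial>m) = (\<integral>p. complex_of_real (D p *\<^sub>R H (log_coord p)) \<partial>m)"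
        by (rule integral_complex_of_real[symmetric])
      also have "\<dots> = (\<integral>p. lift ?G p \<partial>m)"
      proof (rule integral_cong_AE)
        show "AE p in m. complex_of_real (D p *\<^sub>R H (log_coord p)) = lift ?G p"
          using AE
        proof eventually_elim
          case (elim p)
          show ?case
          proof (cases "log_coord p \<in> corner N")
            case True
            then show ?thesis using elim by (simp add: lift_def D_def H_def leaf_density_eq)
          next
            case False
            then have "?G (log_coord p) = 0" using z log_coord_in_quadrant[OF elim] by blast
            then have "lift ?G p = 0" using elim by (simp only: lift_def of_real_0 if_True)
            then show ?thesis using False by (simp add: H_def)
          qed
        qed
        show "lift ?G \<in> borel_measurable m"
          using borel_measurable_continuous_onI[OF l] by (simp cong: measurable_cong_sets)
      qed simp
      also have "\<dots> = 0" by (rule integral_lift_laplacian[OF T m F])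
      finally show ?thesis using 1 by simp
    qed
  qed
  from ball_mass_vanishes[of "norm mu" "norm lam" \<epsilon>] mu lam \<epsilon>
  obtain \<rho>0 where \<rho>0: "\<rho>0 > 0" and est: "\<And>\<rho> n0. 0 < \<rho> \<Longrightarrow> \<rho> < \<rho>0 \<Longrightarrow>
    (\<integral>\<^sup>+x\<in>{x. exp (- 2 * norm mu * fst x) + exp (- 2 * norm lam * snd x) < \<rho> \<and> fst x + snd x \<le> n0}. ennreal (log_density x) \<partial>\<Lambda>) \<le> ennreal (\<epsilon> * \<rho>)"
    unfolding log_density_def by auto
  have "emeasure m {p. (norm p)\<^sup>2 < \<rho>} \<le> ennreal (\<epsilon> * \<rho>)" if \<rho>: "0 < \<rho>" "\<rho> < \<rho>0" for \<rho>
  proof -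
    \<comment> \<open>Truncation at u + v \<le> n, where the estimate is available. Up to a null set
      these sets exhaust the ball, and the bound is uniform in n.\<close>
    define A where "A n = {p \<in> off_axes. (norm p)\<^sup>2 < \<rho> \<and> fst (log_coord p) + snd (log_coord p) \<le> real n}" for n :: nat
    have sum_meas: "(\<lambda>p. fst (log_coord p) + snd (log_coord p)) \<in> borel_measurable borel"
      unfolding log_coord_def by simp
    have A_sets: "A n \<in> sets m" for n
    proof -
      have "A n = off_axes \<inter> {p. (norm p)\<^sup>2 < \<rho>} \<inter> {p \<in> space borel. fst (log_coord p) + snd (log_coord p) \<le> real n}"
        by (auto simp: A_def)
      moreover have "open {p :: pt. (norm p)\<^sup>2 < \<rho>}" by (intro open_Collect_less continuous_intros)
      moreover have "{p \<in> space borel. fst (log_coord p) + snd (log_coord p) \<le> real n} \<in> sets borel"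
        using sum_meas by (rule borel_measurable_le[OF _ borel_measurable_const])
      ultimately show ?thesis using sets_off_axes by (simp add: sets.Int borel_open)
    qed
    have "emeasure m (A n) \<le> ennreal (\<epsilon> * \<rho>)" for n
    proof -
      let ?E = "{x. exp (- 2 * norm mu * fst x) + exp (- 2 * norm lam * snd x) < \<rho> \<and> fst x + snd x \<le> real n}"
      have E [measurable]: "?E \<in> sets borel" by (rule sets_exp_sublevel)
      have "continuous_on UNIV log_density" unfolding log_density_def[abs_def] by (intro continuous_intros)
      then have ld [measurable]: "log_density \<in> borel_measurable borel" by (rule borel_measurable_continuous_onI)
      have "emeasure m (A n) = (\<integral>\<^sup>+p. indicator (A n) p \<partial>m)" using A_sets by simp
      also have "\<dots> \<le> (\<integral>\<^sup>+p. ennreal (D p) * (ennreal (log_density (log_coord p)) * indicator ?E (log_coord p)) \<partial>m)"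
      proof (rule nn_integral_mono)
        fix p
        show "indicator (A n) p \<le> ennreal (D p) * (ennreal (log_density (log_coord p)) * indicator ?E (log_coord p))"
        proof (cases "p \<in> A n")
          case True
          then have p: "p \<in> off_axes" by (simp add: A_def)
          have "(norm p)\<^sup>2 = (norm (fst p))\<^sup>2 + (norm (snd p))\<^sup>2" by (simp add: norm_prod_def)
          also have "\<dots> = exp (- 2 * norm mu * fst (log_coord p)) + exp (- 2 * norm lam * snd (log_coord p))"
            by (simp only: norm_square_log_coord[OF p])
          finally have "log_coord p \<in> ?E" using True by (simp add: A_def)
          moreover have "ennreal (D p) * ennreal (log_density (log_coord p)) = 1"
            using log_density_pos[of "log_coord p"] by (simp add: D_def leaf_density_eq[OF p] ennreal_mult[symmetric])
          ultimately show ?thesis using True by simp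
        qed simp
      qed
      also have "\<dots> = (\<integral>\<^sup>+x\<in>?E. ennreal (log_density x) \<partial>\<Lambda>)"
        by (rule nn[symmetric]) measurable
      also have "\<dots> \<le> ennreal (\<epsilon> * \<rho>)" by (rule est[OF \<rho>])
      finally show ?thesis .
    qed
    note A_le = this
    have inc: "incseq A" by (intro incseq_SucI) (auto simp: A_def)
    have "emeasure m (\<Union>n. A n) = (SUP n. emeasure m (A n))"
      by (rule SUP_emeasure_incseq[symmetric]) (use A_sets inc in auto)
    also have "\<dots> \<le> ennreal (\<epsilon> * \<rho>)" by (rule SUP_least) (rule A_le)
    finally have le: "emeasure m (\<Union>n. A n) \<le> ennreal (\<epsilon> * \<rho>)" .
    have "emeasure m {p. (norm p)\<^sup>2 < \<rho>} \<le> emeasure m (\<Union>n. A n)"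
    proof (rule emeasure_mono_AE)
      show "AE p in m. p \<in> {p. (norm p)\<^sup>2 < \<rho>} \<longrightarrow> p \<in> (\<Union>n. A n)"
        using AE
      proof eventually_elim
        case (elim p)
        obtain n where "fst (log_coord p) + snd (log_coord p) \<le> real n" using real_arch_simple by blast
        then show ?case using elim by (auto simp: A_def)
      qed
      show "(\<Union>n. A n) \<in> sets m" using A_sets by blast
    qed
    then show ?thesis using le by (rule order_trans)
  qed
  then show ?thesis using \<rho>0 by blast
qed

end

section \<open>Mass measures in arbitrary coordinates\<close>

context linear_flow
begin

lemma leaf_Ck_norm_square:
  assumes "open U" "leaf_Ck U k f"
  shows "leaf_Ck U k (\<lambda>p. of_real ((norm (f p))\<^sup>2))"
  using leaf_Ck_mult[OF assms leaf_Ck_cnj[OF assms]] by (simp only: complex_norm_square)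

lemma leaf_Ck_compose_affine_norm:
  assumes "smooth_on UNIV A" "leaf_Ck UNIV k f"
  shows "leaf_Ck UNIV k (\<lambda>p. of_real (A (\<alpha> * (norm (f p))\<^sup>2 + \<beta>)))"
proof -
  have "smooth_on UNIV (\<lambda>x. A (\<alpha> * x + \<beta>))"
    by (rule smooth_on_compose_UNIV[OF open_UNIV assms(1)])
      (rule smooth_on_add[OF open_UNIV smooth_on_cmult[OF open_UNIV smooth_on_id[OF open_UNIV]] smooth_on_const[OF open_UNIV]])
  then have "Ck UNIV k (\<lambda>x. A (\<alpha> * x + \<beta>))" unfolding smooth_on_def by blast
  from leaf_Ck_compose_real[OF open_UNIV open_UNIV UNIV_I leaf_Ck_norm_square[OF open_UNIV assms(2)] this]
  show ?thesis .
qed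

lemma mass_measure_integral_eq:
  assumes "mass_measure mu lam T bidisc (\<lambda>p. p) m1" "mass_measure mu lam T bidisc (\<lambda>p. p) m2"
    and "\<phi> \<in> test_functions mu lam"
  shows "(\<integral>p. \<phi> p \<partial>m1) = (\<integral>p. \<phi> p \<partial>m2)"
proof -
  have cl: "closure {p. \<phi> p \<noteq> 0} \<subseteq> bidisc" using assms(3) by (auto simp: test_functions_def)
  have "(\<integral>p. \<phi> p \<partial>m) = T (\<lambda>p a b. \<phi> p * i_ddbar mu lam (\<lambda>q. of_real ((norm q)\<^sup>2)) p a b)"
    if "mass_measure mu lam T bidisc (\<lambda>p. p) m" for m
    using that assms(3) cl unfolding mass_measure_def by blast
  from this[OF assms(1)] this[OF assms(2)] show ?thesis by simp
qed

text \<open>Compares the two measures by testing against functions decreasing to the indicator of an annulus in the axis.\<close>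

lemma axis_null_transfer:
  assumes m1: "mass_measure mu lam T bidisc (\<lambda>p. p) m1" and m2: "mass_measure mu lam T bidisc (\<lambda>p. p) m2"
    and null: "emeasure m2 ({p \<in> bidisc. snd p = 0} - {0}) = 0"
  shows "emeasure m1 ({p \<in> bidisc. snd p = 0} - {0}) = 0"
proof -
  obtain A A' A'' B c where "step_and_ramp A A' A'' B c" using exists_step_and_ramp by blast
  then interpret step_and_ramp A A' A'' B c .
  have sets1: "sets m1 = sets borel" and sets2: "sets m2 = sets borel"
    using m1 m2 by (simp_all add: mass_measure_def)
  define S where "S = ({p \<in> bidisc. snd p = 0} - {0} :: pt set)"
  \<comment> \<open>The summand 3 makes the inner radius less than 1/2, hence less than the outer
    radius.\<close>
  define Kj where "Kj j = {p :: pt. snd p = 0 \<and> 1 / real (j + 3) \<le> norm (fst p) \<and> norm (fst p) \<le> 1 - 1 / real (j + 3)}" for j :: nat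
  have closed_Kj: "closed (Kj j)" for j
    unfolding Kj_def by (intro closed_Collect_conj closed_Collect_le closed_Collect_eq continuous_intros)
  have zero: "emeasure m1 (Kj j) = 0" for j
  proof -
    define a where "a = 1 / real (j + 3)"
    have a: "0 < a" "a < 1 / 2" by (auto simp: a_def field_simps)
    define b where "b = 1 - a"
    define a' where "a' = a / 2"
    define b' where "b' = 1 - a / 2"
    have ab: "0 < a'" "a' < a" "a < b" "b < b'" "b' < 1" using a by (auto simp: a'_def b_def b'_def)
    have sq: "a'\<^sup>2 < a\<^sup>2" "b\<^sup>2 < b'\<^sup>2" using ab by (auto intro!: power_strict_mono)
    define K where "K = {p :: pt. a' \<le> norm (fst p) \<and> norm (fst p) \<le> b' \<and> norm (snd p) \<le> 1 / 2}"
    have "closed K" unfolding K_def by (intro closed_Collect_conj closed_Collect_le continuous_intros)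
    moreover have "K \<subseteq> cball 0 b' \<times> cball 0 (1 / 2)" by (auto simp: K_def)
    then have "bounded K" by (rule bounded_subset[rotated]) (intro bounded_Times bounded_cball)
    ultimately have K: "compact K" by (simp add: compact_eq_bounded_closed)
    have K_sub: "K \<subseteq> punctured_bidisc" using ab by (auto simp: K_def)
    define k1 where "k1 = 1 / (a\<^sup>2 - a'\<^sup>2)"
    define k2 where "k2 = 1 / (b'\<^sup>2 - b\<^sup>2)"
    have k: "k1 > 0" "k2 > 0" using sq by (auto simp: k1_def k2_def)
    define g where "g x = A (k1 * x + (- k1 * a'\<^sup>2)) * (1 - A (k2 * x + (- k2 * b\<^sup>2)))" for x
    \<comment> \<open>The function is 1 on \<open>Kj j\<close>. Its last factor vanishes once |w|^2
      \<ge> 1 / (n + 4): as n + 4 \<ge> 4 the support stays in |w| \<le> 1/2, and off the axis the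
      functions tend to 0. Squared moduli keep everything smooth.\<close>
    define \<psi> where "\<psi> n p = g ((norm (fst p))\<^sup>2) * (1 - A (real (n + 4) * (norm (snd p))\<^sup>2 + 0))" for n and p :: pt
    have g01: "0 \<le> g x" "g x \<le> 1" for x
      using A_ge A_le by (auto simp: g_def intro!: mult_nonneg_nonneg mult_le_one)
    have \<psi>01: "0 \<le> \<psi> n p" "\<psi> n p \<le> 1" for n p
      using A_ge A_le g01 unfolding \<psi>_def by (auto intro!: mult_nonneg_nonneg mult_le_one)
    have \<psi>0: "\<psi> n p = 0" if outside: "p \<notin> K" for n p
    proof -
      consider "norm (fst p) < a'" | "norm (fst p) > b'" | "norm (snd p) > 1 / 2" using outside unfolding K_def mem_Collect_eq by linarith
      then show ?thesis
      proof cases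
        case 1
        then have "(norm (fst p))\<^sup>2 \<le> a'\<^sup>2" using ab by (intro power_mono) auto
        then have "k1 * (norm (fst p))\<^sup>2 \<le> k1 * a'\<^sup>2" using k by (intro mult_left_mono) auto
        then show ?thesis by (simp add: \<psi>_def g_def A_0)
      next
        case 2
        then have "b'\<^sup>2 \<le> (norm (fst p))\<^sup>2" using ab by (intro power_mono) auto
        then have "k2 * (b'\<^sup>2 - b\<^sup>2) \<le> k2 * ((norm (fst p))\<^sup>2 - b\<^sup>2)" using k by (intro mult_left_mono) auto
        moreover have "k2 * (b'\<^sup>2 - b\<^sup>2) = 1" using sq by (simp add: k2_def)
        ultimately have "1 \<le> k2 * (norm (fst p))\<^sup>2 + (- k2 * b\<^sup>2)" by (simp add: algebra_simps)
        then show ?thesis by (simp add: \<psi>_def g_def A_1)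
      next
        case 3
        then have "(1 / 2)\<^sup>2 \<le> (norm (snd p))\<^sup>2" by (intro power_mono) auto
        then have "4 * (1 / 4) \<le> real (n + 4) * (norm (snd p))\<^sup>2" by (intro mult_mono) (auto simp: power2_eq_square)
        then show ?thesis by (simp add: \<psi>_def A_1)
      qed
    qed
    have \<psi>1: "\<psi> n p = 1" if "p \<in> Kj j" for n p
    proof -
      have p: "snd p = 0" "a \<le> norm (fst p)" "norm (fst p) \<le> b" using that by (auto simp: Kj_def a_def b_def)
      have "a\<^sup>2 \<le> (norm (fst p))\<^sup>2" "(norm (fst p))\<^sup>2 \<le> b\<^sup>2" using p ab by (auto intro!: power_mono)
      then have "k1 * (a\<^sup>2 - a'\<^sup>2) \<le> k1 * ((norm (fst p))\<^sup>2 - a'\<^sup>2)" "k2 * (norm (fst p))\<^sup>2 \<le> k2 * b\<^sup>2"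
        using k by (auto intro!: mult_left_mono)
      moreover have "k1 * (a\<^sup>2 - a'\<^sup>2) = 1" using sq by (simp add: k1_def)
      ultimately have "1 \<le> k1 * (norm (fst p))\<^sup>2 + (- k1 * a'\<^sup>2)" "k2 * (norm (fst p))\<^sup>2 + (- k2 * b\<^sup>2) \<le> 0"
        by (simp_all add: algebra_simps)
      then show ?thesis using p by (simp add: \<psi>_def g_def A_1 A_0)
    qed
    have test: "(\<lambda>p. complex_of_real (\<psi> n p)) \<in> test_functions mu lam" for n
    proof (rule test_functionsI[OF open_punctured_bidisc K K_sub subset_refl])
      have "leaf_Ck UNIV k (\<lambda>p. complex_of_real (\<psi> n p))" for k
      proof -
        note fs = leaf_Ck_compose_affine_norm[OF smooth_A leaf_Ck_fst[OF open_UNIV, of k]]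
        note ss = leaf_Ck_compose_affine_norm[OF smooth_A leaf_Ck_snd[OF open_UNIV, of k]]
        have neg: "leaf_Ck UNIV k (\<lambda>p. 1 + (-1) * f p)" if "leaf_Ck UNIV k f" for f
          by (rule leaf_Ck_add[OF open_UNIV leaf_Ck_const[OF open_UNIV] leaf_Ck_mult[OF open_UNIV leaf_Ck_const[OF open_UNIV] that]])
        from leaf_Ck_mult[OF open_UNIV leaf_Ck_mult[OF open_UNIV fs[of k1 "- k1 * a'\<^sup>2"] neg[OF fs[of k2 "- k2 * b\<^sup>2"]]] neg[OF ss[of "real (n + 4)" 0]]]
        show ?thesis by (simp add: \<psi>_def[abs_def] g_def)
      qed
      then show "leaf_smooth_on punctured_bidisc (\<lambda>p. complex_of_real (\<psi> n p))"
        unfolding leaf_smooth_on_def using leaf_Ck_subset by blast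
    qed (simp add: \<psi>0)
    have cont: "continuous_on UNIV (\<psi> n)" for n
      using continuous_on_Re[OF test_functionsD(2)[OF test[of n]]] by simp
    have meas: "\<psi> n \<in> borel_measurable m1" "\<psi> n \<in> borel_measurable m2" for n
      using borel_measurable_continuous_onI[OF cont[of n]] sets1 sets2 by (simp_all cong: measurable_cong_sets)
    have fin: "emeasure m1 K < \<infinity>" "emeasure m2 K < \<infinity>"
      using m1 m2 K K_sub by (simp_all add: mass_measure_def)
    have Ks: "K \<in> sets m1" "K \<in> sets m2" using K sets1 sets2 by (auto intro: borel_closed compact_imp_closed)
    have int_eq: "(\<integral>p. \<psi> n p \<partial>m1) = (\<integral>p. \<psi> n p \<partial>m2)" for n
      using mass_measure_integral_eq[OF m1 m2 test[of n]] by (simp only: integral_complex_of_real of_real_eq_iff)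
    have "Kj j = {p. snd p = 0 \<and> a \<le> norm (fst p) \<and> norm (fst p) \<le> b}"
      by (simp only: Kj_def a_def b_def)
    then have KjK: "Kj j \<subseteq> K" using ab by (auto simp: K_def)
    have Kjs: "Kj j \<in> sets m1" using closed_Kj sets1 by (auto intro: borel_closed)
    have finKj: "emeasure m1 (Kj j) < \<infinity>"
      using emeasure_mono[OF KjK Ks(1)] fin(1) by (rule le_less_trans)
    have le: "measure m1 (Kj j) \<le> (\<integral>p. \<psi> n p \<partial>m2)" for n
    proof -
      have "measure m1 (Kj j) = (\<integral>p. indicator (Kj j) p \<partial>m1)" using Kjs finKj by simp
      also have "\<dots> \<le> (\<integral>p. \<psi> n p \<partial>m1)"
      proof (rule integral_mono)
        show "integrable m1 (\<psi> n)"
          by (rule integrableI_bounded_set[where A = K and B = 1]) (use Ks fin meas \<psi>01 \<psi>0 in auto)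
        show "indicator (Kj j) p \<le> \<psi> n p" for p using \<psi>1[of p n] \<psi>01[of n p] by (cases "p \<in> Kj j") auto
      qed (use Kjs finKj in simp)
      finally show ?thesis using int_eq by simp
    qed
    \<comment> \<open>On the part of the axis inside \<open>K\<close> the functions need not tend to
      0, but this part is null for \<open>m2\<close>.\<close>
    have "(\<lambda>n. \<integral>p. \<psi> n p \<partial>m2) \<longlonglongrightarrow> (\<integral>p. 0 \<partial>m2)"
    proof (rule integral_dominated_convergence[where w = "indicator K"])
      show "integrable m2 (indicator K :: pt \<Rightarrow> real)" using Ks fin by simp
      show "AE p in m2. norm (\<psi> n p) \<le> indicator K p" for n
        using \<psi>01 \<psi>0 by (auto simp: indicator_def)
      have "S \<in> sets m2"
      proof -
        have "S = punctured_bidisc \<inter> {p. snd p = 0}" by (auto simp: S_def)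
        moreover have "closed {p :: pt. snd p = 0}" by (intro closed_Collect_eq continuous_intros)
        ultimately show ?thesis using open_punctured_bidisc sets2 by (simp add: sets.Int borel_open borel_closed)
      qed
      then have "AE p in m2. p \<notin> S" using null unfolding S_def[symmetric] by (intro AE_not_in) (simp add: null_sets_def)
      then show "AE p in m2. (\<lambda>n. \<psi> n p) \<longlonglongrightarrow> 0"
      proof eventually_elim
        case (elim p)
        show ?case
        proof (cases "p \<in> K")
          case True
          then have "snd p \<noteq> 0" using elim K_sub by (auto simp: S_def)
          then have w: "(norm (snd p))\<^sup>2 > 0" by simp
          obtain n0 :: nat where n0: "real n0 > 1 / (norm (snd p))\<^sup>2" using reals_Archimedean2 by blast
          have "\<psi> n p = 0" if "n \<ge> n0" for n
          proof -
            have "1 / (norm (snd p))\<^sup>2 \<le> real (n + 4)" using n0 that by simp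
            then have "1 \<le> real (n + 4) * (norm (snd p))\<^sup>2" using w by (simp add: field_simps)
            then show ?thesis by (simp add: \<psi>_def A_1)
          qed
          then have "\<forall>\<^sub>F n in sequentially. \<psi> n p = 0" by (auto simp: eventually_sequentially)
          then show ?thesis by (rule tendsto_eventually)
        qed (simp add: \<psi>0)
      qed
    qed (use meas in auto)
    then have "(\<lambda>n. \<integral>p. \<psi> n p \<partial>m2) \<longlonglongrightarrow> 0" by simp
    then have "measure m1 (Kj j) \<le> 0" by (rule LIMSEQ_le_const) (use le in blast)
    then have "measure m1 (Kj j) = 0" using measure_nonneg[of m1 "Kj j"] by linarith
    then show ?thesis using finKj by (simp add: emeasure_eq_ennreal_measure less_top[symmetric])
  qed
  have "S \<subseteq> (\<Union>j. Kj j)"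
  proof
    fix p assume "p \<in> S"
    then have "p \<noteq> 0" "p \<in> bidisc" and p0: "snd p = 0" by (simp_all add: S_def)
    then have "fst p \<noteq> 0" "fst p \<in> ball 0 1" by (simp_all add: prod_eq_iff mem_Times_iff)
    then have p: "0 < norm (fst p)" "norm (fst p) < 1" by simp_all
    obtain j1 where j1: "1 / real (Suc j1) < norm (fst p)" using reals_Archimedean[OF p(1)] by (auto simp: divide_inverse)
    obtain j2 where j2: "1 / real (Suc j2) < 1 - norm (fst p)" using reals_Archimedean[of "1 - norm (fst p)"] p by (auto simp: divide_inverse)
    let ?j = "max j1 j2"
    have "1 / real (?j + 3) \<le> 1 / real (Suc j1)" "1 / real (?j + 3) \<le> 1 / real (Suc j2)"
      by (intro divide_left_mono; simp)+
    then have "1 / real (?j + 3) \<le> norm (fst p)" "norm (fst p) \<le> 1 - 1 / real (?j + 3)"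
      using j1 j2 by linarith+
    then have "p \<in> Kj ?j" unfolding Kj_def mem_Collect_eq using p0 by blast
    then show "p \<in> (\<Union>j. Kj j)" by blast
  qed
  then have "emeasure m1 S \<le> emeasure m1 (\<Union>j. Kj j)"
    by (rule emeasure_mono) (use closed_Kj sets1 in \<open>auto intro!: sets.countable_UN borel_closed\<close>)
  also have "\<dots> = 0"
    by (rule emeasure_UN_eq_0) (use zero closed_Kj sets1 in \<open>auto intro: borel_closed\<close>)
  finally show ?thesis unfolding S_def by simp
qed

text \<open>By complex linearity of the derivative, y maps holomorphic curves to holomorphic curves.
  The curves used are orbits of the flow and complex lines.\<close>

lemma holomorphic2_curve:
  assumes "(y has_derivative D) (at p)" "\<And>c v. D (cscale c v) = cscale c (D v)"
    and "(\<gamma> has_derivative (\<lambda>s. cscale s v)) (at t)" "\<gamma> t = p"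
  shows "((\<lambda>t. fst (y (\<gamma> t))) has_field_derivative fst (D v)) (at t)"
    "((\<lambda>t. snd (y (\<gamma> t))) has_field_derivative snd (D v)) (at t)"
proof -
  have "((\<lambda>t. y (\<gamma> t)) has_derivative (\<lambda>s. D (cscale s v))) (at t)"
    using has_derivative_compose[OF assms(3)] assms(1,4) by blast
  then have d: "((\<lambda>t. y (\<gamma> t)) has_derivative (\<lambda>s. cscale s (D v))) (at t)" by (simp only: assms(2))
  show "((\<lambda>t. fst (y (\<gamma> t))) has_field_derivative fst (D v)) (at t)"
    "((\<lambda>t. snd (y (\<gamma> t))) has_field_derivative snd (D v)) (at t)"
    unfolding has_field_derivative_def
    by (rule has_derivative_eq_rhs[OF has_derivative_fst[OF d]], simp add: cscale_def fun_eq_iff mult.commute,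
        rule has_derivative_eq_rhs[OF has_derivative_snd[OF d]], simp add: cscale_def fun_eq_iff mult.commute)
qed

lemma flow_derivative: "((\<lambda>t. flow mu lam t p) has_derivative (\<lambda>s. cscale s (vfield mu lam p))) (at 0)"
  unfolding flow_def cscale_def vfield_def
  by (auto intro!: derivative_eq_intros simp: fun_eq_iff)

lemma line_derivative: "((\<lambda>s. p + cscale s v) has_derivative (\<lambda>s. cscale s v)) (at t)"
proof -
  have "((\<lambda>s. (fst p + s * fst v, snd p + s * snd v)) has_derivative (\<lambda>s. (s * fst v, s * snd v))) (at t)"
    by (auto intro!: derivative_eq_intros)
  then show ?thesis by (simp add: cscale_def plus_prod_def)
qed

lemma holomorphic2_leaf_holomorphic:
  assumes "holomorphic2_on y U"
  shows "leaf_holomorphic_on U (\<lambda>p. fst (y p))" "leaf_holomorphic_on U (\<lambda>p. snd (y p))"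
proof -
  have c: "continuous_on U y"
    unfolding continuous_on_eq_continuous_within
    using assms unfolding holomorphic2_on_def
    by (meson continuous_at_imp_continuous_within has_derivative_continuous)
  have "(\<lambda>t. fst (y (flow mu lam t p))) field_differentiable (at 0)"
    "(\<lambda>t. snd (y (flow mu lam t p))) field_differentiable (at 0)" if p: "p \<in> U" for p
  proof -
    obtain D where D: "(y has_derivative D) (at p)" "\<And>c v. D (cscale c v) = cscale c (D v)"
      using assms p unfolding holomorphic2_on_def by blast
    from holomorphic2_curve[OF D flow_derivative flow_0]
    show "(\<lambda>t. fst (y (flow mu lam t p))) field_differentiable (at 0)"
      "(\<lambda>t. snd (y (flow mu lam t p))) field_differentiable (at 0)"
      unfolding field_differentiable_def by blast+
  qed
  then show "leaf_holomorphic_on U (\<lambda>p. fst (y p))" "leaf_holomorphic_on U (\<lambda>p. snd (y p))"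
    using c by (auto simp: leaf_holomorphic_on_def intro: continuous_on_fst continuous_on_snd)
qed

text \<open>Cauchy's estimate on the complex line, not the leaf, through p in the direction v of the
  vector field: with radius \<delta> / |v| it stays within distance 2 \<delta> of 0, where y is
  bounded by 1. The resulting bound is proportional to |v|, so its square compares with the leaf
  density uniformly as p tends to 0.\<close>

lemma holomorphic2_leaf_X_bound:
  assumes y: "holomorphic2_on y U" and \<delta>: "\<delta> > 0" and sub: "\<And>q. norm q \<le> 2 * \<delta> \<Longrightarrow> q \<in> U \<and> norm (y q) \<le> 1"
    and p: "norm p \<le> \<delta>"
  shows "(norm (leaf_X (\<lambda>p. fst (y p)) p))\<^sup>2 + (norm (leaf_X (\<lambda>p. snd (y p)) p))\<^sup>2 \<le> 2 / \<delta>\<^sup>2 * leaf_density p"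
proof -
  define v where "v = vfield mu lam p"
  have nv: "(norm v)\<^sup>2 = leaf_density p" by (simp add: v_def vfield_def norm_prod_def leaf_density_def)
  have pU: "p \<in> U" using sub[of p] p \<delta> by auto
  obtain D where D: "(y has_derivative D) (at p)" "\<And>c v. D (cscale c v) = cscale c (D v)"
    using y pU unfolding holomorphic2_on_def by blast
  have X: "leaf_X (\<lambda>p. fst (y p)) p = fst (D v)" "leaf_X (\<lambda>p. snd (y p)) p = snd (D v)"
    unfolding leaf_X_def v_def by (rule DERIV_imp_deriv; rule holomorphic2_curve[OF D flow_derivative flow_0])+
  have "norm (fst (D v)) \<le> norm v / \<delta> \<and> norm (snd (D v)) \<le> norm v / \<delta>"
  proof (cases "v = 0")
    case True
    then have "D v = 0" using linear_0[OF has_derivative_linear[OF D(1)]] by simp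
    then show ?thesis using \<delta> by simp
  next
    case False
    define R where "R = \<delta> / norm v"
    have R: "R > 0" using False \<delta> by (simp add: R_def)
    have norm_cscale: "norm (cscale s v) = norm s * norm v" for s
      by (simp add: cscale_def norm_prod_def norm_mult power_mult_distrib distrib_left[symmetric] real_sqrt_mult)
    have in_U: "p + cscale s v \<in> U" "norm (y (p + cscale s v)) \<le> 1" if "norm s \<le> R" for s
    proof -
      have "norm s * norm v \<le> \<delta>" using that False by (simp add: R_def field_simps)
      then have "norm (p + cscale s v) \<le> 2 * \<delta>"
        using p norm_triangle_ineq[of p "cscale s v"] norm_cscale[of s] by linarith
      then show "p + cscale s v \<in> U" "norm (y (p + cscale s v)) \<le> 1" using sub by auto
    qed
    have ex: "\<exists>D. (y has_derivative D) (at (p + cscale s v)) \<and> (\<forall>c v. D (cscale c v) = cscale c (D v))" if "norm s \<le> R" for s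
      using y in_U(1)[OF that] unfolding holomorphic2_on_def by blast
    have fd: "(\<lambda>s. fst (y (p + cscale s v))) field_differentiable (at s)" "(\<lambda>s. snd (y (p + cscale s v))) field_differentiable (at s)"
      if s: "norm s \<le> R" for s
    proof -
      obtain E where E: "(y has_derivative E) (at (p + cscale s v))" "\<And>c v. E (cscale c v) = cscale c (E v)"
        using ex[OF s] by blast
      show "(\<lambda>s. fst (y (p + cscale s v))) field_differentiable (at s)" "(\<lambda>s. snd (y (p + cscale s v))) field_differentiable (at s)"
        using holomorphic2_curve[OF E line_derivative refl] unfolding field_differentiable_def by blast+
    qed
    have hol: "(\<lambda>s. fst (y (p + cscale s v))) holomorphic_on cball 0 R" "(\<lambda>s. snd (y (p + cscale s v))) holomorphic_on cball 0 R"
      unfolding holomorphic_on_def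
      by (rule ballI, rule field_differentiable_at_within, rule fd(1), simp,
          rule ballI, rule field_differentiable_at_within, rule fd(2), simp)
    have cauchy: "norm (deriv f 0) \<le> 1 / R" if "f holomorphic_on cball 0 R" "\<And>s. norm s \<le> R \<Longrightarrow> norm (f s) \<le> 1" for f
    proof -
      have "norm ((deriv ^^ 1) f 0) \<le> fact 1 * 1 / R ^ 1"
        using that R by (intro Cauchy_inequality) (auto intro: holomorphic_on_subset holomorphic_on_imp_continuous_on)
      then show ?thesis by simp
    qed
    have z: "p + cscale 0 v = p" by (simp add: cscale_def zero_prod_def[symmetric])
    have der: "deriv (\<lambda>s. fst (y (p + cscale s v))) 0 = fst (D v)" "deriv (\<lambda>s. snd (y (p + cscale s v))) 0 = snd (D v)"
      by (rule DERIV_imp_deriv; rule holomorphic2_curve[OF D line_derivative z])+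
    have "norm (fst (y (p + cscale s v))) \<le> 1" "norm (snd (y (p + cscale s v))) \<le> 1" if "norm s \<le> R" for s
      using in_U(2)[OF that] norm_fst_le[of "fst (y (p + cscale s v))" "snd (y (p + cscale s v))"]
        norm_snd_le[of "snd (y (p + cscale s v))" "fst (y (p + cscale s v))"] by auto
    then show ?thesis using cauchy[OF hol(1)] cauchy[OF hol(2)] unfolding der by (simp add: R_def)
  qed
  then have "(norm (fst (D v)))\<^sup>2 + (norm (snd (D v)))\<^sup>2 \<le> (norm v / \<delta>)\<^sup>2 + (norm v / \<delta>)\<^sup>2"
    by (intro add_mono power_mono) auto
  also have "\<dots> = 2 / \<delta>\<^sup>2 * leaf_density p" by (simp add: power_divide nv)
  finally show ?thesis unfolding X .
qed

end

context hyperbolic_flow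
begin

text \<open>The density of the mass measure for the coordinates y relative to the one for the
  standard coordinates: the quotient of the two coefficients given by
  \<open>leaf_laplacian_norm\<close>.\<close>

definition coord_density :: "(pt \<Rightarrow> pt) \<Rightarrow> pt \<Rightarrow> real" where
  "coord_density y p =
     ((norm (leaf_X (\<lambda>p. fst (y p)) p))\<^sup>2 + (norm (leaf_X (\<lambda>p. snd (y p)) p))\<^sup>2) / leaf_density p"

lemma coord_density_nonneg: "0 \<le> coord_density y p"
  by (simp add: coord_density_def leaf_density_def)

definition coord_measure :: "pt measure \<Rightarrow> pt set \<Rightarrow> (pt \<Rightarrow> pt) \<Rightarrow> pt measure" where
  "coord_measure m U y = density m (\<lambda>p. ennreal (indicator (U - {0}) p * coord_density y p))"

section \<open>The mass measure in the coordinates y\<close>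

context
  fixes T m U and y :: "pt \<Rightarrow> pt"
  assumes m: "mass_measure mu lam T bidisc (\<lambda>p. p) m"
    and U: "open U" "U \<subseteq> bidisc" and y: "holomorphic2_on y U"
begin

lemma sets_m: "sets m = sets borel"
  using m by (simp add: mass_measure_def)

lemma open_punctured: "open (U - {0})"
  using U by (simp add: open_Diff)

lemma leaf_X_hol:
  "leaf_holomorphic_on U (leaf_X (\<lambda>p. fst (y p)))" "leaf_holomorphic_on U (leaf_X (\<lambda>p. snd (y p)))"
  by (rule leaf_holomorphic_X[OF U(1) holomorphic2_leaf_holomorphic(1)[OF y]],
      rule leaf_holomorphic_X[OF U(1) holomorphic2_leaf_holomorphic(2)[OF y]])

text \<open>Away from 0 the denominator is positive and X of a holomorphic function is leafwise
  smooth. Smoothness of the quotient is what allows it to multiply test functions.\<close>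

lemma leaf_smooth_coord_density: "leaf_Ck (U - {0}) k (\<lambda>p. of_real (coord_density y p))"
proof -
  let ?V = "U - {0}"
  note V = open_punctured
  have X: "leaf_Ck ?V k (leaf_X (\<lambda>p. fst (y p)))" "leaf_Ck ?V k (leaf_X (\<lambda>p. snd (y p)))"
    using leaf_Ck_holomorphic[OF U(1) leaf_X_hol(1)] leaf_Ck_holomorphic[OF U(1) leaf_X_hol(2)] leaf_Ck_subset by blast+
  have lin: "leaf_Ck ?V k (\<lambda>p. mu * fst p)" "leaf_Ck ?V k (\<lambda>p. lam * snd p)"
    by (rule leaf_Ck_mult[OF V leaf_Ck_const[OF V] leaf_Ck_fst[OF V]], rule leaf_Ck_mult[OF V leaf_Ck_const[OF V] leaf_Ck_snd[OF V]])
  have "leaf_Ck ?V k (\<lambda>p. of_real ((norm (mu * fst p))\<^sup>2) + of_real ((norm (lam * snd p))\<^sup>2))"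
    by (rule leaf_Ck_add[OF V leaf_Ck_norm_square[OF V lin(1)] leaf_Ck_norm_square[OF V lin(2)]])
  then have d: "leaf_Ck ?V k (\<lambda>p. of_real (leaf_density p))"
    by (simp add: leaf_density_def)
  have "leaf_Ck ?V k (\<lambda>p. inverse (of_real (leaf_density p)))"
  proof (rule leaf_Ck_inverse[OF V _ d])
    show "complex_of_real (leaf_density p) \<noteq> 0" if "p \<in> ?V" for p
      using leaf_density_pos[OF mu lam, of p] that by simp
  qed
  from leaf_Ck_mult[OF V leaf_Ck_add[OF V leaf_Ck_norm_square[OF V X(1)] leaf_Ck_norm_square[OF V X(2)]] this]
  show ?thesis by (simp add: coord_density_def divide_inverse)
qed

lemma continuous_coord_density: "continuous_on (U - {0}) (coord_density y)"
  using continuous_on_Re[OF leaf_Ck_continuous[OF leaf_smooth_coord_density]] by simp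

lemma measurable_coord_density:
  "(\<lambda>p. indicator (U - {0}) p * coord_density y p) \<in> borel_measurable borel"
  using borel_measurable_continuous_on_indicator[OF borel_open[OF open_punctured] continuous_coord_density]
  by (simp only: real_scaleR_def)

lemma emeasure_coord_measure:
  assumes "S \<in> sets borel"
  shows "emeasure (coord_measure m U y) S =
    (\<integral>\<^sup>+p. ennreal (indicator (U - {0}) p * coord_density y p) * indicator S p \<partial>m)"
proof -
  note [simp, measurable_cong] = sets_m
  note [measurable] = measurable_coord_density
  show ?thesis unfolding coord_measure_def by (rule emeasure_density) (use assms in auto)
qed

text \<open>For a test function \<phi> supported in U, the product of \<phi> and
  \<open>coord_density y\<close> is again a test function. The defining identity of m for this
  product is the one required for \<phi>, since the two forms agree pointwise.\<close>

lemma mass_measure_coord: "mass_measure mu lam T U y (coord_measure m U y)"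
  unfolding mass_measure_def
proof (intro conjI allI impI ballI)
  note [simp, measurable_cong] = sets_m
  note [measurable] = measurable_coord_density
  show "sets (coord_measure m U y) = sets borel" by (simp add: coord_measure_def)
  have c: "- (U - {0}) \<in> sets borel"
    by (rule borel_closed, rule closed_Compl[OF open_punctured])
  have "(\<integral>\<^sup>+p. ennreal (indicator (U - {0}) p * coord_density y p) * indicator (- (U - {0})) p \<partial>m) = (\<integral>\<^sup>+p. 0 \<partial>m)"
    by (rule nn_integral_cong) (auto simp: indicator_def)
  then show "emeasure (coord_measure m U y) (- (U - {0})) = 0"
    unfolding emeasure_coord_measure[OF c] by simp
  show "emeasure (coord_measure m U y) K < \<infinity>" if K: "compact K \<and> K \<subseteq> U - {0}" for K
  proof -
    have "bounded (coord_density y ` K)"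
      using K continuous_on_subset[OF continuous_coord_density] by (auto intro!: compact_imp_bounded compact_continuous_image)
    then obtain C where "\<forall>x\<in>coord_density y ` K. norm x \<le> C" unfolding bounded_iff by blast
    then have C: "coord_density y p \<le> C" if "p \<in> K" for p
      using that abs_ge_self[of "coord_density y p"] by fastforce
    have Ks: "K \<in> sets borel" using K by (auto intro: borel_closed compact_imp_closed)
    have "emeasure (coord_measure m U y) K \<le> (\<integral>\<^sup>+p. ennreal C * indicator K p \<partial>m)"
      unfolding emeasure_coord_measure[OF Ks]
      by (intro nn_integral_mono) (use K C in \<open>auto simp: indicator_def intro!: ennreal_leI\<close>)
    also have "\<dots> = ennreal C * emeasure m K" using Ks by (simp add: nn_integral_cmult_indicator)
    also have "\<dots> < \<infinity>"
    proof -
      have "K \<subseteq> punctured_bidisc" using K U by auto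
      then have "emeasure m K < \<infinity>" using m K by (simp add: mass_measure_def)
      then show ?thesis by (simp add: ennreal_mult_less_top)
    qed
    finally show ?thesis .
  qed
  show "(\<integral>p. \<phi> p \<partial>coord_measure m U y) = T (\<lambda>p a b. \<phi> p * i_ddbar mu lam (\<lambda>q. of_real ((norm (y q))\<^sup>2)) p a b)"
    if \<phi>: "\<phi> \<in> test_functions mu lam" and sub: "closure {p. \<phi> p \<noteq> 0} \<subseteq> U" for \<phi>
  proof -
    define K where "K = closure {p. \<phi> p \<noteq> 0}"
    have K: "compact K" "K \<subseteq> U - {0}" using \<phi> sub by (auto simp: test_functions_def K_def)
    have \<phi>0: "\<phi> p = 0" if "p \<notin> K" for p using that closure_subset[of "{p. \<phi> p \<noteq> 0}"] by (auto simp: K_def)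
    define \<psi> where "\<psi> p = \<phi> p * of_real (coord_density y p)" for p
    have Usub: "U - {0} \<subseteq> punctured_bidisc" using U by auto
    have "leaf_Ck (U - {0}) k \<psi>" for k
    proof -
      have "leaf_Ck punctured_bidisc k \<phi>" using test_functionsD(1)[OF \<phi>] by (simp add: leaf_smooth_on_def)
      from leaf_Ck_mult[OF open_punctured leaf_Ck_subset[OF this Usub] leaf_smooth_coord_density]
      show ?thesis by (simp only: \<psi>_def[abs_def])
    qed
    then have \<psi>: "\<psi> \<in> test_functions mu lam"
      by (intro test_functionsI[OF open_punctured K Usub]) (simp_all add: leaf_smooth_on_def \<psi>_def \<phi>0)
    have meas: "\<phi> \<in> borel_measurable m"
      using borel_measurable_continuous_onI[OF test_functionsD(2)[OF \<phi>]] by (simp cong: measurable_cong_sets)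
    have "(\<integral>p. \<phi> p \<partial>coord_measure m U y) = (\<integral>p. (indicator (U - {0}) p * coord_density y p) *\<^sub>R \<phi> p \<partial>m)"
      unfolding coord_measure_def
      by (rule integral_density) (use meas in \<open>auto simp: coord_density_nonneg\<close>)
    also have "\<dots> = (\<integral>p. \<psi> p \<partial>m)"
    proof (rule Bochner_Integration.integral_cong[OF refl])
      show "(indicator (U - {0}) p * coord_density y p) *\<^sub>R \<phi> p = \<psi> p" for p
      proof (cases "p \<in> K")
        case True
        then have "p \<in> U - {0}" using K(2) by blast
        then show ?thesis by (simp add: \<psi>_def scaleR_conv_of_real)
      qed (simp add: \<psi>_def \<phi>0)
    qed
    also have "\<dots> = T (\<lambda>p a b. \<psi> p * i_ddbar mu lam (\<lambda>q. of_real ((norm q)\<^sup>2)) p a b)"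
    proof -
      have "closure {p. \<psi> p \<noteq> 0} \<subseteq> bidisc" using \<psi> by (auto simp: test_functions_def)
      then show ?thesis using m \<psi> unfolding mass_measure_def by blast
    qed
    also have "(\<lambda>p a b. \<psi> p * i_ddbar mu lam (\<lambda>q. of_real ((norm q)\<^sup>2)) p a b)
        = (\<lambda>p a b. \<phi> p * i_ddbar mu lam (\<lambda>q. of_real ((norm (y q))\<^sup>2)) p a b)"
    proof (intro ext)
      fix p a b
      show "\<psi> p * i_ddbar mu lam (\<lambda>q. of_real ((norm q)\<^sup>2)) p a b
        = \<phi> p * i_ddbar mu lam (\<lambda>q. of_real ((norm (y q))\<^sup>2)) p a b"
      proof (cases "p \<in> K")
        case True
        then have p: "p \<in> U" "p \<noteq> 0" using K(2) by auto
        have "coord_density y p * leaf_density p =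
            (norm (leaf_X (\<lambda>p. fst (y p)) p))\<^sup>2 + (norm (leaf_X (\<lambda>p. snd (y p)) p))\<^sup>2"
          using leaf_density_pos[OF mu lam p(2)] by (simp add: coord_density_def)
        then have "complex_of_real (coord_density y p) * of_real (leaf_density p) =
            leaf_dt mu lam (leaf_dtbar mu lam (\<lambda>q. of_real ((norm (y q))\<^sup>2))) p"
          unfolding leaf_laplacian_norm[OF U(1) p(1) holomorphic2_leaf_holomorphic[OF y]] of_real_mult[symmetric] by simp
        then show ?thesis
          unfolding i_ddbar_def \<psi>_def leaf_laplacian_norm_id by (simp add: mult.assoc[symmetric])
      qed (simp add: \<psi>_def \<phi>0)
    qed
    finally show ?thesis .
  qed
qed

lemma coord_density_bounded:
  assumes "0 \<in> U" "y 0 = 0"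
  shows "\<exists>\<delta>>0. \<exists>C>0. \<forall>p. norm p \<le> \<delta> \<longrightarrow> p \<noteq> 0 \<longrightarrow> coord_density y p \<le> C"
proof -
  have "continuous (at 0) y"
    using y assms(1) unfolding holomorphic2_on_def by (meson has_derivative_continuous)
  then obtain d where d: "d > 0" "\<And>q. norm q < d \<Longrightarrow> norm (y q) < 1"
    unfolding continuous_at_eps_delta assms(2) by (metis diff_zero zero_less_one dist_norm)
  obtain e where e: "e > 0" "ball 0 e \<subseteq> U" using U(1) assms(1) open_contains_ball by blast
  \<comment> \<open>A third, so that the closed ball of radius 2 \<delta> fits into both open
    balls.\<close>
  define \<delta> where "\<delta> = min d e / 3"
  have \<delta>: "\<delta> > 0" using d e by (simp add: \<delta>_def)
  have sub: "q \<in> U \<and> norm (y q) \<le> 1" if "norm q \<le> 2 * \<delta>" for q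
  proof -
    have "norm q < d" "norm q < e" using that \<delta> by (auto simp: \<delta>_def min_def split: if_splits)
    then show ?thesis using d(2)[of q] e(2) by auto
  qed
  have "coord_density y p \<le> 2 / \<delta>\<^sup>2" if "norm p \<le> \<delta>" "p \<noteq> 0" for p
    using holomorphic2_leaf_X_bound[OF y \<delta> sub that(1)] leaf_density_pos[OF mu lam that(2)]
    by (simp add: coord_density_def pos_divide_le_eq)
  moreover have "2 / \<delta>\<^sup>2 > 0" using \<delta> by simp
  ultimately show ?thesis using \<delta> by blast
qed

end

text \<open>The inverse coordinate map is differentiable at 0 and fixes 0, so it grows at most
  linearly there. Hence small balls in the coordinates y lie in Euclidean balls of comparable
  radius.\<close>

lemma coord_lipschitz:
  assumes "biholomorphic_coordinate U y" "0 \<in> U" "y 0 = 0"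
  shows "\<exists>\<eta>>0. \<exists>C>0. \<forall>p\<in>U. norm (y p) < \<eta> \<longrightarrow> norm p \<le> C * norm (y p)"
proof -
  let ?x = "inv_into U y"
  have inj: "inj_on y U" and x: "holomorphic2_on ?x (y ` U)"
    using assms(1) by (auto simp: biholomorphic_coordinate_def)
  have x0: "?x 0 = 0" using inv_into_f_f[OF inj assms(2)] assms(3) by simp
  have "0 \<in> y ` U" using assms(2,3) by force
  then obtain D where D: "(?x has_derivative D) (at 0)" using x unfolding holomorphic2_on_def by blast
  then obtain d where d: "d > 0" "\<And>q. norm q < d \<Longrightarrow> norm (?x q - D q) \<le> norm q"
    unfolding has_derivative_at_alt x0 by (metis diff_zero mult_1 zero_less_one)
  obtain K where K: "K > 0" "\<And>q. norm (D q) \<le> norm q * K"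
    using bounded_linear.pos_bounded[OF has_derivative_bounded_linear[OF D]] by blast
  have "norm p \<le> (K + 1) * norm (y p)" if "p \<in> U" "norm (y p) < d" for p
  proof -
    have "norm (?x (y p)) \<le> norm (?x (y p) - D (y p)) + norm (D (y p))"
      using norm_triangle_ineq[of "?x (y p) - D (y p)" "D (y p)"] by simp
    also have "\<dots> \<le> norm (y p) + norm (y p) * K" using d(2)[OF that(2)] K(2) by (intro add_mono)
    finally show ?thesis using inv_into_f_f[OF inj that(1)] by (simp add: algebra_simps)
  qed
  moreover have "K + 1 > 0" using K by simp
  ultimately show ?thesis using d by blast
qed

text \<open>For small r the y-ball of radius r lies in a Euclidean ball of radius L r, where the
  density is at most C off 0; its mass is thus at most C times o(r^2).\<close>

lemma coord_measure_lelong: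
  assumes m: "mass_measure mu lam T bidisc (\<lambda>p. p) m"
    and small: "\<And>\<epsilon>. \<epsilon> > 0 \<Longrightarrow> \<exists>\<rho>0>0. \<forall>\<rho>. 0 < \<rho> \<and> \<rho> < \<rho>0 \<longrightarrow> emeasure m {p. (norm p)\<^sup>2 < \<rho>} \<le> ennreal (\<epsilon> * \<rho>)"
    and y: "biholomorphic_coordinate U y" "0 \<in> U" "y 0 = 0"
  shows "((\<lambda>r. emeasure (coord_measure m U y) {p \<in> U. norm (y p) < r} / ennreal (pi * r\<^sup>2)) \<longlongrightarrow> 0) (at_right 0)"
proof -
  have U: "open U" "U \<subseteq> bidisc" and hol: "holomorphic2_on y U" using y(1) by (auto simp: biholomorphic_coordinate_def)
  have sets_m: "sets m = sets borel" using m by (simp add: mass_measure_def)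
  obtain \<delta> C where \<delta>: "\<delta> > 0" and C: "C > 0" and dens: "\<And>p. norm p \<le> \<delta> \<Longrightarrow> p \<noteq> 0 \<Longrightarrow> coord_density y p \<le> C"
    using coord_density_bounded[OF m U hol y(2,3)] by blast
  obtain \<eta> L where \<eta>: "\<eta> > 0" and L: "L > 0" and lip: "\<And>p. p \<in> U \<Longrightarrow> norm (y p) < \<eta> \<Longrightarrow> norm p \<le> L * norm (y p)"
    using coord_lipschitz[OF y] by blast
  have cont: "continuous_on U y"
    unfolding continuous_on_eq_continuous_within
    using hol unfolding holomorphic2_on_def by (meson continuous_at_imp_continuous_within has_derivative_continuous)
  have ev: "\<forall>\<^sub>F r in at_right 0. emeasure (coord_measure m U y) {p \<in> U. norm (y p) < r} / ennreal (pi * r\<^sup>2) \<le> ennreal e"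
    if e: "e > 0" for e
  proof -
    \<comment> \<open>Chosen so that C \<epsilon> (L r)^2 = e pi r^2.\<close>
    define \<epsilon> where "\<epsilon> = e * pi / (C * L\<^sup>2)"
    have \<epsilon>: "\<epsilon> > 0" using e C L by (simp add: \<epsilon>_def)
    obtain \<rho>0 where \<rho>0: "\<rho>0 > 0" "\<And>\<rho>. 0 < \<rho> \<Longrightarrow> \<rho> < \<rho>0 \<Longrightarrow> emeasure m {p. (norm p)\<^sup>2 < \<rho>} \<le> ennreal (\<epsilon> * \<rho>)"
      using small[OF \<epsilon>] by blast
    define r0 where "r0 = min \<eta> (min (\<delta> / L) (sqrt \<rho>0 / L))"
    have r0: "r0 > 0" using \<eta> \<delta> L \<rho>0 by (simp add: r0_def)
    have "emeasure (coord_measure m U y) {p \<in> U. norm (y p) < r} / ennreal (pi * r\<^sup>2) \<le> ennreal e"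
      if r: "0 < r" "r < r0" for r
    proof -
      have r': "r < \<eta>" "L * r < \<delta>" "L * r < sqrt \<rho>0"
        using r L by (auto simp: r0_def field_simps)
      have "(L * r)\<^sup>2 < (sqrt \<rho>0)\<^sup>2" using r' r L by (intro power_strict_mono) auto
      then have Lr: "0 < (L * r)\<^sup>2" "(L * r)\<^sup>2 < \<rho>0" using r L \<rho>0 by auto
      define S where "S = {p \<in> U. norm (y p) < r}"
      have "open (U \<inter> y -` ball 0 r)" by (rule continuous_open_preimage[OF cont U(1) open_ball])
      moreover have "S = U \<inter> y -` ball 0 r" by (auto simp: S_def)
      ultimately have S: "S \<in> sets borel" by (simp add: borel_open)
      define Bl where "Bl = {p :: pt. (norm p)\<^sup>2 < (L * r)\<^sup>2}"
      have "open Bl" unfolding Bl_def by (intro open_Collect_less continuous_intros)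
      then have Bl: "Bl \<in> sets m" using sets_m by simp
      have incl: "norm p \<le> \<delta> \<and> p \<in> Bl" if "p \<in> S" for p
      proof -
        have p: "p \<in> U" "norm (y p) < r" using that by (auto simp: S_def)
        then have "norm p \<le> L * norm (y p)" using lip r' by auto
        also have "\<dots> < L * r" using p L by simp
        finally have "norm p < L * r" .
        then show ?thesis using r' by (auto simp: Bl_def intro!: power_strict_mono)
      qed
      have "emeasure (coord_measure m U y) S \<le> (\<integral>\<^sup>+p. ennreal C * indicator Bl p \<partial>m)"
        unfolding emeasure_coord_measure[OF m U hol S]
      proof (rule nn_integral_mono)
        fix p
        show "ennreal (indicator (U - {0}) p * coord_density y p) * indicator S p \<le> ennreal C * indicator Bl p"
          using incl[of p] dens[of p] by (cases "p \<in> S"; cases "p = 0") (auto simp: indicator_def intro!: ennreal_leI)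
      qed
      also have "\<dots> = ennreal C * emeasure m Bl" using Bl by (simp add: nn_integral_cmult_indicator)
      also have "\<dots> \<le> ennreal C * ennreal (\<epsilon> * (L * r)\<^sup>2)"
        unfolding Bl_def using \<rho>0(2)[OF Lr] by (rule mult_left_mono) simp
      also have "\<dots> = ennreal (C * (\<epsilon> * (L * r)\<^sup>2))" using C \<epsilon> by (simp add: ennreal_mult)
      also have "C * (\<epsilon> * (L * r)\<^sup>2) = e * (pi * r\<^sup>2)"
        using C L by (simp add: \<epsilon>_def power_mult_distrib)
      finally have le: "emeasure (coord_measure m U y) S \<le> ennreal (e * (pi * r\<^sup>2))" .
      have "emeasure (coord_measure m U y) S / ennreal (pi * r\<^sup>2) \<le> ennreal (e * (pi * r\<^sup>2)) / ennreal (pi * r\<^sup>2)"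
        by (rule divide_right_mono_ennreal[OF le])
      also have "\<dots> = ennreal e" using r e by (simp add: divide_ennreal)
      finally show ?thesis by (simp only: S_def)
    qed
    then show ?thesis using r0 by (auto simp: eventually_at_right_field)
  qed
  show ?thesis
  proof (rule order_tendstoI)
    fix a :: ennreal assume "0 < a"
    then obtain b where b: "0 < b" "b < a" using dense by blast
    then have "b \<noteq> top" by auto
    then obtain e where e: "b = ennreal e" "e \<ge> 0" by (cases b) auto
    then have "e > 0" using b by (cases "e = 0") auto
    from ev[OF this] show "\<forall>\<^sub>F r in at_right 0. emeasure (coord_measure m U y) {p \<in> U. norm (y p) < r} / ennreal (pi * r\<^sup>2) < a"
      by eventually_elim (use b e in auto)
  qed simp
qed

end

theorem theorem1p2:
  fixes mu lam :: complex and T :: "form \<Rightarrow> complex"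
  assumes "mu \<noteq> 0" and "lam \<noteq> 0" and "lam / mu \<notin> \<real>"
    and "harmonic_current mu lam T"
    and "gives_no_mass mu lam T ({p \<in> bidisc. fst p = 0} - {0})"
    and "gives_no_mass mu lam T ({p \<in> bidisc. snd p = 0} - {0})"
  shows "has_lelong_number mu lam T 0 0"
proof -
  interpret hyperbolic_flow mu lam by unfold_locales (rule assms)+
  obtain m where m: "mass_measure mu lam T bidisc (\<lambda>p. p) m"
    and null1: "emeasure m ({p \<in> bidisc. fst p = 0} - {0}) = 0"
    using assms(5) by (auto simp: gives_no_mass_def)
  obtain m' where m': "mass_measure mu lam T bidisc (\<lambda>p. p) m'"
    and "emeasure m' ({p \<in> bidisc. snd p = 0} - {0}) = 0"
    using assms(6) by (auto simp: gives_no_mass_def)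
  \<comment> \<open>The two hypotheses on the separatrices come with separate measures, but both
    null sets are needed for one and the same measure.\<close>
  then have null2: "emeasure m ({p \<in> bidisc. snd p = 0} - {0}) = 0"
    by (rule axis_null_transfer[OF m])
  have sets_m: "sets m = sets borel" and null0: "emeasure m (- punctured_bidisc) = 0"
    using m by (simp_all add: mass_measure_def)
  have axes_closed: "closed {p :: pt. fst p = 0}" "closed {p :: pt. snd p = 0}"
    by (intro closed_Collect_eq continuous_intros)+
  have eqs: "{p \<in> bidisc. fst p = 0} - {0} = punctured_bidisc \<inter> {p. fst p = 0}"
    "{p \<in> bidisc. snd p = 0} - {0} = punctured_bidisc \<inter> {p. snd p = 0}" by auto
  have s: "punctured_bidisc \<inter> {p. fst p = 0} \<in> sets m" "punctured_bidisc \<inter> {p. snd p = 0} \<in> sets m"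
    "- punctured_bidisc \<in> sets m"
    unfolding sets_m
    by (rule sets.Int[OF borel_open[OF open_punctured_bidisc] borel_closed[OF axes_closed(1)]],
        rule sets.Int[OF borel_open[OF open_punctured_bidisc] borel_closed[OF axes_closed(2)]],
        rule borel_closed, rule closed_Compl[OF open_punctured_bidisc])
  have ae: "AE p in m. p \<notin> N" if "N \<in> sets m" "emeasure m N = 0" for N
    by (rule AE_not_in[OF null_setsI[OF that(2,1)]])
  \<comment> \<open>Both separatrices and the complement of the punctured bidisc are null, so almost
    every point has logarithmic coordinates.\<close>
  have AE: "AE p in m. p \<in> off_axes"
    using ae[OF s(1) null1[unfolded eqs]] ae[OF s(2) null2[unfolded eqs]] ae[OF s(3) null0]
  proof eventually_elim
    case (elim p)
    then have "p \<in> punctured_bidisc" by blast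
    then show ?case using elim by (simp add: off_axes_def)
  qed
  show ?thesis
    unfolding has_lelong_number_def
  proof (intro allI impI)
    fix U y assume y: "biholomorphic_coordinate U y \<and> 0 \<in> U \<and> y 0 = 0"
    then have "mass_measure mu lam T U y (coord_measure m U y)"
      using m by (intro mass_measure_coord) (auto simp: biholomorphic_coordinate_def)
    moreover have "((\<lambda>r. emeasure (coord_measure m U y) {p \<in> U. norm (y p) < r} / ennreal (pi * r\<^sup>2)) \<longlongrightarrow> ennreal 0) (at_right 0)"
      using coord_measure_lelong[OF m ball_mass_bound[OF assms(4) m AE]] y by simp
    ultimately show "\<exists>m. mass_measure mu lam T U y m \<and>
        ((\<lambda>r. emeasure m {p \<in> U. norm (y p) < r} / ennreal (pi * r\<^sup>2)) \<longlongrightarrow> ennreal 0) (at_right 0)" by blast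
  qed
qed

end
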